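(* Let $P$ be a (classical) PRO and let $\mathcal{P}$ be its globularization. The algebras for the globular PRO $\mathcal{P}$ are exactly the strict $\omega$-categories which are algebras for $P$ whose operations in $P$ are given by strict $\omega$-functors. That is, to give a globular set $A$ (regarded as a degenerate collection) the structure of an algebra for $\mathcal{P}$ is exactly to give $A$ the structure of a strict $\omega$-category together with the structure of an algebra in $\mathbf{Glob}$ for the PRO $P$ such that every operation in $P(n,m)$ acts by a strict $\omega$-functor $A^n\to A^m$, for all $n,m\in\mathbb{N}$.
   Context: **Collections.** A globular set is a family of sets $X_k$ ($k\ge 0$) with source and target maps $s,t:X_{k+1}\to X_k$ satisfying $ss=st$, $ts=tt$; $\mathbf{Glob}$ is the category of globular sets, $\mathbf{1}$ its terminal object, $!_X:X\to\mathbf{1}$ the unique map. $(\mathcal{T},\mu,\eta)$ is the free strict $\omega$-category monad on $\mathbf{Glob}$. A collection is a globular set $X$ with a map $x:X\to\mathcal{T}(\mathbf{1})$ (arity map); $\mathbf{Col}=\mathbf{Glob}/\mathcal{T}(\mathbf{1})$. The cartesian product $\times$ in $\mathbf{Col}$ is the fibre product over $\mathcal{T}(\mathbf{1})$; its unit is the terminal collection $\mathrm{id}:\mathcal{T}(\mathbf{1})\to\mathcal{T}(\mathbf{1})$, written $\mathcal{T}(\mathbf{1})$. The composition tensor product $X\square Y$ of $x$ and $y:Y\to\mathcal{T}(\mathbf{1})$ has underlying globular set the pullback of $x$ and $\mathcal{T}(!_Y):\mathcal{T}(Y)\to\mathcal{T}(\mathbf{1})$, with arity map $X\square Y\to\mathcal{T}(Y)\xrightarrow{\mathcal{T}(y)}\mathcal{T}^2(\mathbf{1})\xrightarrow{\mu_{\mathbf{1}}}\mathcal{T}(\mathbf{1})$.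 This is a monoidal structure with unit $I=(\eta_{\mathbf{1}}:\mathbf{1}\to\mathcal{T}(\mathbf{1}))$. The interchange map $\boxtimes:(A\times B)\square(C\times D)\to(A\square C)\times(B\square D)$ is the canonical map induced by the projections. **Degenerate collections.** $[id]:\mathbf{1}\to\mathcal{T}(\mathbf{1})$ is the map sending the unique $k$-cell to the $k$-fold iterated identity on the unique $0$-cell. A collection $a:A\to\mathcal{T}(\mathbf{1})$ is degenerate if $a=[id]\circ{!_A}$; every globular set is regarded as a degenerate collection in this way. **PRO and its algebras.** A PRO $P$ is a strict monoidal category with object set (identified with) $\mathbb{N}$ whose monoidal product $+$ is addition on objects. An algebra for $P$ in $\mathbf{Glob}$ is a globular set $A$ with functions $P(n,m)\to\mathbf{Glob}(A^n,A^m)$ for all $n,m$ (cartesian powers in $\mathbf{Glob}$) that preserve composition and identities and send $+$ to the cartesian product of maps (i.e. a strict monoidal functor from $P$ to the endomorphism PRO of $A$). If $A$ is a strict $\omega$-category, $A^n$ carries the product $\omega$-category structure. **Globularization.** $\mathcal{P}(n,m)=P(n,m)\cdot\mathcal{T}(\mathbf{1})=\coprod_{P(n,m)}\mathcal{T}(\mathbf{1})$ in $\mathbf{Col}$, for $n,m\in\mathbb{N}$. Since $\square$ and $\times$ distribute over coproducts in each variable, $\mathcal{P}(m,p)\square\mathcal{P}(n,m)\cong(P(m,p)\times P(n,m))\cdot(\mathcal{T}(\mathbf{1})\square\mathcal{T}(\mathbf{1}))$ and $\mathcal{P}(n,m)\times\mathcal{P}(l,k)\cong(P(n,m)\times P(l,k))\cdot(\mathcal{T}(\mathbf{1})\times\mathcal{T}(\mathbf{1}))$.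 Composition $\circ_{n,m,p}:\mathcal{P}(m,p)\square\mathcal{P}(n,m)\to\mathcal{P}(n,p)$ is $\circ^P\cdot\phi$ with $\phi:\mathcal{T}(\mathbf{1})\square\mathcal{T}(\mathbf{1})\to\mathcal{T}(\mathbf{1})$ the unique map to the terminal collection; the sum $+_{n,m,l,k}:\mathcal{P}(n,m)\times\mathcal{P}(l,k)\to\mathcal{P}(n+l,m+k)$ is $+^P\cdot\Phi$ with $\Phi:\mathcal{T}(\mathbf{1})\times\mathcal{T}(\mathbf{1})\cong\mathcal{T}(\mathbf{1})$ canonical; $j_n:I\to\mathcal{P}(n,n)$ is $\eta_{\mathbf{1}}$ followed by the inclusion of the summand indexed by the identity of $n$. These data form a globular PRO, i.e. a strict monoidal category enriched over $\mathbf{Col}$ (enriched with respect to $\square$, with monoidal product $+$ formed with respect to $\times$) with object set $\mathbb{N}$ and $+$ given by addition on objects. **Algebra for a globular PRO** $\mathcal{P}$: a degenerate collection $A$ with collection homomorphisms $\Omega_{n,m}:\mathcal{P}(n,m)\square A^n\to A^m$ for all $n,m\in\mathbb{N}$ (cartesian powers in $\mathbf{Col}$; the paper takes $A^0$ to be the terminal collection) such that for all indices, suppressing associators of $\square$: (i) $\Omega_{m,r}(\mathrm{id}\square\Omega_{n,m})=\Omega_{n,r}(\circ_{n,m,r}\square\mathrm{id}_{A^n})$ on $\mathcal{P}(m,r)\square\mathcal{P}(n,m)\square A^n$; (ii) $\Omega_{n+r,m+s}(+_{n,m,r,s}\square\mathrm{id}_{A^{n+r}})=(\Omega_{n,m}\times\Omega_{r,s})\boxtimes$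 on $[\mathcal{P}(n,m)\times\mathcal{P}(r,s)]\square[A^n\times A^r]$; (iii) $\Omega_{n,n}(j_n\square\mathrm{id}_{A^n})$ is the left unitor $I\square A^n\to A^n$.
   Formalization: With A^0 the terminal collection the claim fails if some P(0,m), m>0, is inhabited (e.g. monoids, A terminal); it is proved for every PRO with A^0 the degenerate collection 1, and with A^0 = T(1) when P(0,m) is empty for all m>0. *)

theory Defs
  imports Main
begin

section \<open>Globular sets and strict omega-categories\<close>

text \<open>Cells of different dimensions may share carrier elements, so every operation carries
  the dimension as an argument: \<open>src X k\<close> and \<open>tgt X k\<close> go from \<open>cells X (Suc k)\<close> to \<open>cells X k\<close>,
  and a map of globular sets is a family \<open>f k\<close>.\<close>

record 'a gset =
  cells :: "nat \<Rightarrow> 'a set"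
  src :: "nat \<Rightarrow> 'a \<Rightarrow> 'a"
  tgt :: "nat \<Rightarrow> 'a \<Rightarrow> 'a"

definition globular_set :: "('a, 'x) gset_scheme \<Rightarrow> bool" where
  "globular_set X \<longleftrightarrow>
    (\<forall>k. \<forall>x\<in>cells X (Suc k). src X k x \<in> cells X k \<and> tgt X k x \<in> cells X k) \<and>
    (\<forall>k. \<forall>x\<in>cells X (Suc (Suc k)).
       src X k (src X (Suc k) x) = src X k (tgt X (Suc k) x) \<and>
       tgt X k (src X (Suc k) x) = tgt X k (tgt X (Suc k) x))"

definition globular_map ::
  "('a, 'x) gset_scheme \<Rightarrow> ('b, 'y) gset_scheme \<Rightarrow> (nat \<Rightarrow> 'a \<Rightarrow> 'b) \<Rightarrow> bool" where
  "globular_map X Y f \<longleftrightarrow>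
    (\<forall>k. \<forall>x\<in>cells X k. f k x \<in> cells Y k) \<and>
    (\<forall>k. \<forall>x\<in>cells X (Suc k).
       f k (src X k x) = src Y k (f (Suc k) x) \<and> f k (tgt X k x) = tgt Y k (f (Suc k) x))"

text \<open>The hom-set: maps are normalised outside the cells, so that equality in HOL is equality of maps.\<close>

definition ghom ::
  "('a, 'x) gset_scheme \<Rightarrow> ('b, 'y) gset_scheme \<Rightarrow> (nat \<Rightarrow> 'a \<Rightarrow> 'b) set" where
  "ghom X Y = {f. globular_map X Y f \<and> (\<forall>k x. x \<notin> cells X k \<longrightarrow> f k x = undefined)}"

definition gone :: "unit gset" where
  "gone = \<lparr>cells = (\<lambda>k. {()}), src = (\<lambda>k x. x), tgt = (\<lambda>k x. x)\<rparr>"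

definition bang :: "nat \<Rightarrow> 'a \<Rightarrow> unit" where
  "bang k x = ()"

text \<open>The cartesian power \<open>A\<^sup>n\<close> of globular sets, as lists of length \<open>n\<close>.\<close>

definition gpow :: "('a, 'x) gset_scheme \<Rightarrow> nat \<Rightarrow> 'a list gset" where
  "gpow A n = \<lparr>cells = (\<lambda>k. {xs. length xs = n \<and> set xs \<subseteq> cells A k}),
     src = (\<lambda>k. map (src A k)), tgt = (\<lambda>k. map (tgt A k))\<rparr>"

text \<open>\<open>bd s p k x\<close> is the \<open>p\<close>-dimensional source (target) of a \<open>k\<close>-cell \<open>x\<close>, for \<open>p \<le> k\<close>,
  when \<open>s\<close> is the family of source (target) maps.\<close>

primrec bd :: "(nat \<Rightarrow> 'a \<Rightarrow> 'a) \<Rightarrow> nat \<Rightarrow> nat \<Rightarrow> 'a \<Rightarrow> 'a" where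
  "bd s p 0 x = x"
| "bd s p (Suc k) x = (if p < Suc k then bd s p k (s k x) else x)"

text \<open>\<open>ocomp C p k y x\<close> is the composite \<open>y \<circ>\<^sub>p x\<close> of \<open>k\<close>-cells (first \<open>x\<close>, then \<open>y\<close>);
  \<open>oid C k x\<close> is the identity \<open>(k+1)\<close>-cell on a \<open>k\<close>-cell \<open>x\<close>.\<close>

record 'a omega_str =
  ocomp :: "nat \<Rightarrow> nat \<Rightarrow> 'a \<Rightarrow> 'a \<Rightarrow> 'a"
  oid :: "nat \<Rightarrow> 'a \<Rightarrow> 'a"

text \<open>\<open>oids i p k x\<close> is the iterated identity \<open>k\<close>-cell on a \<open>p\<close>-cell \<open>x\<close>, for \<open>p \<le> k\<close>.\<close>

primrec oids :: "(nat \<Rightarrow> 'a \<Rightarrow> 'a) \<Rightarrow> nat \<Rightarrow> nat \<Rightarrow> 'a \<Rightarrow> 'a" where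
  "oids i p 0 x = x"
| "oids i p (Suc k) x = (if p < Suc k then i k (oids i p k x) else x)"

definition composable :: "('a, 'x) gset_scheme \<Rightarrow> nat \<Rightarrow> nat \<Rightarrow> 'a \<Rightarrow> 'a \<Rightarrow> bool" where
  "composable X p k y x \<longleftrightarrow>
    p < k \<and> y \<in> cells X k \<and> x \<in> cells X k \<and> bd (src X) p k y = bd (tgt X) p k x"

locale strict_omega_cat =
  fixes X :: "('a, 'x) gset_scheme" and C :: "'a omega_str"
  assumes glob: "globular_set X"
    and comp_cell: "composable X p k y x \<Longrightarrow> ocomp C p k y x \<in> cells X k"
    and id_cell: "x \<in> cells X k \<Longrightarrow> oid C k x \<in> cells X (Suc k)"
    and src_comp_top: "composable X k (Suc k) y x \<Longrightarrow>
          src X k (ocomp C k (Suc k) y x) = src X k x"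
    and tgt_comp_top: "composable X k (Suc k) y x \<Longrightarrow>
          tgt X k (ocomp C k (Suc k) y x) = tgt X k y"
    and src_comp: "composable X p (Suc k) y x \<Longrightarrow> p < k \<Longrightarrow>
          src X k (ocomp C p (Suc k) y x) = ocomp C p k (src X k y) (src X k x)"
    and tgt_comp: "composable X p (Suc k) y x \<Longrightarrow> p < k \<Longrightarrow>
          tgt X k (ocomp C p (Suc k) y x) = ocomp C p k (tgt X k y) (tgt X k x)"
    and src_id: "x \<in> cells X k \<Longrightarrow> src X k (oid C k x) = x"
    and tgt_id: "x \<in> cells X k \<Longrightarrow> tgt X k (oid C k x) = x"
    and assoc: "composable X p k z y \<Longrightarrow> composable X p k y x \<Longrightarrow>
          ocomp C p k (ocomp C p k z y) x = ocomp C p k z (ocomp C p k y x)"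
    and unit_left: "x \<in> cells X k \<Longrightarrow> p < k \<Longrightarrow>
          ocomp C p k (oids (oid C) p k (bd (tgt X) p k x)) x = x"
    and unit_right: "x \<in> cells X k \<Longrightarrow> p < k \<Longrightarrow>
          ocomp C p k x (oids (oid C) p k (bd (src X) p k x)) = x"
    and interchange: "p < q \<Longrightarrow> composable X q k y' y \<Longrightarrow> composable X q k x' x \<Longrightarrow>
          composable X p k y x \<Longrightarrow> composable X p k y' x' \<Longrightarrow>
          ocomp C p k (ocomp C q k y' y) (ocomp C q k x' x) =
          ocomp C q k (ocomp C p k y' x') (ocomp C p k y x)"
    and id_interchange: "composable X p k y x \<Longrightarrow>
          ocomp C p (Suc k) (oid C k y) (oid C k x) = oid C k (ocomp C p k y x)"

definition omega_str_on :: "('a, 'x) gset_scheme \<Rightarrow> 'a omega_str set" where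
  "omega_str_on X = {C. strict_omega_cat X C \<and>
     (\<forall>p k y x. \<not> composable X p k y x \<longrightarrow> ocomp C p k y x = undefined) \<and>
     (\<forall>k x. x \<notin> cells X k \<longrightarrow> oid C k x = undefined)}"

definition strict_omega_functor ::
  "('a, 'x) gset_scheme \<Rightarrow> 'a omega_str \<Rightarrow> ('b, 'y) gset_scheme \<Rightarrow> 'b omega_str \<Rightarrow>
   (nat \<Rightarrow> 'a \<Rightarrow> 'b) \<Rightarrow> bool" where
  "strict_omega_functor X C Y D f \<longleftrightarrow> globular_map X Y f \<and>
    (\<forall>p k y x. composable X p k y x \<longrightarrow> f k (ocomp C p k y x) = ocomp D p k (f k y) (f k x)) \<and>
    (\<forall>k. \<forall>x\<in>cells X k. f (Suc k) (oid C k x) = oid D k (f k x))"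

text \<open>The product structure on \<open>gpow A n\<close>, for every \<open>n\<close>.\<close>

definition omega_pow :: "'a omega_str \<Rightarrow> 'a list omega_str" where
  "omega_pow C = \<lparr>ocomp = (\<lambda>p k. map2 (ocomp C p k)), oid = (\<lambda>k. map (oid C k))\<rparr>"


section \<open>The free strict omega-category monad\<close>

text \<open>\<open>\<T>(X)\<close> is constructed as for any algebraic theory: well-formed formal composites of cells
  of \<open>X\<close>, modulo the least congruence containing the axioms of strict omega-categories.
  Composability is itself up to this congruence, so well-formedness and the congruence are
  defined simultaneously. Dimensions are not recorded in the terms; \<open>tm_src X k\<close> and
  \<open>tm_tgt X k\<close> apply to terms of dimension \<open>k+1\<close>.\<close>

datatype 'a otm = Gen 'a | Idt "'a otm" | Cmp nat "'a otm" "'a otm"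

primrec tm_src :: "('a, 'x) gset_scheme \<Rightarrow> nat \<Rightarrow> 'a otm \<Rightarrow> 'a otm" where
  "tm_src X k (Gen x) = Gen (src X k x)"
| "tm_src X k (Idt t) = t"
| "tm_src X k (Cmp p u v) = (if p = k then tm_src X k v else Cmp p (tm_src X k u) (tm_src X k v))"

primrec tm_tgt :: "('a, 'x) gset_scheme \<Rightarrow> nat \<Rightarrow> 'a otm \<Rightarrow> 'a otm" where
  "tm_tgt X k (Gen x) = Gen (tgt X k x)"
| "tm_tgt X k (Idt t) = t"
| "tm_tgt X k (Cmp p u v) = (if p = k then tm_tgt X k u else Cmp p (tm_tgt X k u) (tm_tgt X k v))"

inductive tm_wf :: "('a, 'x) gset_scheme \<Rightarrow> nat \<Rightarrow> 'a otm \<Rightarrow> bool"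
  and tm_eq :: "('a, 'x) gset_scheme \<Rightarrow> nat \<Rightarrow> 'a otm \<Rightarrow> 'a otm \<Rightarrow> bool"
  for X :: "('a, 'x) gset_scheme" where
  wf_Gen: "x \<in> cells X k \<Longrightarrow> tm_wf X k (Gen x)"
| wf_Idt: "tm_wf X k t \<Longrightarrow> tm_wf X (Suc k) (Idt t)"
| wf_Cmp: "p < k \<Longrightarrow> tm_wf X k u \<Longrightarrow> tm_wf X k v \<Longrightarrow>
    tm_eq X p (bd (tm_src X) p k u) (bd (tm_tgt X) p k v) \<Longrightarrow> tm_wf X k (Cmp p u v)"
| eq_refl: "tm_wf X k t \<Longrightarrow> tm_eq X k t t"
| eq_sym: "tm_eq X k t u \<Longrightarrow> tm_eq X k u t"
| eq_trans: "tm_eq X k t u \<Longrightarrow> tm_eq X k u v \<Longrightarrow> tm_eq X k t v"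
| eq_Idt: "tm_eq X k t u \<Longrightarrow> tm_eq X (Suc k) (Idt t) (Idt u)"
| eq_Cmp: "tm_wf X k (Cmp p u v) \<Longrightarrow> tm_wf X k (Cmp p u' v') \<Longrightarrow>
    tm_eq X k u u' \<Longrightarrow> tm_eq X k v v' \<Longrightarrow> tm_eq X k (Cmp p u v) (Cmp p u' v')"
| eq_assoc: "tm_wf X k (Cmp p (Cmp p w v) u) \<Longrightarrow> tm_wf X k (Cmp p w (Cmp p v u)) \<Longrightarrow>
    tm_eq X k (Cmp p (Cmp p w v) u) (Cmp p w (Cmp p v u))"
| eq_unit_left: "tm_wf X k u \<Longrightarrow>
    tm_wf X k (Cmp p (oids (\<lambda>_. Idt) p k (bd (tm_tgt X) p k u)) u) \<Longrightarrow>
    tm_eq X k (Cmp p (oids (\<lambda>_. Idt) p k (bd (tm_tgt X) p k u)) u) u"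
| eq_unit_right: "tm_wf X k u \<Longrightarrow>
    tm_wf X k (Cmp p u (oids (\<lambda>_. Idt) p k (bd (tm_src X) p k u))) \<Longrightarrow>
    tm_eq X k (Cmp p u (oids (\<lambda>_. Idt) p k (bd (tm_src X) p k u))) u"
| eq_interchange: "p < q \<Longrightarrow>
    tm_wf X k (Cmp p (Cmp q y' y) (Cmp q x' x)) \<Longrightarrow>
    tm_wf X k (Cmp q (Cmp p y' x') (Cmp p y x)) \<Longrightarrow>
    tm_eq X k (Cmp p (Cmp q y' y) (Cmp q x' x)) (Cmp q (Cmp p y' x') (Cmp p y x))"
| eq_id_interchange: "tm_wf X k (Cmp p u v) \<Longrightarrow> tm_wf X (Suc k) (Cmp p (Idt u) (Idt v)) \<Longrightarrow>
    tm_eq X (Suc k) (Cmp p (Idt u) (Idt v)) (Idt (Cmp p u v))"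

definition tm_class :: "('a, 'x) gset_scheme \<Rightarrow> nat \<Rightarrow> 'a otm \<Rightarrow> 'a otm set" where
  "tm_class X k t = {u. tm_eq X k t u}"

definition T :: "('a, 'x) gset_scheme \<Rightarrow> 'a otm set gset" where
  "T X = \<lparr>cells = (\<lambda>k. tm_class X k ` {t. tm_wf X k t}),
     src = (\<lambda>k c. \<Union>t\<in>c. tm_class X k (tm_src X k t)),
     tgt = (\<lambda>k c. \<Union>t\<in>c. tm_class X k (tm_tgt X k t))\<rparr>"

definition T_omega :: "('a, 'x) gset_scheme \<Rightarrow> 'a otm set omega_str" where
  "T_omega X =
    \<lparr>ocomp = (\<lambda>p k c d. \<Union>u\<in>c. \<Union>v\<in>d. tm_class X k (Cmp p u v)),
     oid = (\<lambda>k c. \<Union>t\<in>c. tm_class X (Suc k) (Idt t))\<rparr>"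

primrec tm_map :: "(nat \<Rightarrow> 'a \<Rightarrow> 'b) \<Rightarrow> nat \<Rightarrow> 'a otm \<Rightarrow> 'b otm" where
  "tm_map f k (Gen x) = Gen (f k x)"
| "tm_map f k (Idt t) = Idt (tm_map f (k - 1) t)"
| "tm_map f k (Cmp p u v) = Cmp p (tm_map f k u) (tm_map f k v)"

text \<open>\<open>T_map Y f\<close> is \<open>\<T>(f) : \<T>(X) \<rightarrow> \<T>(Y)\<close> for \<open>f : X \<rightarrow> Y\<close>.\<close>

definition T_map ::
  "('b, 'y) gset_scheme \<Rightarrow> (nat \<Rightarrow> 'a \<Rightarrow> 'b) \<Rightarrow> nat \<Rightarrow> 'a otm set \<Rightarrow> 'b otm set" where
  "T_map Y f k c = (\<Union>t\<in>c. tm_class Y k (tm_map f k t))"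

definition T_eta :: "('a, 'x) gset_scheme \<Rightarrow> nat \<Rightarrow> 'a \<Rightarrow> 'a otm set" where
  "T_eta X k x = tm_class X k (Gen x)"

primrec tm_eval :: "'a omega_str \<Rightarrow> nat \<Rightarrow> 'a otm \<Rightarrow> 'a" where
  "tm_eval C k (Gen x) = x"
| "tm_eval C k (Idt t) = oid C (k - 1) (tm_eval C (k - 1) t)"
| "tm_eval C k (Cmp p u v) = ocomp C p k (tm_eval C k u) (tm_eval C k v)"

text \<open>\<open>T_eval C : \<T>(X) \<rightarrow> X\<close> is the \<open>\<T>\<close>-algebra given by a strict omega-category structure \<open>C\<close>
  on \<open>X\<close>; evaluation is constant on the classes.\<close>

definition T_eval :: "'a omega_str \<Rightarrow> nat \<Rightarrow> 'a otm set \<Rightarrow> 'a" where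
  "T_eval C k c = the_elem (tm_eval C k ` c)"

definition T_mu :: "('a, 'x) gset_scheme \<Rightarrow> nat \<Rightarrow> 'a otm set otm set \<Rightarrow> 'a otm set" where
  "T_mu X = T_eval (T_omega X)"


section \<open>Collections\<close>

type_synonym arity = "unit otm set"

record 'a coll = "'a gset" +
  ar :: "nat \<Rightarrow> 'a \<Rightarrow> arity"

definition chom :: "'a coll \<Rightarrow> 'b coll \<Rightarrow> (nat \<Rightarrow> 'a \<Rightarrow> 'b) set" where
  "chom X Y = {f \<in> ghom X Y. \<forall>k. \<forall>x\<in>cells X k. ar Y k (f k x) = ar X k x}"

definition terminal_coll :: "arity coll" where
  "terminal_coll = \<lparr>cells = cells (T gone), src = src (T gone), tgt = tgt (T gone), ar = (\<lambda>k x. x)\<rparr>"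

definition unit_coll :: "unit coll" where
  "unit_coll = \<lparr>cells = cells gone, src = src gone, tgt = tgt gone, ar = T_eta gone\<rparr>"

definition cprod :: "'a coll \<Rightarrow> 'b coll \<Rightarrow> ('a \<times> 'b) coll" (infixr "\<times>\<^sub>c" 75) where
  "X \<times>\<^sub>c Y = \<lparr>cells = (\<lambda>k. {(x, y). x \<in> cells X k \<and> y \<in> cells Y k \<and> ar X k x = ar Y k y}),
     src = (\<lambda>k. map_prod (src X k) (src Y k)), tgt = (\<lambda>k. map_prod (tgt X k) (tgt Y k)),
     ar = (\<lambda>k (x, y). ar X k x)\<rparr>"

definition cprod_map ::
  "(nat \<Rightarrow> 'a \<Rightarrow> 'c) \<Rightarrow> (nat \<Rightarrow> 'b \<Rightarrow> 'd) \<Rightarrow> nat \<Rightarrow> 'a \<times> 'b \<Rightarrow> 'c \<times> 'd" where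
  "cprod_map f g k = map_prod (f k) (g k)"

text \<open>The coproduct of copies of \<open>X\<close> indexed by \<open>S\<close>.\<close>

definition copower :: "'s set \<Rightarrow> 'a coll \<Rightarrow> ('s \<times> 'a) coll" where
  "copower S X = \<lparr>cells = (\<lambda>k. S \<times> cells X k),
     src = (\<lambda>k. map_prod id (src X k)), tgt = (\<lambda>k. map_prod id (tgt X k)),
     ar = (\<lambda>k (s, x). ar X k x)\<rparr>"

definition copower_in :: "'s \<Rightarrow> nat \<Rightarrow> 'a \<Rightarrow> 's \<times> 'a" where
  "copower_in s k x = (s, x)"

definition ctensor :: "'a coll \<Rightarrow> 'b coll \<Rightarrow> ('a \<times> 'b otm set) coll" (infixr "\<box>" 70) where
  "X \<box> Y =
    \<lparr>cells = (\<lambda>k. {(x, w). x \<in> cells X k \<and> w \<in> cells (T Y) k \<and> ar X k x = T_map gone bang k w}),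
     src = (\<lambda>k. map_prod (src X k) (src (T Y) k)), tgt = (\<lambda>k. map_prod (tgt X k) (tgt (T Y) k)),
     ar = (\<lambda>k (x, w). T_mu gone k (T_map (T gone) (ar Y) k w))\<rparr>"

text \<open>\<open>ctensor_map Y' f g\<close> is \<open>f \<box> g : X \<box> Y \<rightarrow> X' \<box> Y'\<close>.\<close>

definition ctensor_map ::
  "'d coll \<Rightarrow> (nat \<Rightarrow> 'a \<Rightarrow> 'c) \<Rightarrow> (nat \<Rightarrow> 'b \<Rightarrow> 'd) \<Rightarrow> nat \<Rightarrow> 'a \<times> 'b otm set \<Rightarrow> 'c \<times> 'd otm set" where
  "ctensor_map Y' f g k = map_prod (f k) (T_map Y' g k)"

text \<open>The structural isomorphisms of \<open>\<box>\<close> have closed formulas in the directions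
  \<open>X \<box> (Y \<box> Z) \<rightarrow> (X \<box> Y) \<box> Z\<close> and \<open>X \<rightarrow> I \<box> X\<close>; these inverses are used below.\<close>

definition assoc_inv ::
  "'b coll \<Rightarrow> 'c coll \<Rightarrow> nat \<Rightarrow> 'a \<times> ('b \<times> 'c otm set) otm set \<Rightarrow> ('a \<times> 'b otm set) \<times> 'c otm set" where
  "assoc_inv Y Z k = (\<lambda>(x, v).
     ((x, T_map Y (\<lambda>_. fst) k v), T_mu Z k (T_map (T Z) (\<lambda>_. snd) k v)))"

definition lunit_inv :: "'a coll \<Rightarrow> nat \<Rightarrow> 'a \<Rightarrow> unit \<times> 'a otm set" where
  "lunit_inv X k x = ((), T_eta X k x)"

text \<open>The interchange map \<open>(A \<times> B) \<box> (C \<times> D) \<rightarrow> (A \<box> C) \<times> (B \<box> D)\<close>.\<close>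

definition cinterchange ::
  "'c coll \<Rightarrow> 'd coll \<Rightarrow> nat \<Rightarrow> ('a \<times> 'b) \<times> ('c \<times> 'd) otm set \<Rightarrow>
   ('a \<times> 'c otm set) \<times> ('b \<times> 'd otm set)" where
  "cinterchange C D k = (\<lambda>((a, b), w).
     ((a, T_map C (\<lambda>_. fst) k w), (b, T_map D (\<lambda>_. snd) k w)))"

definition id_arity :: "nat \<Rightarrow> arity" where
  "id_arity k = tm_class gone k ((Idt ^^ k) (Gen ()))"

definition degen :: "'a gset \<Rightarrow> 'a coll" where
  "degen A = \<lparr>cells = cells A, src = src A, tgt = tgt A, ar = (\<lambda>k x. id_arity k)\<rparr>"

text \<open>The \<open>n\<close>-fold fibre power of \<open>X\<close> over \<open>\<T>(\<one>)\<close>, restricted to arities in \<open>U\<close>; a cell is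
  a list of \<open>n\<close> cells together with their common arity, which matters for \<open>n = 0\<close>.
  For \<open>U = cells (T gone)\<close> this is the cartesian power in \<open>Col\<close>, and the nullary power is the
  terminal collection \<open>\<T>(\<one>)\<close>. For \<open>U k = {id_arity k}\<close> it is the cartesian power among
  degenerate collections, i.e. the power in globular sets regarded as a degenerate collection,
  and the nullary power is the degenerate collection \<open>\<one>\<close>. If \<open>X\<close> is degenerate the two agree
  for every \<open>n > 0\<close>.\<close>

definition cpow :: "(nat \<Rightarrow> arity set) \<Rightarrow> 'a coll \<Rightarrow> nat \<Rightarrow> (arity \<times> 'a list) coll" where
  "cpow U X n =
    \<lparr>cells = (\<lambda>k. {(a, xs). a \<in> U k \<and> length xs = n \<and> (\<forall>x\<in>set xs. x \<in> cells X k \<and> ar X k x = a)}),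
     src = (\<lambda>k. map_prod (src (T gone) k) (map (src X k))),
     tgt = (\<lambda>k. map_prod (tgt (T gone) k) (map (tgt X k))),
     ar = (\<lambda>k (a, xs). a)\<rparr>"

abbreviation all_arities :: "nat \<Rightarrow> arity set" where
  "all_arities \<equiv> cells (T gone)"

abbreviation id_arities :: "nat \<Rightarrow> arity set" where
  "id_arities \<equiv> (\<lambda>k. {id_arity k})"

text \<open>The canonical isomorphism \<open>X\<^sup>n \<times> X\<^sup>r \<cong> X\<^sup>n\<^sup>+\<^sup>r\<close>.\<close>

definition cpow_join :: "nat \<Rightarrow> (arity \<times> 'a list) \<times> (arity \<times> 'a list) \<Rightarrow> arity \<times> 'a list" where
  "cpow_join k = (\<lambda>((a, xs), (b, ys)). (a, xs @ ys))"


section \<open>PROs and their algebras in globular sets\<close>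

text \<open>\<open>pcomp P n m p g f\<close> is \<open>g \<circ> f\<close> for \<open>f : n \<rightarrow> m\<close>, \<open>g : m \<rightarrow> p\<close>;
  \<open>psum P n m l k f g\<close> is \<open>f + g\<close> for \<open>f : n \<rightarrow> m\<close>, \<open>g : l \<rightarrow> k\<close>. The objects are arguments
  because hom-sets are not required to be disjoint.\<close>

record 'p pro =
  phom :: "nat \<Rightarrow> nat \<Rightarrow> 'p set"
  pcomp :: "nat \<Rightarrow> nat \<Rightarrow> nat \<Rightarrow> 'p \<Rightarrow> 'p \<Rightarrow> 'p"
  pid :: "nat \<Rightarrow> 'p"
  psum :: "nat \<Rightarrow> nat \<Rightarrow> nat \<Rightarrow> nat \<Rightarrow> 'p \<Rightarrow> 'p \<Rightarrow> 'p"

locale PRO =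
  fixes P :: "'p pro"
  assumes pid_hom: "pid P n \<in> phom P n n"
    and pcomp_hom: "f \<in> phom P n m \<Longrightarrow> g \<in> phom P m p \<Longrightarrow> pcomp P n m p g f \<in> phom P n p"
    and pcomp_assoc: "f \<in> phom P n m \<Longrightarrow> g \<in> phom P m p \<Longrightarrow> h \<in> phom P p q \<Longrightarrow>
          pcomp P n m q (pcomp P m p q h g) f = pcomp P n p q h (pcomp P n m p g f)"
    and pid_left: "f \<in> phom P n m \<Longrightarrow> pcomp P n m m (pid P m) f = f"
    and pid_right: "f \<in> phom P n m \<Longrightarrow> pcomp P n n m f (pid P n) = f"
    and psum_hom: "f \<in> phom P n m \<Longrightarrow> g \<in> phom P l k \<Longrightarrow> psum P n m l k f g \<in> phom P (n + l) (m + k)"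
    and psum_pid: "psum P n n l l (pid P n) (pid P l) = pid P (n + l)"
    and psum_pcomp: "f \<in> phom P n m \<Longrightarrow> g \<in> phom P m p \<Longrightarrow> f' \<in> phom P n' m' \<Longrightarrow> g' \<in> phom P m' p' \<Longrightarrow>
          psum P n p n' p' (pcomp P n m p g f) (pcomp P n' m' p' g' f') =
          pcomp P (n + n') (m + m') (p + p') (psum P m p m' p' g g') (psum P n m n' m' f f')"
    and psum_assoc: "f \<in> phom P n m \<Longrightarrow> g \<in> phom P n' m' \<Longrightarrow> h \<in> phom P n'' m'' \<Longrightarrow>
          psum P (n + n') (m + m') n'' m'' (psum P n m n' m' f g) h =
          psum P n m (n' + n'') (m' + m'') f (psum P n' m' n'' m'' g h)"
    and psum_unit_left: "f \<in> phom P n m \<Longrightarrow> psum P 0 0 n m (pid P 0) f = f"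
    and psum_unit_right: "f \<in> phom P n m \<Longrightarrow> psum P n m 0 0 f (pid P 0) = f"

definition pro_algebra ::
  "'p pro \<Rightarrow> 'a gset \<Rightarrow> (nat \<Rightarrow> nat \<Rightarrow> 'p \<Rightarrow> nat \<Rightarrow> 'a list \<Rightarrow> 'a list) set" where
  "pro_algebra P A = {\<rho>.
    (\<forall>n m. \<forall>f\<in>phom P n m. \<rho> n m f \<in> ghom (gpow A n) (gpow A m)) \<and>
    (\<forall>n m f. f \<notin> phom P n m \<longrightarrow> \<rho> n m f = undefined) \<and>
    (\<forall>n m p. \<forall>f\<in>phom P n m. \<forall>g\<in>phom P m p. \<forall>k. \<forall>xs\<in>cells (gpow A n) k.
       \<rho> n p (pcomp P n m p g f) k xs = \<rho> m p g k (\<rho> n m f k xs)) \<and>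
    (\<forall>n k. \<forall>xs\<in>cells (gpow A n) k. \<rho> n n (pid P n) k xs = xs) \<and>
    (\<forall>n m r s. \<forall>f\<in>phom P n m. \<forall>g\<in>phom P r s. \<forall>k.
       \<forall>xs\<in>cells (gpow A n) k. \<forall>ys\<in>cells (gpow A r) k.
       \<rho> (n + r) (m + s) (psum P n m r s f g) k (xs @ ys) = \<rho> n m f k xs @ \<rho> r s g k ys)}"

text \<open>Strict omega-category structures on \<open>A\<close> together with \<open>P\<close>-algebra structures on \<open>A\<close>
  all of whose operations are strict omega-functors.\<close>

definition omega_pro_algebra ::
  "'p pro \<Rightarrow> 'a gset \<Rightarrow>
   ('a omega_str \<times> (nat \<Rightarrow> nat \<Rightarrow> 'p \<Rightarrow> nat \<Rightarrow> 'a list \<Rightarrow> 'a list)) set" where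
  "omega_pro_algebra P A = {(C, \<rho>). C \<in> omega_str_on A \<and> \<rho> \<in> pro_algebra P A \<and>
    (\<forall>n m. \<forall>f\<in>phom P n m.
       strict_omega_functor (gpow A n) (omega_pow C) (gpow A m) (omega_pow C) (\<rho> n m f))}"


section \<open>Globular PROs and their algebras\<close>

text \<open>\<open>gcomp Q n m p : Q(m,p) \<box> Q(n,m) \<rightarrow> Q(n,p)\<close>,
  \<open>gsum Q n m l k : Q(n,m) \<times> Q(l,k) \<rightarrow> Q(n+l,m+k)\<close> and \<open>gunit Q n : I \<rightarrow> Q(n,n)\<close>.\<close>

record 'c gpro =
  gobj :: "nat \<Rightarrow> nat \<Rightarrow> 'c coll"
  gcomp :: "nat \<Rightarrow> nat \<Rightarrow> nat \<Rightarrow> nat \<Rightarrow> 'c \<times> 'c otm set \<Rightarrow> 'c"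
  gsum :: "nat \<Rightarrow> nat \<Rightarrow> nat \<Rightarrow> nat \<Rightarrow> nat \<Rightarrow> 'c \<times> 'c \<Rightarrow> 'c"
  gunit :: "nat \<Rightarrow> nat \<Rightarrow> unit \<Rightarrow> 'c"

text \<open>The map from \<open>X\<close> to the terminal collection is \<open>ar X\<close>. Composition is defined on
  \<open>P(m,p)\<cdot>\<T>(\<one>) \<box> P(n,m)\<cdot>\<T>(\<one>)\<close>, the coproduct of the images of \<open>\<T>(\<one>) \<box> \<T>(\<one>)\<close> under the
  maps \<open>in\<^sub>g \<box> in\<^sub>f\<close>, by its restrictions to these summands.\<close>

definition globularization :: "'p pro \<Rightarrow> ('p \<times> arity) gpro" where
  "globularization P = \<lparr>
     gobj = (\<lambda>n m. copower (phom P n m) terminal_coll),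
     gcomp = (\<lambda>n m p k z. THE y. \<exists>g\<in>phom P m p. \<exists>f\<in>phom P n m.
        \<exists>z'\<in>cells (terminal_coll \<box> terminal_coll) k.
          z = ctensor_map (copower (phom P n m) terminal_coll) (copower_in g) (copower_in f) k z' \<and>
          y = copower_in (pcomp P n m p g f) k (ar (terminal_coll \<box> terminal_coll) k z')),
     gsum = (\<lambda>n m l r k ((f, a), (g, b)).
        copower_in (psum P n m l r f g) k (ar (terminal_coll \<times>\<^sub>c terminal_coll) k (a, b))),
     gunit = (\<lambda>n k u. copower_in (pid P n) k (T_eta gone k u))\<rparr>"

text \<open>Algebra structures on the degenerate collection \<open>A\<close>, where \<open>A\<^sup>n\<close> is \<open>cpow U (degen A) n\<close>.

  The choice of \<open>U\<close> decides what \<open>A\<^sup>0\<close> is. With \<open>U = all_arities\<close> (\<open>A\<^sup>0 = \<T>(\<one>)\<close>), a PRO with some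
  \<open>P(0,m)\<close>, \<open>m > 0\<close>, inhabited has no algebras at all: \<open>P(0,m)\<cdot>\<T>(\<one>) \<box> \<T>(\<one>)\<close> has cells of every arity
  in \<open>\<T>(\<one>)\<close>, whereas all cells of \<open>A\<^sup>m\<close> have arity \<open>id_arity k\<close>. With \<open>U = id_arities\<close> the powers
  are those of the globular set \<open>A\<close> and nullary operations cause no difficulty.\<close>

definition gpro_algebra ::
  "(nat \<Rightarrow> arity set) \<Rightarrow> 'c gpro \<Rightarrow> 'a gset \<Rightarrow>
   (nat \<Rightarrow> nat \<Rightarrow> nat \<Rightarrow> 'c \<times> (arity \<times> 'a list) otm set \<Rightarrow> arity \<times> 'a list) set" where
  "gpro_algebra U Q A = {\<Omega>. let pw = cpow U (degen A) in
    (\<forall>n m. \<Omega> n m \<in> chom (gobj Q n m \<box> pw n) (pw m)) \<and>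
    (\<forall>n m r k. \<forall>z\<in>cells (gobj Q m r \<box> gobj Q n m \<box> pw n) k.
       \<Omega> m r k (ctensor_map (pw m) (\<lambda>_. id) (\<Omega> n m) k z) =
       \<Omega> n r k (ctensor_map (pw n) (gcomp Q n m r) (\<lambda>_. id) k
                  (assoc_inv (gobj Q n m) (pw n) k z))) \<and>
    (\<forall>n m r s k. \<forall>z\<in>cells ((gobj Q n m \<times>\<^sub>c gobj Q r s) \<box> (pw n \<times>\<^sub>c pw r)) k.
       \<Omega> (n + r) (m + s) k (ctensor_map (pw (n + r)) (gsum Q n m r s) cpow_join k z) =
       cpow_join k (cprod_map (\<Omega> n m) (\<Omega> r s) k (cinterchange (pw n) (pw r) k z))) \<and>
    (\<forall>n k. \<forall>x\<in>cells (pw n) k.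
       \<Omega> n n k (ctensor_map (pw n) (gunit Q n) (\<lambda>_. id) k (lunit_inv (pw n) k x)) = x)}"

text \<open>The correspondence: \<open>\<P>(n,m) \<box> A\<^sup>n\<close> acts by composing a pasting diagram in the product
  omega-category \<open>A\<^sup>n\<close> and then applying the operation of \<open>P\<close>.\<close>

definition induced_action ::
  "(nat \<Rightarrow> arity set) \<Rightarrow> 'p pro \<Rightarrow> 'a gset \<Rightarrow>
   'a omega_str \<times> (nat \<Rightarrow> nat \<Rightarrow> 'p \<Rightarrow> nat \<Rightarrow> 'a list \<Rightarrow> 'a list) \<Rightarrow>
   (nat \<Rightarrow> nat \<Rightarrow> nat \<Rightarrow> ('p \<times> arity) \<times> (arity \<times> 'a list) otm set \<Rightarrow> arity \<times> 'a list)" where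
  "induced_action U P A = (\<lambda>(C, \<rho>) n m k ((f, a), w).
     let X = gobj (globularization P) n m \<box> cpow U (degen A) n in
     if ((f, a), w) \<in> cells X k
     then (ar X k ((f, a), w),
           \<rho> n m f k (T_eval (omega_pow C) k (T_map (gpow A n) (\<lambda>_. snd) k w)))
     else undefined)"

end

theory Submission
  imports Defs
begin

text \<open>
  Two strict omega-functors out of a free strict omega-category \<open>\<T>(X)\<close> agree as soon as they agree on
  the generators, so every identity between maps built from \<open>\<T>(f)\<close>, \<open>\<mu>\<close>, evaluation and arities can be
  checked on generators. Composable cells of \<open>\<T>(X)\<close> have generators in the same connected component
  of \<open>X\<close>; hence a structure map \<open>\<P>(n,m) \<box> A\<^sup>n \<rightarrow> A\<^sup>m\<close> amounts to a family \<open>\<omega>\<^sub>f : \<T>(A\<^sup>n) \<rightarrow> A\<^sup>m\<close> indexed by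
  \<open>f \<in> P(n,m)\<close>, the arities being forced, and the associativity law becomes
  \<open>\<omega>\<^sub>g \<circ> \<T>(\<omega>\<^sub>f) = \<omega>\<^sub>g\<^sub>f \<circ> \<mu>\<close>. For \<open>f = g = id\<close> this makes \<open>A\<^sup>n\<close> a \<open>\<T>\<close>-algebra, that is a strict omega-category,
  and the sum law identifies it with the \<open>n\<close>-th power of \<open>A\<close>. Taking only one of \<open>f\<close>, \<open>g\<close> to be an
  identity shows that \<open>\<omega>\<^sub>f\<close> is evaluation in \<open>A\<^sup>n\<close> followed by \<open>\<rho>\<^sub>f = \<omega>\<^sub>f \<circ> \<eta>\<close>, and that \<open>\<rho>\<^sub>f\<close> is a homomorphism
  of \<open>\<T>\<close>-algebras, that is a strict omega-functor.
\<close>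

text \<open>The delicate point is the arity component, above all for \<open>n = 0\<close>. A cell of
  \<open>cpow U (degen A) n\<close> is a list with an arity. For \<open>n > 0\<close> the arity is
  forced to be \<open>id_arity k\<close>; for \<open>n = 0\<close> and
  \<open>U = all_arities\<close> it ranges over all cells of \<open>T gone\<close>. There the
  projection to lists loses information under \<open>T_map\<close>, so it is not evident that a
  structure map is determined by diagrams of lists. All else is uniform in \<open>U\<close>, so both
  choices are treated at once, and the bijection factors through \<open>monadic_algebra\<close>,
  where arities no longer occur.

  The other obstacle is that \<open>T X\<close> is a quotient of raw terms whose composability is
  itself a congruence. The existence of boundaries and of evaluation both need strong induction on
  the dimension; later arguments mostly replace terms by \<open>T_induct\<close> and
  \<open>functor_eqI\<close>.\<close>

section \<open>Formal composites and their boundaries\<close>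

lemma bd_self [simp]: "bd s k k x = x"
  by (cases k) auto

lemma bd_trans: "p \<le> q \<Longrightarrow> q \<le> k \<Longrightarrow> bd s p q (bd s q k x) = bd s p k x"
  by (induction k arbitrary: x) (auto simp: le_Suc_eq)

lemma oids_self [simp]: "oids i k k x = x"
  by (cases k) auto

lemma bd_mem:
  "globular_set X \<Longrightarrow> x \<in> cells X k \<Longrightarrow> p \<le> k \<Longrightarrow> bd (src X) p k x \<in> cells X p \<and> bd (tgt X) p k x \<in> cells X p"
  by (induction k arbitrary: x) (auto simp: le_Suc_eq globular_set_def)

lemma bd_glob_step:
  assumes "globular_set X" "x \<in> cells X (Suc k)" "p < k"
  shows "bd (src X) p k (src X k x) = bd (src X) p k (tgt X k x)"
    "bd (tgt X) p k (src X k x) = bd (tgt X) p k (tgt X k x)"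
  using assms by (cases k; auto simp: globular_set_def)+

text \<open>On the way down to dimension \<open>q\<close> each source may be exchanged for a target,
  because one step above \<open>p\<close> both have the same \<open>p\<close>-dimensional
  target.\<close>

lemma bd_tgt_src:
  "globular_set X \<Longrightarrow> x \<in> cells X k \<Longrightarrow> p < q \<Longrightarrow> q \<le> k \<Longrightarrow>
    bd (tgt X) p q (bd (src X) q k x) = bd (tgt X) p k x"
proof (induction k arbitrary: x)
  case (Suc k)
  then show ?case
    using bd_glob_step[of X x k p] by (cases "q = Suc k") (auto simp: globular_set_def)
qed simp

section \<open>Well-formed terms and the iterated boundaries of formal composites\<close>

lemma tm_wf_Gen [simp]: "tm_wf X k (Gen x) \<longleftrightarrow> x \<in> cells X k"
  by (auto elim: tm_wf.cases intro: tm_wf_tm_eq.intros)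

lemma tm_wf_Idt [simp]: "tm_wf X (Suc k) (Idt t) \<longleftrightarrow> tm_wf X k t"
  by (auto elim: tm_wf.cases intro: tm_wf_tm_eq.intros)

lemma tm_wf_Idt_0 [simp]: "\<not> tm_wf X 0 (Idt t)"
  by (auto elim: tm_wf.cases)

lemma tm_wf_Cmp: "tm_wf X k (Cmp p u v) \<longleftrightarrow> p < k \<and> tm_wf X k u \<and> tm_wf X k v \<and>
    tm_eq X p (bd (tm_src X) p k u) (bd (tm_tgt X) p k v)"
  by (auto elim: tm_wf.cases intro: tm_wf_tm_eq.intros)

text \<open>The simultaneous induction with the trivial predicate on the well-formedness side:
  well-formedness stays available as a premise in each case, without an induction hypothesis of its
  own.\<close>

lemmas tm_eq_induct = tm_wf_tm_eq.inducts(2)[where ?P1.0 = "\<lambda>_ _. True", simplified, consumes 1,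
  case_names refl sym trans Idt Cmp assoc unit_left unit_right interchange id_interchange]

lemma tm_eq_wf: "tm_eq X k t u \<Longrightarrow> tm_wf X k t \<and> tm_wf X k u"
  by (induction rule: tm_eq_induct) (auto)

lemma tm_eq_oids: "tm_eq X p t u \<Longrightarrow> p \<le> k \<Longrightarrow> tm_eq X k (oids (\<lambda>_. Idt) p k t) (oids (\<lambda>_. Idt) p k u)"
  by (induction k) (auto simp: le_Suc_eq intro: tm_wf_tm_eq.intros)

lemma oids_Idt_bd: "p \<le> q \<Longrightarrow> q \<le> k \<Longrightarrow> bd (tm_src X) q k (oids (\<lambda>_. Idt) p k t) = oids (\<lambda>_. Idt) p q t
   \<and> bd (tm_tgt X) q k (oids (\<lambda>_. Idt) p k t) = oids (\<lambda>_. Idt) p q t"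
  by (induction k) (auto simp: le_Suc_eq)

lemma bd_Cmp_high: "p \<le> q \<Longrightarrow> q < k \<Longrightarrow> bd (tm_src X) p k (Cmp q u v) = bd (tm_src X) p k v \<and>
   bd (tm_tgt X) p k (Cmp q u v) = bd (tm_tgt X) p k u"
  by (induction k arbitrary: u v) (auto simp: less_Suc_eq)

lemma bd_Cmp_low: "p < q \<Longrightarrow> q \<le> k \<Longrightarrow>
   bd (tm_src X) q k (Cmp p u v) = Cmp p (bd (tm_src X) q k u) (bd (tm_src X) q k v) \<and>
   bd (tm_tgt X) q k (Cmp p u v) = Cmp p (bd (tm_tgt X) q k u) (bd (tm_tgt X) q k v)"
  by (induction k arbitrary: u v) (auto simp: le_Suc_eq)

text \<open>An invariant for one term that refers only to the dimensions \<open>k - 1\<close> and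
  \<open>k - 2\<close>; the second clause is the globular identities up to congruence. The guards
  make it vacuous where there is no boundary.\<close>

definition tm_bdry_wf :: "('a, 'x) gset_scheme \<Rightarrow> nat \<Rightarrow> 'a otm \<Rightarrow> bool" where
  "tm_bdry_wf X k t \<longleftrightarrow>
    (\<forall>j. k = Suc j \<longrightarrow> tm_wf X j (tm_src X j t) \<and> tm_wf X j (tm_tgt X j t)) \<and>
    (\<forall>j. k = Suc (Suc j) \<longrightarrow>
      tm_eq X j (tm_src X j (tm_src X (Suc j) t)) (tm_src X j (tm_tgt X (Suc j) t)) \<and>
      tm_eq X j (tm_tgt X j (tm_src X (Suc j) t)) (tm_tgt X j (tm_tgt X (Suc j) t)))"

definition tm_bdry_eq :: "('a, 'x) gset_scheme \<Rightarrow> nat \<Rightarrow> 'a otm \<Rightarrow> 'a otm \<Rightarrow> bool" where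
  "tm_bdry_eq X k t u \<longleftrightarrow>
    (\<forall>j. k = Suc j \<longrightarrow> tm_eq X j (tm_src X j t) (tm_src X j u) \<and> tm_eq X j (tm_tgt X j t) (tm_tgt X j u))"

text \<open>The boundary of a composite is well-formed only because the congruence is compatible with iterated
  boundaries in lower dimensions, so well-formedness and congruence go through one strong induction on the
  dimension.\<close>

lemma tm_bdry:
  assumes X: "globular_set X"
  shows "(\<forall>t. tm_wf X k t \<longrightarrow> tm_bdry_wf X k t) \<and> (\<forall>t u. tm_eq X k t u \<longrightarrow> tm_bdry_eq X k t u)"
proof (induction k rule: less_induct)
  case (less k)
  have IHeq: "tm_eq X j (tm_src X j t) (tm_src X j u)" "tm_eq X j (tm_tgt X j t) (tm_tgt X j u)"
    if "tm_eq X (Suc j) t u" "Suc j < k" for j t u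
    using less that by (auto simp: tm_bdry_eq_def)
  \<comment> \<open>A single boundary step respects the congruence by the induction hypothesis;
    iterating covers every boundary of terms of dimension below \<open>k\<close>.\<close>
  have bd_cong: "p \<le> i \<Longrightarrow> i < k \<Longrightarrow> tm_eq X i t u \<Longrightarrow>
      tm_eq X p (bd (tm_src X) p i t) (bd (tm_src X) p i u) \<and>
      tm_eq X p (bd (tm_tgt X) p i t) (bd (tm_tgt X) p i u)" for p i t u
    by (induction i arbitrary: t u) (auto simp: le_Suc_eq IHeq)
  show ?case
  proof (cases k)
    case 0
    then show ?thesis by (simp add: tm_bdry_wf_def tm_bdry_eq_def)
  next
    case k: (Suc n)
    have glob: "tm_eq X p (bd (tm_src X) p n (tm_src X n v)) (bd (tm_src X) p n (tm_tgt X n v))"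
      "tm_eq X p (bd (tm_tgt X) p n (tm_src X n v)) (bd (tm_tgt X) p n (tm_tgt X n v))"
      if "p < n" "tm_bdry_wf X k v" for p v
    proof -
      obtain j where j: "n = Suc j" using \<open>p < n\<close> by (cases n) auto
      have "tm_eq X j (tm_src X j (tm_src X n v)) (tm_src X j (tm_tgt X n v))"
        "tm_eq X j (tm_tgt X j (tm_src X n v)) (tm_tgt X j (tm_tgt X n v))"
        using that j k by (auto simp: tm_bdry_wf_def)
      then show "tm_eq X p (bd (tm_src X) p n (tm_src X n v)) (bd (tm_src X) p n (tm_tgt X n v))"
        "tm_eq X p (bd (tm_tgt X) p n (tm_src X n v)) (bd (tm_tgt X) p n (tm_tgt X n v))"
        using that bd_cong[of p j] j k by auto
    qed
    \<comment> \<open>At fixed \<open>k\<close> structural induction suffices: the factors of a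
      composite have its dimension, and identities fall back on the outer induction
      hypothesis.\<close>
    have bwf: "tm_wf X k t \<Longrightarrow> tm_bdry_wf X k t" for t
    proof (induction t)
      case (Gen x)
      then show ?case using X unfolding tm_bdry_wf_def globular_set_def
        by (auto intro!: eq_refl)
    next
      case (Idt t)
      then show ?case using k less by (auto simp: tm_bdry_wf_def intro!: eq_refl)
    next
      case (Cmp p u v)
      then have p: "p < k" "p \<le> n" and u: "tm_wf X k u" "tm_bdry_wf X k u" and v: "tm_wf X k v" "tm_bdry_wf X k v"
        and uv: "tm_eq X p (bd (tm_src X) p k u) (bd (tm_tgt X) p k v)"
        using k by (auto simp: tm_wf_Cmp)
      have wf1: "tm_wf X n (tm_src X n u)" "tm_wf X n (tm_tgt X n u)" "tm_wf X n (tm_src X n v)" "tm_wf X n (tm_tgt X n v)"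
        using u v k by (auto simp: tm_bdry_wf_def)
      \<comment> \<open>For \<open>p < n\<close> the source and target of \<open>u\<close> have
        congruent \<open>p\<close>-sources, and those of \<open>v\<close> congruent
        \<open>p\<close>-targets, so the composability of \<open>u\<close> and \<open>v\<close>
        passes to both ends.\<close>
      have wf2: "tm_wf X n (Cmp p (tm_src X n u) (tm_src X n v))"
         "tm_wf X n (Cmp p (tm_tgt X n u) (tm_tgt X n v))" if "p < n"
        using that wf1 uv glob(1)[OF that u(2)] glob(2)[OF that v(2)] k unfolding tm_wf_Cmp
        by (auto intro: eq_trans eq_sym)
      have wf3: "tm_wf X n (tm_src X n (Cmp p u v)) \<and> tm_wf X n (tm_tgt X n (Cmp p u v))"
        using wf1 wf2 p by auto
      have "tm_eq X j (tm_src X j (tm_src X n (Cmp p u v))) (tm_src X j (tm_tgt X n (Cmp p u v))) \<and>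
         tm_eq X j (tm_tgt X j (tm_src X n (Cmp p u v))) (tm_tgt X j (tm_tgt X n (Cmp p u v)))" if j: "n = Suc j" for j
      proof -
        have gu: "tm_eq X j (tm_src X j (tm_src X n u)) (tm_src X j (tm_tgt X n u))"
            "tm_eq X j (tm_tgt X j (tm_src X n u)) (tm_tgt X j (tm_tgt X n u))"
          and gv: "tm_eq X j (tm_src X j (tm_src X n v)) (tm_src X j (tm_tgt X n v))"
            "tm_eq X j (tm_tgt X j (tm_src X n v)) (tm_tgt X j (tm_tgt X n v))"
          using u v k j by (auto simp: tm_bdry_wf_def)
        have bw: "tm_bdry_wf X n t" if "tm_wf X n t" for t using less that k by auto
        \<comment> \<open>For \<open>p = n\<close> the ends come from different factors and are
          linked through the composability condition; for \<open>p = j\<close> only the second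
          boundary step selects a factor; for \<open>p < j\<close> both steps act factor by
          factor.\<close>
        consider "p = n" | "p = j" | "p < j" using p j by linarith
        then show ?thesis
        proof cases
          case 1
          then have "tm_eq X n (tm_src X n u) (tm_tgt X n v)" using uv k by simp
          then have "tm_eq X j (tm_src X j (tm_src X n u)) (tm_src X j (tm_tgt X n v))"
             "tm_eq X j (tm_tgt X j (tm_src X n u)) (tm_tgt X j (tm_tgt X n v))"
            using IHeq[of j] k j by auto
          then show ?thesis using gu gv 1 by (simp, meson eq_trans eq_sym)
        next
          case 2
          then show ?thesis using gu gv j by simp
        next
          case 3
          then have "p < n" using j by simp
          from wf2[OF this, THEN bw] 3 j gu gv show ?thesis
            by (auto simp: tm_bdry_wf_def intro!: eq_Cmp)
        qed
      qed
      then show ?case using wf3 k by (auto simp: tm_bdry_wf_def)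
    qed
    \<comment> \<open>The rules for identities change the dimension, so the induction runs over a
      free \<open>k'\<close> and is specialised by the equation \<open>k' = k\<close>.\<close>
    have "tm_eq X k' t u \<Longrightarrow> k' = k \<longrightarrow> tm_bdry_eq X k t u" for t u k'
    proof (induction rule: tm_eq_induct)
      case (refl k' t)
      then show ?case using bwf[of t] by (auto simp: tm_bdry_eq_def tm_bdry_wf_def intro!: eq_refl)
    next
      case (sym k' t u)
      then show ?case by (auto simp: tm_bdry_eq_def intro: eq_sym)
    next
      case (trans k' t u v)
      then show ?case by (auto simp: tm_bdry_eq_def intro: eq_trans)
    next
      case (Idt k' t u)
      then show ?case by (auto simp: tm_bdry_eq_def)
    next
      case (Cmp k' p u v u' v')
      show ?case
      proof
        assume k': "k' = k"
        then have "tm_bdry_wf X k (Cmp p u v)" "tm_bdry_wf X k (Cmp p u' v')" using Cmp bwf by auto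
        then show "tm_bdry_eq X k (Cmp p u v) (Cmp p u' v')"
          using Cmp k k' by (auto simp: tm_bdry_eq_def tm_bdry_wf_def intro!: eq_Cmp)
      qed
    next
      case (assoc k' p w v u)
      show ?case
      proof
        assume k': "k' = k"
        then have "tm_bdry_wf X k (Cmp p (Cmp p w v) u)" "tm_bdry_wf X k (Cmp p w (Cmp p v u))" using assoc bwf by auto
        then show "tm_bdry_eq X k (Cmp p (Cmp p w v) u) (Cmp p w (Cmp p v u))"
          using k k' by (auto simp: tm_bdry_eq_def tm_bdry_wf_def split: if_splits intro!: eq_assoc eq_refl)
      qed
    next
      case (unit_left k' u p)
      let ?i = "oids (\<lambda>_. Idt) p"
      show ?case
      proof
        assume k': "k' = k"
        have u: "tm_bdry_wf X k u" and c: "tm_bdry_wf X k (Cmp p (?i k (bd (tm_tgt X) p k u)) u)" and p: "p < k"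
          using unit_left bwf k' tm_wf_Cmp by blast+
        have w: "tm_wf X n (tm_src X n u)" "tm_wf X n (tm_tgt X n u)" using u k by (auto simp: tm_bdry_wf_def)
        have "tm_bdry_eq X k (Cmp p (?i k (bd (tm_tgt X) p k u)) u) u"
        proof (cases "p = n")
          case True
          then show ?thesis using k w by (auto simp: tm_bdry_eq_def intro!: eq_refl)
        next
          case False
          then have pn: "p < n" using p k by auto
          then have c2: "tm_wf X n (Cmp p (?i n (bd (tm_tgt X) p k u)) (tm_src X n u))"
             "tm_wf X n (Cmp p (?i n (bd (tm_tgt X) p k u)) (tm_tgt X n u))"
            using c k by (auto simp: tm_bdry_wf_def)
          \<comment> \<open>The source of the left-hand side contains the identity on the
            \<open>p\<close>-target of \<open>u\<close>, while the unit law for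
            \<open>tm_src X n u\<close> wants the identity on the \<open>p\<close>-target of that
            source. These are congruent but different terms. On the target side they coincide
            literally.\<close>
          have e: "tm_eq X p (bd (tm_tgt X) p k u) (bd (tm_tgt X) p n (tm_src X n u))"
            using glob[OF pn u] k pn by (simp add: eq_sym)
          have e2: "tm_eq X n (?i n (bd (tm_tgt X) p k u)) (?i n (bd (tm_tgt X) p n (tm_src X n u)))"
            using tm_eq_oids[OF e] pn by simp
          have "tm_wf X n (Cmp p (?i n (bd (tm_tgt X) p n (tm_src X n u))) (tm_src X n u))"
          proof -
            have "bd (tm_src X) p n (?i n t) = t" for t using oids_Idt_bd[of p p n X] pn by simp
            moreover have "tm_eq X p (bd (tm_tgt X) p n (tm_src X n u)) (bd (tm_tgt X) p n (tm_src X n u))"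
              using e tm_eq_wf eq_refl by blast
            ultimately show ?thesis
              using pn w tm_eq_wf[OF e2] unfolding tm_wf_Cmp by simp
          qed
          then have "tm_eq X n (Cmp p (?i n (bd (tm_tgt X) p k u)) (tm_src X n u)) (tm_src X n u)"
            using c2(1) e2 w(1) by (blast intro: eq_trans[OF eq_Cmp eq_unit_left] eq_refl)
          moreover have "tm_eq X n (Cmp p (?i n (bd (tm_tgt X) p k u)) (tm_tgt X n u)) (tm_tgt X n u)"
            using c2(2) w pn k eq_unit_left[of X n "tm_tgt X n u" p] by simp
          ultimately show ?thesis using pn k by (auto simp: tm_bdry_eq_def)
        qed
        then show "tm_bdry_eq X k (Cmp p (?i k' (bd (tm_tgt X) p k' u)) u) u" using k' by simp
      qed
    next
      case (unit_right k' u p)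
      let ?i = "oids (\<lambda>_. Idt) p"
      show ?case
      proof
        assume k': "k' = k"
        have u: "tm_bdry_wf X k u" and c: "tm_bdry_wf X k (Cmp p u (?i k (bd (tm_src X) p k u)))" and p: "p < k"
          using unit_right bwf k' tm_wf_Cmp by blast+
        have w: "tm_wf X n (tm_src X n u)" "tm_wf X n (tm_tgt X n u)" using u k by (auto simp: tm_bdry_wf_def)
        have "tm_bdry_eq X k (Cmp p u (?i k (bd (tm_src X) p k u))) u"
        proof (cases "p = n")
          case True
          then show ?thesis using k w by (auto simp: tm_bdry_eq_def intro!: eq_refl)
        next
          case False
          then have pn: "p < n" using p k by auto
          then have c2: "tm_wf X n (Cmp p (tm_tgt X n u) (?i n (bd (tm_src X) p k u)))"
             "tm_wf X n (Cmp p (tm_src X n u) (?i n (bd (tm_src X) p k u)))"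
            using c k by (auto simp: tm_bdry_wf_def)
          \<comment> \<open>Mirror image of the left unit: now it is the target whose identity has
            to be exchanged.\<close>
          have e: "tm_eq X p (bd (tm_src X) p k u) (bd (tm_src X) p n (tm_tgt X n u))"
            using glob[OF pn u] k pn by (simp)
          have e2: "tm_eq X n (?i n (bd (tm_src X) p k u)) (?i n (bd (tm_src X) p n (tm_tgt X n u)))"
            using tm_eq_oids[OF e] pn by simp
          have "tm_wf X n (Cmp p (tm_tgt X n u) (?i n (bd (tm_src X) p n (tm_tgt X n u))))"
          proof -
            have "bd (tm_tgt X) p n (?i n t) = t" for t using oids_Idt_bd[of p p n X] pn by simp
            moreover have "tm_eq X p (bd (tm_src X) p n (tm_tgt X n u)) (bd (tm_src X) p n (tm_tgt X n u))"
              using e tm_eq_wf eq_refl by blast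
            ultimately show ?thesis
              using pn w tm_eq_wf[OF e2] unfolding tm_wf_Cmp by simp
          qed
          then have "tm_eq X n (Cmp p (tm_tgt X n u) (?i n (bd (tm_src X) p k u))) (tm_tgt X n u)"
            using c2(1) e2 w(2) by (blast intro: eq_trans[OF eq_Cmp eq_unit_right] eq_refl)
          moreover have "tm_eq X n (Cmp p (tm_src X n u) (?i n (bd (tm_src X) p k u))) (tm_src X n u)"
            using c2(2) w pn k eq_unit_right[of X n "tm_src X n u" p] by simp
          ultimately show ?thesis using pn k by (auto simp: tm_bdry_eq_def)
        qed
        then show "tm_bdry_eq X k (Cmp p u (?i k' (bd (tm_src X) p k' u))) u" using k' by simp
      qed
    next
      case (interchange p q k' y' y x' x)
      show ?case
      proof
        assume k': "k' = k"
        then have "tm_bdry_wf X k (Cmp p (Cmp q y' y) (Cmp q x' x))" "tm_bdry_wf X k (Cmp q (Cmp p y' x') (Cmp p y x))"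
          using interchange bwf by auto
        moreover have "q < k" using interchange k' by (simp add: tm_wf_Cmp)
        ultimately show "tm_bdry_eq X k (Cmp p (Cmp q y' y) (Cmp q x' x)) (Cmp q (Cmp p y' x') (Cmp p y x))"
          using k k' \<open>p < q\<close>
          by (auto simp: tm_bdry_eq_def tm_bdry_wf_def split: if_splits intro!: eq_interchange eq_refl)
      qed
    next
      case (id_interchange k' p u v)
      then have "p < k'" by (simp add: tm_wf_Cmp)
      with id_interchange show ?case by (auto simp: tm_bdry_eq_def intro!: eq_refl)
    qed
    then show ?thesis using bwf by blast
  qed
qed

lemma tm_wf_src: "globular_set X \<Longrightarrow> tm_wf X (Suc k) t \<Longrightarrow> tm_wf X k (tm_src X k t)"
  and tm_wf_tgt: "globular_set X \<Longrightarrow> tm_wf X (Suc k) t \<Longrightarrow> tm_wf X k (tm_tgt X k t)"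
  and tm_eq_src: "globular_set X \<Longrightarrow> tm_eq X (Suc k) t u \<Longrightarrow> tm_eq X k (tm_src X k t) (tm_src X k u)"
  and tm_eq_tgt: "globular_set X \<Longrightarrow> tm_eq X (Suc k) t u \<Longrightarrow> tm_eq X k (tm_tgt X k t) (tm_tgt X k u)"
  and tm_src_glob: "globular_set X \<Longrightarrow> tm_wf X (Suc (Suc k)) t \<Longrightarrow>
    tm_eq X k (tm_src X k (tm_src X (Suc k) t)) (tm_src X k (tm_tgt X (Suc k) t))"
  and tm_tgt_glob: "globular_set X \<Longrightarrow> tm_wf X (Suc (Suc k)) t \<Longrightarrow>
    tm_eq X k (tm_tgt X k (tm_src X (Suc k) t)) (tm_tgt X k (tm_tgt X (Suc k) t))"
  using tm_bdry[of X "Suc k"] tm_bdry[of X "Suc (Suc k)"] by (auto simp: tm_bdry_wf_def tm_bdry_eq_def)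

lemma tm_wf_bd:
  assumes "globular_set X"
  shows "tm_wf X k t \<Longrightarrow> p \<le> k \<Longrightarrow> tm_wf X p (bd (tm_src X) p k t) \<and> tm_wf X p (bd (tm_tgt X) p k t)"
  using assms by (induction k arbitrary: t) (auto simp: le_Suc_eq tm_wf_src tm_wf_tgt)

section \<open>The free strict omega-category\<close>

lemma mem_tm_class: "u \<in> tm_class X k t \<longleftrightarrow> tm_eq X k t u"
  by (simp add: tm_class_def)

text \<open>Well-formedness of \<open>t\<close> makes its class nonempty; all ill-formed terms share
  the empty class.\<close>

lemma tm_class_eq_iff:
  assumes "tm_wf X k t"
  shows "tm_class X k t = tm_class X k u \<longleftrightarrow> tm_eq X k t u"
proof
  assume "tm_class X k t = tm_class X k u"
  then have "t \<in> tm_class X k u" using eq_refl[OF assms] by (auto simp: mem_tm_class)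
  then show "tm_eq X k t u" by (simp add: mem_tm_class eq_sym)
next
  assume "tm_eq X k t u"
  then have "tm_eq X k t v \<longleftrightarrow> tm_eq X k u v" for v
    by (meson eq_sym eq_trans)
  then show "tm_class X k t = tm_class X k u" by (simp add: tm_class_def)
qed

lemma tm_class_eqI: "tm_eq X k t u \<Longrightarrow> tm_class X k t = tm_class X k u"
  using tm_class_eq_iff tm_eq_wf by blast

lemma cells_T: "c \<in> cells (T X) k \<longleftrightarrow> (\<exists>t. tm_wf X k t \<and> c = tm_class X k t)"
  by (auto simp: T_def)

lemma tm_class_in_T: "tm_wf X k t \<Longrightarrow> tm_class X k t \<in> cells (T X) k"
  by (auto simp: cells_T)

text \<open>Operations on classes are unions over all representatives. Such a union collapses to one
  value because a well-formed term represents its own class and the summand does not depend on the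
  representative.\<close>

lemma Union_tm_class:
  assumes "tm_wf X k t" "\<And>u. tm_eq X k t u \<Longrightarrow> g u = g t"
  shows "(\<Union>u\<in>tm_class X k t. g u) = g t"
proof (rule SUP_eq_const)
  show "tm_class X k t \<noteq> {}" using eq_refl[OF assms(1)] by (auto simp: mem_tm_class)
  show "g u = g t" if "u \<in> tm_class X k t" for u using that assms(2) by (simp add: mem_tm_class)
qed

lemma src_T_class:
  "globular_set X \<Longrightarrow> tm_wf X (Suc k) t \<Longrightarrow> src (T X) k (tm_class X (Suc k) t) = tm_class X k (tm_src X k t)"
  unfolding T_def by simp (rule Union_tm_class, assumption, rule tm_class_eqI, blast intro: eq_sym tm_eq_src)

lemma tgt_T_class:
  "globular_set X \<Longrightarrow> tm_wf X (Suc k) t \<Longrightarrow> tgt (T X) k (tm_class X (Suc k) t) = tm_class X k (tm_tgt X k t)"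
  unfolding T_def by simp (rule Union_tm_class, assumption, rule tm_class_eqI, blast intro: eq_sym tm_eq_tgt)

lemma globular_T:
  assumes X: "globular_set X"
  shows "globular_set (T X)"
  unfolding globular_set_def[of "T X"]
proof (intro conjI allI ballI)
  fix k c assume "c \<in> cells (T X) (Suc k)"
  then show "src (T X) k c \<in> cells (T X) k" "tgt (T X) k c \<in> cells (T X) k"
    using X by (auto simp: cells_T[of c] src_T_class tgt_T_class intro!: tm_class_in_T tm_wf_src tm_wf_tgt)
next
  fix k c assume "c \<in> cells (T X) (Suc (Suc k))"
  then obtain t where t: "tm_wf X (Suc (Suc k)) t" "c = tm_class X (Suc (Suc k)) t" by (auto simp: cells_T)
  show "src (T X) k (src (T X) (Suc k) c) = src (T X) k (tgt (T X) (Suc k) c)"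
    "tgt (T X) k (src (T X) (Suc k) c) = tgt (T X) k (tgt (T X) (Suc k) c)"
    using t X tm_class_eqI[OF tm_src_glob[OF X t(1)]] tm_class_eqI[OF tm_tgt_glob[OF X t(1)]]
    by (simp_all add: src_T_class tgt_T_class tm_wf_src tm_wf_tgt)
qed

lemma bd_T_class:
  "globular_set X \<Longrightarrow> tm_wf X k t \<Longrightarrow> p \<le> k \<Longrightarrow>
     bd (src (T X)) p k (tm_class X k t) = tm_class X p (bd (tm_src X) p k t) \<and>
     bd (tgt (T X)) p k (tm_class X k t) = tm_class X p (bd (tm_tgt X) p k t)"
  by (induction k arbitrary: t) (auto simp: le_Suc_eq src_T_class tgt_T_class tm_wf_src tm_wf_tgt)

lemma composable_T_class:
  assumes "globular_set X" "tm_wf X k u" "tm_wf X k v"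
  shows "composable (T X) p k (tm_class X k u) (tm_class X k v) \<longleftrightarrow> tm_wf X k (Cmp p u v)"
proof (cases "p < k")
  case True
  then show ?thesis
    using assms tm_class_eq_iff[of X p "bd (tm_src X) p k u" "bd (tm_tgt X) p k v"] tm_wf_bd[OF assms(1,2), of p]
    by (simp add: composable_def tm_wf_Cmp bd_T_class tm_class_in_T)
qed (simp add: composable_def tm_wf_Cmp)

lemma oid_T_class: "tm_wf X k t \<Longrightarrow> oid (T_omega X) k (tm_class X k t) = tm_class X (Suc k) (Idt t)"
  unfolding T_omega_def by simp (rule Union_tm_class, assumption, rule tm_class_eqI, blast intro: eq_sym eq_Idt)

lemma tm_eq_bd:
  assumes "globular_set X"
  shows "tm_eq X k t u \<Longrightarrow> p \<le> k \<Longrightarrow> tm_eq X p (bd (tm_src X) p k t) (bd (tm_src X) p k u)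
    \<and> tm_eq X p (bd (tm_tgt X) p k t) (bd (tm_tgt X) p k u)"
  using assms by (induction k arbitrary: t u) (auto simp: le_Suc_eq tm_eq_src tm_eq_tgt)

lemma tm_wf_Cmp_cong:
  assumes "globular_set X" "tm_wf X k (Cmp p u v)" "tm_eq X k u u'" "tm_eq X k v v'"
  shows "tm_wf X k (Cmp p u' v')"
proof -
  have p: "p < k" and "tm_eq X p (bd (tm_src X) p k u) (bd (tm_tgt X) p k v)"
    using assms(2) by (auto simp: tm_wf_Cmp)
  then have "tm_eq X p (bd (tm_src X) p k u') (bd (tm_tgt X) p k v')"
    using tm_eq_bd[OF assms(1,3), of p] tm_eq_bd[OF assms(1,4), of p]
    by (meson eq_trans eq_sym less_imp_le)
  then show ?thesis using p tm_eq_wf[OF assms(3)] tm_eq_wf[OF assms(4)] by (simp add: tm_wf_Cmp)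
qed

lemma tm_eq_Cmp_cong:
  assumes "globular_set X" "tm_wf X k (Cmp p u v)" "tm_eq X k u u'" "tm_eq X k v v'"
  shows "tm_eq X k (Cmp p u v) (Cmp p u' v')"
  using assms tm_wf_Cmp_cong eq_Cmp by blast

lemma ocomp_T_class:
  assumes "globular_set X" "tm_wf X k (Cmp p u v)"
  shows "ocomp (T_omega X) p k (tm_class X k u) (tm_class X k v) = tm_class X k (Cmp p u v)"
proof -
  have uv: "tm_wf X k u" "tm_wf X k v" using assms by (auto simp: tm_wf_Cmp)
  have *: "tm_class X k (Cmp p u' v') = tm_class X k (Cmp p u v)" if "tm_eq X k u u'" "tm_eq X k v v'" for u' v'
    using tm_class_eqI[OF tm_eq_Cmp_cong[OF assms that]] by (rule sym)
  have inner: "(\<Union>v'\<in>tm_class X k v. tm_class X k (Cmp p u' v')) = tm_class X k (Cmp p u v)"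
    if "tm_eq X k u u'" for u'
  proof -
    have "(\<Union>v'\<in>tm_class X k v. tm_class X k (Cmp p u' v')) = tm_class X k (Cmp p u' v)"
      by (rule Union_tm_class[OF uv(2)]) (rule trans[OF *[OF that] sym[OF *[OF that eq_refl[OF uv(2)]]]])
    also have "\<dots> = tm_class X k (Cmp p u v)" by (rule *[OF that eq_refl[OF uv(2)]])
    finally show ?thesis .
  qed
  have "ocomp (T_omega X) p k (tm_class X k u) (tm_class X k v) =
     (\<Union>u'\<in>tm_class X k u. \<Union>v'\<in>tm_class X k v. tm_class X k (Cmp p u' v'))"
    by (simp add: T_omega_def)
  also have "\<dots> = (\<Union>v'\<in>tm_class X k v. tm_class X k (Cmp p u v'))"
    by (rule Union_tm_class[OF uv(1)]) (rule trans[OF inner sym[OF inner[OF eq_refl[OF uv(1)]]]])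
  also have "\<dots> = tm_class X k (Cmp p u v)"
    by (rule inner[OF eq_refl[OF uv(1)]])
  finally show ?thesis .
qed

lemma oids_T_class: "tm_wf X p t \<Longrightarrow> p \<le> k \<Longrightarrow>
    tm_wf X k (oids (\<lambda>_. Idt) p k t) \<and>
    oids (oid (T_omega X)) p k (tm_class X p t) = tm_class X k (oids (\<lambda>_. Idt) p k t)"
  by (induction k) (auto simp: le_Suc_eq oid_T_class)

lemma composable_T:
  assumes "globular_set X"
  shows "composable (T X) p k c d \<longleftrightarrow>
    (\<exists>u v. c = tm_class X k u \<and> d = tm_class X k v \<and> tm_wf X k (Cmp p u v))"
proof
  assume *: "composable (T X) p k c d"
  then obtain u v where "tm_wf X k u" "c = tm_class X k u" "tm_wf X k v" "d = tm_class X k v"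
    by (auto simp: composable_def cells_T)
  then show "\<exists>u v. c = tm_class X k u \<and> d = tm_class X k v \<and> tm_wf X k (Cmp p u v)"
    using * composable_T_class[OF assms] by blast
next
  assume "\<exists>u v. c = tm_class X k u \<and> d = tm_class X k v \<and> tm_wf X k (Cmp p u v)"
  then show "composable (T X) p k c d"
    using composable_T_class[OF assms] by (auto simp: tm_wf_Cmp)
qed

text \<open>The axioms are rules of the congruence, but those rules ask for both sides to be
  well-formed. The four auxiliary facts supply this for associativity, interchange, units and
  identities of composites.\<close>

lemma T_omega_cat:
  assumes X: "globular_set X"
  shows "strict_omega_cat (T X) (T_omega X)"
proof -
  have comp_assoc_wf: "tm_wf X k (Cmp p (Cmp p w v) u) \<and> tm_wf X k (Cmp p w (Cmp p v u))"
    if "tm_wf X k (Cmp p w v)" "tm_wf X k (Cmp p v u)" for p k w v u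
    using that bd_Cmp_high[of p p k X] by (auto simp: tm_wf_Cmp)
  have ich: "tm_wf X k (Cmp p (Cmp q y' y) (Cmp q x' x)) \<and> tm_wf X k (Cmp q (Cmp p y' x') (Cmp p y x))"
    if pq: "p < q" and w: "tm_wf X k (Cmp q y' y)" "tm_wf X k (Cmp q x' x)" "tm_wf X k (Cmp p y x)"
      "tm_wf X k (Cmp p y' x')" for p q k y' y x' x
  proof
    have qk: "q < k" and wf: "tm_wf X k y'" "tm_wf X k y" "tm_wf X k x'" "tm_wf X k x" using w by (auto simp: tm_wf_Cmp)
    \<comment> \<open>\<open>x'\<close> and \<open>x\<close> meet in a common
      \<open>q\<close>-dimensional boundary, so by globularity they have the same
      \<open>p\<close>-target. The computation takes place among classes, where boundaries are equal
      and not merely congruent.\<close>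
    have "tm_class X p (bd (tm_tgt X) p k x') = tm_class X p (bd (tm_tgt X) p k x)"
    proof -
      have "bd (src (T X)) q k (tm_class X k x') = bd (tgt (T X)) q k (tm_class X k x)"
        using w(2) composable_T_class[OF X wf(3,4), of q] by (simp add: composable_def)
      then have "bd (tgt (T X)) p q (bd (src (T X)) q k (tm_class X k x')) = bd (tgt (T X)) p q (bd (tgt (T X)) q k (tm_class X k x))"
        by simp
      then have "bd (tgt (T X)) p k (tm_class X k x') = bd (tgt (T X)) p k (tm_class X k x)"
        using bd_tgt_src[OF globular_T[OF X] tm_class_in_T[OF wf(3)], of p q]
          bd_trans[of p q k] pq qk by simp
      then show ?thesis using bd_T_class[OF X] wf pq qk by simp
    qed
    then have e: "tm_eq X p (bd (tm_tgt X) p k x) (bd (tm_tgt X) p k x')"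
      using tm_class_eq_iff[of X p "bd (tm_tgt X) p k x" "bd (tm_tgt X) p k x'"] tm_wf_bd[OF X wf(4), of p] pq qk by simp
    have "tm_eq X p (bd (tm_src X) p k y) (bd (tm_tgt X) p k x)"
      using w by (simp add: tm_wf_Cmp)
    with e have "tm_eq X p (bd (tm_src X) p k y) (bd (tm_tgt X) p k x')"
      by (rule eq_trans[rotated])
    then show "tm_wf X k (Cmp p (Cmp q y' y) (Cmp q x' x))"
      using w bd_Cmp_high[of p q k X] pq qk by (simp add: tm_wf_Cmp[of _ _ p])
    have b: "tm_wf X q (bd (tm_src X) q k (Cmp p y' x'))"
      using tm_wf_bd[OF X w(4), of q] qk by simp
    \<comment> \<open>For \<open>p < q\<close> the \<open>q\<close>-boundary of a
      \<open>p\<close>-composite is the \<open>p\<close>-composite of the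
      \<open>q\<close>-boundaries, so the two given \<open>q\<close>-composability conditions
      combine factor by factor.\<close>
    have "tm_eq X q (Cmp p (bd (tm_src X) q k y') (bd (tm_src X) q k x'))
       (Cmp p (bd (tm_tgt X) q k y) (bd (tm_tgt X) q k x))"
      using w b pq qk bd_Cmp_low[of p q k X] by (intro tm_eq_Cmp_cong[OF X]) (auto simp: tm_wf_Cmp[of _ _ q])
    then show "tm_wf X k (Cmp q (Cmp p y' x') (Cmp p y x))"
      using w pq qk bd_Cmp_low[of p q k X] by (simp add: tm_wf_Cmp[of _ _ q])
  qed
  have unit: "tm_wf X k (Cmp p (oids (\<lambda>_. Idt) p k (bd (tm_tgt X) p k u)) u) \<and>
    tm_wf X k (Cmp p u (oids (\<lambda>_. Idt) p k (bd (tm_src X) p k u)))"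
    if "tm_wf X k u" "p < k" for p k u
    using that oids_Idt_bd[of p p k X] tm_wf_bd[OF X that(1), of p] oids_T_class[of X p _ k]
    by (auto simp: tm_wf_Cmp intro: eq_refl)
  have idw: "tm_wf X (Suc k) (Cmp p (Idt u) (Idt v))" if "tm_wf X k (Cmp p u v)" for p k u v
    using that by (auto simp: tm_wf_Cmp)
  note wfC = tm_wf_Cmp[THEN iffD1]
  show ?thesis
  proof
    show "globular_set (T X)" by (rule globular_T[OF X])
  next
    fix p k y x assume "composable (T X) p k y x"
    then show "ocomp (T_omega X) p k y x \<in> cells (T X) k"
      by (auto simp: composable_T[OF X] ocomp_T_class[OF X] tm_class_in_T)
  next
    fix x k assume "x \<in> cells (T X) k"
    then show "oid (T_omega X) k x \<in> cells (T X) (Suc k)"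
      by (auto simp: cells_T[of x] oid_T_class intro!: tm_class_in_T)
  next
    fix k y x assume "composable (T X) k (Suc k) y x"
    then show "src (T X) k (ocomp (T_omega X) k (Suc k) y x) = src (T X) k x"
      "tgt (T X) k (ocomp (T_omega X) k (Suc k) y x) = tgt (T X) k y"
      by (auto simp: composable_T[OF X] ocomp_T_class[OF X] src_T_class[OF X] tgt_T_class[OF X] tm_wf_Cmp[of X _ k])
  next
    fix p k y x assume "composable (T X) p (Suc k) y x" and pk: "p < k"
    then obtain u v where uv: "y = tm_class X (Suc k) u" "x = tm_class X (Suc k) v" "tm_wf X (Suc k) (Cmp p u v)"
      by (auto simp: composable_T[OF X])
    then have "tm_wf X k (Cmp p (tm_src X k u) (tm_src X k v))" "tm_wf X k (Cmp p (tm_tgt X k u) (tm_tgt X k v))"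
      using tm_wf_src[OF X uv(3)] tm_wf_tgt[OF X uv(3)] pk by auto
    then show "src (T X) k (ocomp (T_omega X) p (Suc k) y x) = ocomp (T_omega X) p k (src (T X) k y) (src (T X) k x)"
      "tgt (T X) k (ocomp (T_omega X) p (Suc k) y x) = ocomp (T_omega X) p k (tgt (T X) k y) (tgt (T X) k x)"
      using uv wfC[OF uv(3)] pk by (simp_all add: ocomp_T_class[OF X] src_T_class[OF X] tgt_T_class[OF X])
  next
    fix x k assume "x \<in> cells (T X) k"
    then obtain t where "tm_wf X k t" "x = tm_class X k t" by (auto simp: cells_T)
    then show "src (T X) k (oid (T_omega X) k x) = x" "tgt (T X) k (oid (T_omega X) k x) = x"
      by (simp_all add: oid_T_class src_T_class[OF X] tgt_T_class[OF X])
  next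
    fix p k z y x assume "composable (T X) p k z y" "composable (T X) p k y x"
    moreover obtain w v u where wvu: "z = tm_class X k w" "y = tm_class X k v" "x = tm_class X k u"
      "tm_wf X k w" "tm_wf X k v" "tm_wf X k u"
      using calculation by (auto simp: composable_def cells_T)
    ultimately have a: "tm_wf X k (Cmp p w v)" "tm_wf X k (Cmp p v u)"
      by (auto simp: composable_T_class[OF X])
    note b = comp_assoc_wf[OF this]
    show "ocomp (T_omega X) p k (ocomp (T_omega X) p k z y) x = ocomp (T_omega X) p k z (ocomp (T_omega X) p k y x)"
      using a b wvu eq_assoc[of X k p w v u] by (simp add: ocomp_T_class[OF X] tm_class_eqI)
  next
    fix x k p assume "x \<in> cells (T X) k" and pk: "p < k"
    then obtain u where u: "x = tm_class X k u" "tm_wf X k u" by (auto simp: cells_T)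
    note w = unit[OF u(2) pk]
    show "ocomp (T_omega X) p k (oids (oid (T_omega X)) p k (bd (tgt (T X)) p k x)) x = x"
      "ocomp (T_omega X) p k x (oids (oid (T_omega X)) p k (bd (src (T X)) p k x)) = x"
      using u w pk tm_wf_bd[OF X u(2), of p] oids_T_class[of X p _ k]
      tm_class_eqI[OF eq_unit_left[OF u(2) conjunct1[OF w]]] tm_class_eqI[OF eq_unit_right[OF u(2) conjunct2[OF w]]]
      by (simp_all add: ocomp_T_class[OF X] bd_T_class[OF X])
  next
    fix p q k y' y x' x
    assume pq: "p < q" and c: "composable (T X) q k y' y" "composable (T X) q k x' x"
       "composable (T X) p k y x" "composable (T X) p k y' x'"
    moreover obtain v' v u' u where uv: "y' = tm_class X k v'" "y = tm_class X k v" "x' = tm_class X k u'" "x = tm_class X k u"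
      "tm_wf X k v'" "tm_wf X k v" "tm_wf X k u'" "tm_wf X k u"
      using calculation by (auto simp: composable_def cells_T)
    ultimately have w: "tm_wf X k (Cmp q v' v)" "tm_wf X k (Cmp q u' u)" "tm_wf X k (Cmp p v u)" "tm_wf X k (Cmp p v' u')"
      by (auto simp: composable_T_class[OF X])
    note b = ich[OF pq w]
    show "ocomp (T_omega X) p k (ocomp (T_omega X) q k y' y) (ocomp (T_omega X) q k x' x) =
          ocomp (T_omega X) q k (ocomp (T_omega X) p k y' x') (ocomp (T_omega X) p k y x)"
      using w uv b pq tm_class_eqI[OF eq_interchange[OF pq conjunct1[OF b] conjunct2[OF b]]]
      by (simp add: ocomp_T_class[OF X])
  next
    fix p k y x assume "composable (T X) p k y x"
    then obtain u v where uv: "y = tm_class X k u" "x = tm_class X k v" "tm_wf X k (Cmp p u v)"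
      by (auto simp: composable_T[OF X])
    then show "ocomp (T_omega X) p (Suc k) (oid (T_omega X) k y) (oid (T_omega X) k x) =
       oid (T_omega X) k (ocomp (T_omega X) p k y x)"
      using wfC[OF uv(3)] idw[OF uv(3)] tm_class_eqI[OF eq_id_interchange[OF uv(3) idw[OF uv(3)]]]
      by (simp add: ocomp_T_class[OF X] oid_T_class)
  qed
qed

lemma T_eta_mem: "x \<in> cells X k \<Longrightarrow> T_eta X k x \<in> cells (T X) k"
  by (simp add: T_eta_def tm_class_in_T)

lemma T_eta_glob: "globular_set X \<Longrightarrow> globular_map X (T X) (T_eta X)"
  by (auto simp: globular_map_def T_eta_mem) (auto simp: T_eta_def src_T_class tgt_T_class)

text \<open>Generation of \<open>T X\<close> by its generators under identities and composites; this
  lets later inductions speak of classes instead of terms.\<close>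

lemma T_induct [consumes 2, case_names eta oid ocomp]:
  assumes X: "globular_set X" and c: "c \<in> cells (T X) k"
    and eta: "\<And>k x. x \<in> cells X k \<Longrightarrow> Q k (T_eta X k x)"
    and oid: "\<And>k c. c \<in> cells (T X) k \<Longrightarrow> Q k c \<Longrightarrow> Q (Suc k) (oid (T_omega X) k c)"
    and ocomp: "\<And>p k c d. composable (T X) p k c d \<Longrightarrow> Q k c \<Longrightarrow> Q k d \<Longrightarrow> Q k (ocomp (T_omega X) p k c d)"
  shows "Q k c"
proof -
  obtain t where t: "tm_wf X k t" "c = tm_class X k t" using c by (auto simp: cells_T)
  have "tm_wf X k t \<Longrightarrow> Q k (tm_class X k t)"
  proof (induction t arbitrary: k)
    case (Gen x)
    then show ?case using eta by (simp add: T_eta_def)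
  next
    case (Idt t)
    then show ?case using oid[OF tm_class_in_T] by (cases k) (auto simp: oid_T_class)
  next
    case (Cmp p u v)
    then have "tm_wf X k u" "tm_wf X k v" by (auto simp: tm_wf_Cmp)
    then show ?case using ocomp[of p k "tm_class X k u" "tm_class X k v"] Cmp
      by (simp add: composable_T_class[OF X] ocomp_T_class[OF X])
  qed
  then show ?thesis using t by simp
qed

section \<open>Globular maps and strict functors out of a free omega-category\<close>

lemma globular_map_bd:
  "globular_map X Y f \<Longrightarrow> globular_set X \<Longrightarrow> x \<in> cells X k \<Longrightarrow> p \<le> k \<Longrightarrow>
    f p (bd (src X) p k x) = bd (src Y) p k (f k x) \<and> f p (bd (tgt X) p k x) = bd (tgt Y) p k (f k x)"
  by (induction k arbitrary: x) (auto simp: le_Suc_eq globular_map_def globular_set_def)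

lemma composable_map:
  assumes "globular_map X Y f" "globular_set X" "composable X p k y x"
  shows "composable Y p k (f k y) (f k x)"
  using assms globular_map_bd[OF assms(1,2), of _ k p]
  by (auto simp: composable_def) (auto simp: globular_map_def, metis less_imp_le)

lemma globular_map_comp:
  "globular_map X Y f \<Longrightarrow> globular_map Y Z g \<Longrightarrow> globular_map X Z (\<lambda>k x. g k (f k x))"
  by (simp add: globular_map_def)

lemma functor_comp:
  assumes "globular_set X" "strict_omega_functor X C Y D f" "strict_omega_functor Y D Z E g"
  shows "strict_omega_functor X C Z E (\<lambda>k x. g k (f k x))"
  using assms composable_map[of X Y f] globular_map_comp[of X Y f Z g]
  unfolding strict_omega_functor_def by (auto simp: globular_map_def)

lemma functor_eqI:
  assumes X: "globular_set X"
    and "strict_omega_functor (T X) (T_omega X) Y D f" "strict_omega_functor (T X) (T_omega X) Y D g"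
    and "\<And>k x. x \<in> cells X k \<Longrightarrow> f k (T_eta X k x) = g k (T_eta X k x)"
    and "c \<in> cells (T X) k"
  shows "f k c = g k c"
  using X assms(5,2-4)
proof (induction rule: T_induct)
  case (ocomp p k c d)
  then show ?case by (simp add: strict_omega_functor_def)
qed (auto simp: strict_omega_functor_def)

section \<open>The action of the free construction on maps\<close>

lemma tm_map_src:
  assumes "globular_map X Y f"
  shows "tm_wf X (Suc k) t \<Longrightarrow> tm_map f k (tm_src X k t) = tm_src Y k (tm_map f (Suc k) t) \<and>
    tm_map f k (tm_tgt X k t) = tm_tgt Y k (tm_map f (Suc k) t)"
  using assms by (induction t) (auto simp: globular_map_def tm_wf_Cmp)

lemma tm_map_bd:
  assumes "globular_map X Y f" "globular_set X"
  shows "tm_wf X k t \<Longrightarrow> p \<le> k \<Longrightarrow> tm_map f p (bd (tm_src X) p k t) = bd (tm_src Y) p k (tm_map f k t) \<and>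
    tm_map f p (bd (tm_tgt X) p k t) = bd (tm_tgt Y) p k (tm_map f k t)"
  using assms by (induction k arbitrary: t) (auto simp: le_Suc_eq tm_map_src[OF assms(1)] tm_wf_src tm_wf_tgt)

lemma tm_map_oids: "p \<le> k \<Longrightarrow> tm_map f k (oids (\<lambda>_. Idt) p k t) = oids (\<lambda>_. Idt) p k (tm_map f p t)"
  by (induction k) (auto simp: le_Suc_eq)

text \<open>Composability of the image of a composite is a congruence statement one level down, so
  well-formedness and congruence have to be transported together.\<close>

lemma tm_map_wf_eq:
  assumes f: "globular_map X Y f" and X: "globular_set X"
  shows "tm_wf X k t \<Longrightarrow> tm_wf Y k (tm_map f k t)"
    and "tm_eq X k' t' u' \<Longrightarrow> tm_eq Y k' (tm_map f k' t') (tm_map f k' u')"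
proof (induction rule: tm_wf_tm_eq.inducts)
  case (wf_Gen x k)
  then show ?case using f by (auto simp: globular_map_def)
next
  case (wf_Cmp p k u v)
  then show ?case using tm_map_bd[OF f X] by (simp add: tm_wf_Cmp)
next
  case (eq_unit_left k u p)
  then have "p < k" by (simp add: tm_wf_Cmp)
  with eq_unit_left show ?case
    using tm_wf_tm_eq.eq_unit_left[of Y k "tm_map f k u" p] tm_map_bd[OF f X, of k u p] by (simp add: tm_map_oids)
next
  case (eq_unit_right k u p)
  then have "p < k" by (simp add: tm_wf_Cmp)
  with eq_unit_right show ?case
    using tm_wf_tm_eq.eq_unit_right[of Y k "tm_map f k u" p] tm_map_bd[OF f X, of k u p] by (simp add: tm_map_oids)
qed (auto intro: tm_wf_tm_eq.intros)

lemma T_map_class: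
  assumes "globular_map X Y f" "globular_set X" "tm_wf X k t"
  shows "T_map Y f k (tm_class X k t) = tm_class Y k (tm_map f k t)"
  unfolding T_map_def
  by (rule Union_tm_class[OF assms(3)], rule tm_class_eqI, rule eq_sym, erule tm_map_wf_eq(2)[OF assms(1,2)])

lemma T_map_functor:
  assumes f: "globular_map X Y f" and X: "globular_set X" and Y: "globular_set Y"
  shows "strict_omega_functor (T X) (T_omega X) (T Y) (T_omega Y) (T_map Y f)"
  unfolding strict_omega_functor_def
proof (intro conjI allI impI ballI)
  have "T_map Y f k c \<in> cells (T Y) k" if "c \<in> cells (T X) k" for k c
  proof -
    obtain t where t: "tm_wf X k t" "c = tm_class X k t" using \<open>c \<in> cells (T X) k\<close> by (auto simp: cells_T)
    then show ?thesis using tm_class_in_T[OF tm_map_wf_eq(1)[OF f X t(1)]] by (simp add: T_map_class[OF f X])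
  qed
  moreover have "T_map Y f k (src (T X) k c) = src (T Y) k (T_map Y f (Suc k) c) \<and>
      T_map Y f k (tgt (T X) k c) = tgt (T Y) k (T_map Y f (Suc k) c)" if "c \<in> cells (T X) (Suc k)" for k c
  proof -
    obtain t where t: "tm_wf X (Suc k) t" "c = tm_class X (Suc k) t" using \<open>c \<in> cells (T X) (Suc k)\<close> by (auto simp: cells_T)
    then show ?thesis using tm_map_src[OF f t(1)] tm_map_wf_eq(1)[OF f X t(1)]
      by (simp add: T_map_class[OF f X] src_T_class[OF X] tgt_T_class[OF X]
         src_T_class[OF Y] tgt_T_class[OF Y] tm_wf_src[OF X] tm_wf_tgt[OF X])
  qed
  ultimately show "globular_map (T X) (T Y) (T_map Y f)" by (simp add: globular_map_def)
next
  fix p k y x assume "composable (T X) p k y x"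
  then obtain u v where uv: "y = tm_class X k u" "x = tm_class X k v" "tm_wf X k (Cmp p u v)"
    by (auto simp: composable_T[OF X])
  then show "T_map Y f k (ocomp (T_omega X) p k y x) = ocomp (T_omega Y) p k (T_map Y f k y) (T_map Y f k x)"
    using tm_map_wf_eq(1)[OF f X uv(3)]
    by (simp add: ocomp_T_class[OF X] ocomp_T_class[OF Y] T_map_class[OF f X] tm_wf_Cmp[of X])
next
  fix k x assume "x \<in> cells (T X) k"
  then show "T_map Y f (Suc k) (oid (T_omega X) k x) = oid (T_omega Y) k (T_map Y f k x)"
    using tm_map_wf_eq(1)[OF f X] by (auto simp: cells_T oid_T_class T_map_class[OF f X])
qed

lemma T_map_eta: "globular_map X Y f \<Longrightarrow> globular_set X \<Longrightarrow> x \<in> cells X k \<Longrightarrow>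
    T_map Y f k (T_eta X k x) = T_eta Y k (f k x)"
  by (simp add: T_eta_def T_map_class)

section \<open>Evaluation of formal composites in a strict omega-category\<close>

lemma tm_eval_oids: "p \<le> k \<Longrightarrow> tm_eval C k (oids (\<lambda>_. Idt) p k t) = oids (oid C) p k (tm_eval C p t)"
  by (induction k) (auto simp: le_Suc_eq)

text \<open>Evaluating a composite requires actual composability in \<open>X\<close>, which comes
  from formal congruence in a lower dimension. Hence soundness for the congruence and compatibility
  with boundaries share one strong induction on \<open>k\<close>.\<close>

lemma (in strict_omega_cat) tm_eval_wf_eq:
  "(\<forall>t. tm_wf X k t \<longrightarrow> tm_eval C k t \<in> cells X k \<and>
     (\<forall>j. k = Suc j \<longrightarrow> src X j (tm_eval C k t) = tm_eval C j (tm_src X j t) \<and>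
        tgt X j (tm_eval C k t) = tm_eval C j (tm_tgt X j t))) \<and>
   (\<forall>t u. tm_eq X k t u \<longrightarrow> tm_eval C k t = tm_eval C k u)"
proof (induction k rule: less_induct)
  case (less k)
  define W where "W k t \<longleftrightarrow> tm_eval C k t \<in> cells X k \<and>
     (\<forall>j. k = Suc j \<longrightarrow> src X j (tm_eval C k t) = tm_eval C j (tm_src X j t) \<and>
        tgt X j (tm_eval C k t) = tm_eval C j (tm_tgt X j t))" for k t
  have IHw: "W j t" if "j < k" "tm_wf X j t" for j t
    using less that by (auto simp: W_def)
  have IHe: "tm_eval C j t = tm_eval C j u" if "j < k" "tm_eq X j t u" for j t u
    using less that by auto
  have bd1: "i < k \<Longrightarrow> p \<le> i \<Longrightarrow> tm_wf X i t \<Longrightarrow> bd (src X) p i (tm_eval C i t) = tm_eval C p (bd (tm_src X) p i t) \<and>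
     bd (tgt X) p i (tm_eval C i t) = tm_eval C p (bd (tm_tgt X) p i t)" for p i t
    by (induction i arbitrary: t) (use IHw in \<open>auto simp: W_def le_Suc_eq tm_wf_src[OF glob] tm_wf_tgt[OF glob]\<close>)
  have bdk: "bd (src X) p k (tm_eval C k t) = tm_eval C p (bd (tm_src X) p k t) \<and>
     bd (tgt X) p k (tm_eval C k t) = tm_eval C p (bd (tm_tgt X) p k t)" if "p < k" "W k t" "tm_wf X k t" for p t
    using that bd1 by (cases k) (auto simp: W_def tm_wf_src[OF glob] tm_wf_tgt[OF glob])
  \<comment> \<open>Formal composability is a congruence in dimension \<open>p < k\<close>; the
    induction hypothesis turns it into an equality of boundaries in \<open>X\<close>.\<close>
  have comp: "composable X p k (tm_eval C k u) (tm_eval C k v)" if "tm_wf X k (Cmp p u v)" "W k u" "W k v" for p u v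
    using that bdk[of p u] bdk[of p v] IHe[of p] by (auto simp: composable_def tm_wf_Cmp W_def)
  have w: "tm_wf X k t \<Longrightarrow> W k t" for t
  proof (induction t)
    case (Gen x)
    then show ?case by (simp add: W_def)
  next
    case (Idt t)
    then show ?case using IHw by (cases k) (auto simp: W_def id_cell src_id tgt_id)
  next
    case (Cmp p u v)
    then have W: "W k u" "W k v" by (auto simp: tm_wf_Cmp)
    note c = comp[OF Cmp.prems W]
    then have "p < k" by (simp add: composable_def)
    then show ?case using W c comp_cell[OF c] src_comp_top[of p] tgt_comp_top[of p] src_comp tgt_comp
      by (auto simp: W_def)
  qed
  have comp: "composable X p k (tm_eval C k u) (tm_eval C k v)" if "tm_wf X k (Cmp p u v)" for p u v
    using that comp w by (simp add: tm_wf_Cmp)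
  \<comment> \<open>The case names of the induction below shadow these axioms of the locale.\<close>
  note ax_assoc = assoc and ax_ul = unit_left and ax_ur = unit_right and ax_ich = interchange
    and ax_id = id_interchange
  have "tm_eq X k' t u \<Longrightarrow> k' = k \<longrightarrow> tm_eval C k t = tm_eval C k u" for k' t u
  proof (induction rule: tm_eq_induct)
    case (Idt k' t u)
    then show ?case using IHe[of k' t u] by auto
  next
    case (assoc k' p w v u)
    then have "tm_wf X k' (Cmp p w v)" "tm_wf X k' (Cmp p v u)" using tm_wf_Cmp by blast+
    then show ?case using comp[of p w v] comp[of p v u] ax_assoc by auto
  next
    case (unit_left k' u p)
    show ?case
    proof
      assume k: "k' = k"
      then have p: "p < k" and u: "tm_wf X k u" using unit_left tm_wf_Cmp by blast+
      have "bd (tgt X) p k (tm_eval C k u) = tm_eval C p (bd (tm_tgt X) p k u)" "tm_eval C k u \<in> cells X k"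
        using bdk[OF p w[OF u] u] w[OF u] by (simp_all add: W_def)
      then show "tm_eval C k (Cmp p (oids (\<lambda>_. Idt) p k' (bd (tm_tgt X) p k' u)) u) = tm_eval C k u"
        using p ax_ul[of "tm_eval C k u" k p] k by (simp add: tm_eval_oids)
    qed
  next
    case (unit_right k' u p)
    show ?case
    proof
      assume k: "k' = k"
      then have p: "p < k" and u: "tm_wf X k u" using unit_right tm_wf_Cmp by blast+
      have "bd (src X) p k (tm_eval C k u) = tm_eval C p (bd (tm_src X) p k u)" "tm_eval C k u \<in> cells X k"
        using bdk[OF p w[OF u] u] w[OF u] by (simp_all add: W_def)
      then show "tm_eval C k (Cmp p u (oids (\<lambda>_. Idt) p k' (bd (tm_src X) p k' u))) = tm_eval C k u"
        using p ax_ur[of "tm_eval C k u" k p] k by (simp add: tm_eval_oids)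
    qed
  next
    case (interchange p q k' y' y x' x)
    show ?case
    proof
      assume k: "k' = k"
      then have "tm_wf X k (Cmp q y' y)" "tm_wf X k (Cmp q x' x)" "tm_wf X k (Cmp p y x)" "tm_wf X k (Cmp p y' x')"
        using interchange tm_wf_Cmp by blast+
      from ax_ich[OF interchange(1) this[THEN comp]]
      show "tm_eval C k (Cmp p (Cmp q y' y) (Cmp q x' x)) = tm_eval C k (Cmp q (Cmp p y' x') (Cmp p y x))"
        by simp
    qed
  next
    case (id_interchange k' p u v)
    \<comment> \<open>The composite under the identity lives one dimension below \<open>k\<close>,
      so its composability comes from the induction hypothesis and not from
      \<open>comp\<close>.\<close>
    have "composable X p k' (tm_eval C k' u) (tm_eval C k' v)" if "k = Suc k'"
    proof -
      have *: "p < k'" "tm_wf X k' u" "tm_wf X k' v" "tm_eq X p (bd (tm_src X) p k' u) (bd (tm_tgt X) p k' v)"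
        using id_interchange by (auto simp: tm_wf_Cmp)
      then show ?thesis using that bd1[of k' p u] bd1[of k' p v] IHw[of k'] IHe[of p]
        by (auto simp: composable_def W_def)
    qed
    then have "tm_eval C (Suc k') (Cmp p (Idt u) (Idt v)) = tm_eval C (Suc k') (Idt (Cmp p u v))" if "k = Suc k'"
      using ax_id that by simp
    then show ?case by blast
  qed auto
  then show ?case using w unfolding W_def by blast
qed

lemma (in strict_omega_cat) T_eval_class: "tm_wf X k t \<Longrightarrow> T_eval C k (tm_class X k t) = tm_eval C k t"
proof -
  assume t: "tm_wf X k t"
  have "tm_eval C k u = tm_eval C k t" if "u \<in> tm_class X k t" for u
    using that tm_eval_wf_eq[of k] by (metis mem_tm_class)
  moreover have "t \<in> tm_class X k t" using eq_refl[OF t] by (simp add: mem_tm_class)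
  ultimately have "tm_eval C k ` tm_class X k t = {tm_eval C k t}" by blast
  then show ?thesis by (simp add: T_eval_def)
qed

lemma (in strict_omega_cat) T_eval_functor: "strict_omega_functor (T X) (T_omega X) X C (T_eval C)"
  unfolding strict_omega_functor_def
proof (intro conjI allI impI ballI)
  have "T_eval C k c \<in> cells X k" if "c \<in> cells (T X) k" for k c
    using that tm_eval_wf_eq[of k] by (auto simp: cells_T T_eval_class)
  moreover have "T_eval C k (src (T X) k c) = src X k (T_eval C (Suc k) c) \<and>
      T_eval C k (tgt (T X) k c) = tgt X k (T_eval C (Suc k) c)" if "c \<in> cells (T X) (Suc k)" for k c
  proof -
    obtain t where t: "tm_wf X (Suc k) t" "c = tm_class X (Suc k) t" using \<open>c \<in> cells (T X) (Suc k)\<close> by (auto simp: cells_T)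
    have "src X k (tm_eval C (Suc k) t) = tm_eval C k (tm_src X k t) \<and>
       tgt X k (tm_eval C (Suc k) t) = tm_eval C k (tm_tgt X k t)"
      using tm_eval_wf_eq[of "Suc k"] t(1) by blast
    then show ?thesis using t
      by (simp add: T_eval_class src_T_class[OF glob] tgt_T_class[OF glob] tm_wf_src[OF glob] tm_wf_tgt[OF glob])
  qed
  ultimately show "globular_map (T X) X (T_eval C)" by (simp add: globular_map_def)
next
  fix p k y x assume "composable (T X) p k y x"
  then obtain u v where uv: "y = tm_class X k u" "x = tm_class X k v" "tm_wf X k (Cmp p u v)"
    by (auto simp: composable_T[OF glob])
  then show "T_eval C k (ocomp (T_omega X) p k y x) = ocomp C p k (T_eval C k y) (T_eval C k x)"
    by (simp add: ocomp_T_class[OF glob] T_eval_class tm_wf_Cmp[of X])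
next
  fix k x assume "x \<in> cells (T X) k"
  then show "T_eval C (Suc k) (oid (T_omega X) k x) = oid C k (T_eval C k x)"
    by (auto simp: cells_T oid_T_class T_eval_class)
qed

lemma (in strict_omega_cat) T_eval_eta: "x \<in> cells X k \<Longrightarrow> T_eval C k (T_eta X k x) = x"
  by (simp add: T_eta_def T_eval_class)

section \<open>Powers and the monad structure\<close>

lemma cells_gpow: "xs \<in> cells (gpow A n) k \<longleftrightarrow> length xs = n \<and> set xs \<subseteq> cells A k"
  by (simp add: gpow_def)

lemma cells_gpow_nth: "xs \<in> cells (gpow A n) k \<longleftrightarrow> length xs = n \<and> (\<forall>i<n. xs ! i \<in> cells A k)"
  by (auto simp: cells_gpow set_conv_nth)

lemma src_gpow: "src (gpow A n) k xs = map (src A k) xs"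
  and tgt_gpow: "tgt (gpow A n) k xs = map (tgt A k) xs"
  by (simp_all add: gpow_def)

lemma ocomp_omega_pow: "ocomp (omega_pow C) p k ys xs = map2 (ocomp C p k) ys xs"
  and oid_omega_pow: "oid (omega_pow C) k xs = map (oid C k) xs"
  by (simp_all add: omega_pow_def)

lemma globular_gpow: "globular_set A \<Longrightarrow> globular_set (gpow A n)"
  by (auto simp: globular_set_def cells_gpow_nth src_gpow tgt_gpow list_eq_iff_nth_eq simp del: map_eq_conv)

lemma bd_gpow: "bd (src (gpow A n)) p k xs = map (bd (src A) p k) xs"
  "bd (tgt (gpow A n)) p k xs = map (bd (tgt A) p k) xs"
proof -
  \<comment> \<open>The recursion equations in point-free form, so that mapping over a list fuses
    with them.\<close>
  have *: "bd s p 0 = id" "bd s p (Suc k) = (if p < Suc k then bd s p k \<circ> s k else id)" for s k and p :: nat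
    by (auto simp: fun_eq_iff)
  show "bd (src (gpow A n)) p k xs = map (bd (src A) p k) xs"
    "bd (tgt (gpow A n)) p k xs = map (bd (tgt A) p k) xs"
    by (induction k arbitrary: xs) (simp_all add: * src_gpow tgt_gpow del: bd.simps)
qed

lemma oids_omega_pow: "oids (oid (omega_pow C)) p k xs = map (oids (oid C) p k) xs"
proof -
  have *: "oids i p 0 = id" "oids i p (Suc k) = (if p < Suc k then i k \<circ> oids i p k else id)" for i k and p :: nat
    by (auto simp: fun_eq_iff)
  show ?thesis
    by (induction k) (simp_all add: * oid_omega_pow del: oids.simps)
qed

lemma composable_gpow:
  "composable (gpow A n) p k ys xs \<longleftrightarrow> p < k \<and> length ys = n \<and> length xs = n \<and>
     (\<forall>i<n. composable A p k (ys ! i) (xs ! i))"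
proof -
  have "map f ys = map g xs \<longleftrightarrow> (\<forall>i<n. f (ys ! i) = g (xs ! i))" if "length ys = n" "length xs = n"
    for f g :: "'a \<Rightarrow> 'a"
    using that by (subst list_eq_iff_nth_eq) simp
  then show ?thesis unfolding composable_def cells_gpow_nth bd_gpow by blast
qed

lemma omega_pow_cat:
  assumes "strict_omega_cat A C"
  shows "strict_omega_cat (gpow A n) (omega_pow C)"
proof -
  interpret strict_omega_cat A C by fact
  note gp = composable_gpow cells_gpow_nth ocomp_omega_pow oid_omega_pow oids_omega_pow bd_gpow src_gpow tgt_gpow
  show ?thesis
  proof
    show "globular_set (gpow A n)" using globular_gpow glob by blast
    show "ocomp (omega_pow C) p k (ocomp (omega_pow C) q k y' y) (ocomp (omega_pow C) q k x' x) =
          ocomp (omega_pow C) q k (ocomp (omega_pow C) p k y' x') (ocomp (omega_pow C) p k y x)"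
      if "p < q" "composable (gpow A n) q k y' y" "composable (gpow A n) q k x' x"
        "composable (gpow A n) p k y x" "composable (gpow A n) p k y' x'" for p q k y' y x' x
      using that interchange[OF that(1), of k "y' ! _" "y ! _" "x' ! _" "x ! _"]
      by (auto simp: gp list_eq_iff_nth_eq)
  qed (auto simp: gp list_eq_iff_nth_eq comp_cell id_cell src_comp_top tgt_comp_top src_comp tgt_comp src_id tgt_id
      assoc unit_left unit_right id_interchange)
qed

lemma globular_map_mem: "globular_map X Y f \<Longrightarrow> x \<in> cells X k \<Longrightarrow> f k x \<in> cells Y k"
  by (simp add: globular_map_def)

text \<open>Pairing into a product, with concatenation identifying \<open>A^n \<times> A^m\<close>
  and \<open>A^(n+m)\<close>. The lengths matter because \<open>map2\<close> splits over
  concatenations only where the first parts are equally long.\<close>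

lemma functor_append:
  assumes "strict_omega_functor X D (gpow A n) (omega_pow C) F" "strict_omega_functor X D (gpow A m) (omega_pow C) G"
  shows "strict_omega_functor X D (gpow A (n + m)) (omega_pow C) (\<lambda>k x. F k x @ G k x)"
proof -
  have FG: "globular_map X (gpow A n) F" "globular_map X (gpow A m) G"
    using assms by (auto simp: strict_omega_functor_def)
  have len: "length (F k x) = n" "length (G k x) = m" if "x \<in> cells X k" for k x
    using globular_map_mem[OF FG(1) that] globular_map_mem[OF FG(2) that] by (auto simp: cells_gpow)
  have "globular_map X (gpow A (n + m)) (\<lambda>k x. F k x @ G k x)"
    using FG by (auto simp: globular_map_def cells_gpow src_gpow tgt_gpow)
  then show ?thesis using assms len
    by (auto simp: strict_omega_functor_def ocomp_omega_pow oid_omega_pow composable_def)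
qed

lemma functor_singleton: "strict_omega_functor A C (gpow A (Suc 0)) (omega_pow C) (\<lambda>k x. [x])"
  by (auto simp: strict_omega_functor_def globular_map_def cells_gpow src_gpow tgt_gpow ocomp_omega_pow oid_omega_pow)

lemma globular_map_take: "globular_map (gpow A (n + m)) (gpow A n) (\<lambda>_. take n)"
  and globular_map_drop: "globular_map (gpow A (n + m)) (gpow A m) (\<lambda>_. drop n)"
  by (auto simp: globular_map_def cells_gpow src_gpow tgt_gpow take_map drop_map dest!: in_set_takeD in_set_dropD)

lemma functor_map: "strict_omega_functor X C Y D f \<Longrightarrow> globular_map X Y f"
  by (simp add: strict_omega_functor_def)

lemma functor_id: "strict_omega_functor X C X C (\<lambda>k x. x)"
  by (simp add: strict_omega_functor_def globular_map_def)

section \<open>Functoriality and the monad laws, verified on generators\<close>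

lemma T_map_comp:
  assumes "globular_map X Y f" "globular_map Y Z g" "globular_set X" "globular_set Y" "globular_set Z"
    and "c \<in> cells (T X) k"
  shows "T_map Z g k (T_map Y f k c) = T_map Z (\<lambda>k x. g k (f k x)) k c"
proof (rule functor_eqI[OF assms(3) _ _ _ assms(6)])
  note fg = globular_map_comp[OF assms(1,2)]
  show "strict_omega_functor (T X) (T_omega X) (T Z) (T_omega Z) (\<lambda>k c. T_map Z g k (T_map Y f k c))"
    by (rule functor_comp[OF globular_T T_map_functor T_map_functor]) (use assms in simp_all)
  show "strict_omega_functor (T X) (T_omega X) (T Z) (T_omega Z) (T_map Z (\<lambda>k x. g k (f k x)))"
    by (rule T_map_functor[OF fg assms(3,5)])
  show "T_map Z g k (T_map Y f k (T_eta X k x)) = T_map Z (\<lambda>k x. g k (f k x)) k (T_eta X k x)"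
    if "x \<in> cells X k" for k x
    using assms(1-5) fg globular_map_mem[OF assms(1) that] that by (simp add: T_map_eta)
qed

lemma globular_map_cong:
  assumes "globular_map X Y f" "globular_set X" "\<And>k x. x \<in> cells X k \<Longrightarrow> f k x = g k x"
  shows "globular_map X Y g"
  unfolding globular_map_def
proof (intro conjI allI ballI)
  show "g k x \<in> cells Y k" if "x \<in> cells X k" for k x
    using globular_map_mem[OF assms(1) that] assms(3)[OF that] by simp
  fix k x assume x: "x \<in> cells X (Suc k)"
  then have "src X k x \<in> cells X k" "tgt X k x \<in> cells X k" using assms(2) by (auto simp: globular_set_def)
  then show "g k (src X k x) = src Y k (g (Suc k) x)" "g k (tgt X k x) = tgt Y k (g (Suc k) x)"
    using assms(1) x by (simp_all add: globular_map_def flip: assms(3))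
qed

lemma T_map_cong:
  assumes "globular_map X Y f" "globular_set X" "globular_set Y" "c \<in> cells (T X) k"
    and fg: "\<And>k x. x \<in> cells X k \<Longrightarrow> f k x = g k x"
  shows "T_map Y f k c = T_map Y g k c"
proof (rule functor_eqI[OF assms(2) _ _ _ assms(4)])
  have g: "globular_map X Y g" by (rule globular_map_cong[OF assms(1,2) fg])
  show "strict_omega_functor (T X) (T_omega X) (T Y) (T_omega Y) (T_map Y f)"
    "strict_omega_functor (T X) (T_omega X) (T Y) (T_omega Y) (T_map Y g)"
    using assms g by (auto intro: T_map_functor)
  show "T_map Y f k (T_eta X k x) = T_map Y g k (T_eta X k x)" if "x \<in> cells X k" for k x
    using that assms g by (auto simp: T_map_eta)
qed

lemma T_map_ident:
  assumes "globular_set X" "c \<in> cells (T X) k" "\<And>k x. x \<in> cells X k \<Longrightarrow> f k x = x"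
  shows "T_map X f k c = c"
proof -
  have f: "globular_map X X f"
    by (rule globular_map_cong[of _ _ "\<lambda>_ x. x"]) (use assms in \<open>auto simp: globular_map_def globular_set_def\<close>)
  show ?thesis
    by (rule functor_eqI[OF assms(1) T_map_functor[OF f assms(1,1)] functor_id _ assms(2)])
      (simp add: T_map_eta f assms)
qed

lemma T_mu_functor: "globular_set X \<Longrightarrow> strict_omega_functor (T (T X)) (T_omega (T X)) (T X) (T_omega X) (T_mu X)"
  unfolding T_mu_def using strict_omega_cat.T_eval_functor[OF T_omega_cat] .

lemma T_mu_eta: "globular_set X \<Longrightarrow> c \<in> cells (T X) k \<Longrightarrow> T_mu X k (T_eta (T X) k c) = c"
  unfolding T_mu_def by (rule strict_omega_cat.T_eval_eta[OF T_omega_cat])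

lemma T_map_mem: "globular_map X Y f \<Longrightarrow> globular_set X \<Longrightarrow> globular_set Y \<Longrightarrow> c \<in> cells (T X) k \<Longrightarrow> T_map Y f k c \<in> cells (T Y) k"
  by (rule globular_map_mem[OF functor_map[OF T_map_functor]])

lemma T_mu_mem: "globular_set X \<Longrightarrow> c \<in> cells (T (T X)) k \<Longrightarrow> T_mu X k c \<in> cells (T X) k"
  by (rule globular_map_mem[OF functor_map[OF T_mu_functor]])

lemma T_map_glob: "globular_map X Y f \<Longrightarrow> globular_set X \<Longrightarrow> globular_set Y \<Longrightarrow> globular_map (T X) (T Y) (T_map Y f)"
  by (rule functor_map[OF T_map_functor])

lemma T_map_mu:
  assumes f: "globular_map X Y f" and X: "globular_set X" and Y: "globular_set Y" and W: "W \<in> cells (T (T X)) k"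
  shows "T_map Y f k (T_mu X k W) = T_mu Y k (T_map (T Y) (T_map Y f) k W)"
proof (rule functor_eqI[OF globular_T[OF X] _ _ _ W])
  note Tf = T_map_functor[OF f X Y]
  show "strict_omega_functor (T (T X)) (T_omega (T X)) (T Y) (T_omega Y) (\<lambda>k W. T_map Y f k (T_mu X k W))"
    by (rule functor_comp[OF _ T_mu_functor Tf]) (simp_all add: X globular_T)
  show "strict_omega_functor (T (T X)) (T_omega (T X)) (T Y) (T_omega Y) (\<lambda>k W. T_mu Y k (T_map (T Y) (T_map Y f) k W))"
    by (rule functor_comp[OF _ T_map_functor[OF functor_map[OF Tf]] T_mu_functor]) (simp_all add: X Y globular_T)
  show "T_map Y f k (T_mu X k (T_eta (T X) k c)) = T_mu Y k (T_map (T Y) (T_map Y f) k (T_eta (T X) k c))"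
    if "c \<in> cells (T X) k" for k c
    using that T_map_mem[OF f X Y that] by (simp add: T_mu_eta T_map_eta X Y functor_map[OF Tf] globular_T)
qed

lemma T_mu_map_eta:
  assumes X: "globular_set X" and c: "c \<in> cells (T X) k"
  shows "T_mu X k (T_map (T X) (T_eta X) k c) = c"
proof (rule functor_eqI[OF X _ functor_id _ c])
  show "strict_omega_functor (T X) (T_omega X) (T X) (T_omega X) (\<lambda>k c. T_mu X k (T_map (T X) (T_eta X) k c))"
    by (rule functor_comp[OF _ T_map_functor T_mu_functor]) (simp_all add: X globular_T T_eta_glob)
qed (simp add: T_map_eta T_eta_glob X T_mu_eta T_eta_mem)

section \<open>Strict omega-categories as monad algebras\<close>

lemma composable_bdry:
  assumes "globular_set X" "composable X p (Suc k) y x" "p < k"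
  shows "composable X p k (src X k y) (src X k x)" "composable X p k (tgt X k y) (tgt X k x)"
  using assms bd_glob_step[OF assms(1) _ assms(3), of x] bd_glob_step[OF assms(1) _ assms(3), of y]
  by (auto simp: composable_def globular_set_def)

context strict_omega_cat
begin

lemma bd_ocomp:
  "composable X p k y x \<Longrightarrow>
    bd (src X) p k (ocomp C p k y x) = bd (src X) p k x \<and> bd (tgt X) p k (ocomp C p k y x) = bd (tgt X) p k y"
proof (induction k arbitrary: y x)
  case (Suc k)
  show ?case
  proof (cases "p = k")
    case True
    then show ?thesis using Suc src_comp_top tgt_comp_top by simp
  next
    case False
    then have p: "p < k" using Suc by (auto simp: composable_def)
    have "y \<in> cells X (Suc k)" "x \<in> cells X (Suc k)" using Suc by (auto simp: composable_def)
    then show ?thesis using Suc.IH[OF composable_bdry(1)[OF glob Suc.prems p]]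
        Suc.IH[OF composable_bdry(2)[OF glob Suc.prems p]] p src_comp[OF Suc.prems p] tgt_comp[OF Suc.prems p]
      by simp
  qed
qed (simp add: composable_def)

lemma bd_ocomp_high:
  assumes "composable X q k y x" "p < q"
  shows "bd (src X) p k (ocomp C q k y x) = bd (src X) p k x" "bd (tgt X) p k (ocomp C q k y x) = bd (tgt X) p k y"
    "bd (tgt X) p k y = bd (tgt X) p k x"
proof -
  have q: "q < k" using assms by (simp add: composable_def)
  have t: "bd s p k z = bd s p q (bd s q k z)" for s z using bd_trans[of p q k s z] assms(2) q by simp
  show "bd (src X) p k (ocomp C q k y x) = bd (src X) p k x" "bd (tgt X) p k (ocomp C q k y x) = bd (tgt X) p k y"
    unfolding t using bd_ocomp[OF assms(1)] by simp_all
  have yx: "y \<in> cells X k" "bd (src X) q k y = bd (tgt X) q k x" using assms(1) by (auto simp: composable_def)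
  have "bd (tgt X) p k y = bd (tgt X) p q (bd (src X) q k y)"
    using bd_tgt_src[OF glob yx(1) assms(2)] q by simp
  then show "bd (tgt X) p k y = bd (tgt X) p k x"
    using yx(2) t[of "tgt X" x] by metis
qed

lemma bd_ocomp_low:
  "composable X p k y x \<Longrightarrow> p < q \<Longrightarrow> q \<le> k \<Longrightarrow>
    bd (src X) q k (ocomp C p k y x) = ocomp C p q (bd (src X) q k y) (bd (src X) q k x) \<and>
    bd (tgt X) q k (ocomp C p k y x) = ocomp C p q (bd (tgt X) q k y) (bd (tgt X) q k x)"
proof (induction k arbitrary: y x)
  case (Suc k)
  show ?case
  proof (cases "q = Suc k")
    case False
    then have p: "p < k" "q \<le> k" using Suc by auto
    then show ?thesis using Suc.IH[OF composable_bdry(1)[OF glob Suc.prems(1) p(1)]]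
        Suc.IH[OF composable_bdry(2)[OF glob Suc.prems(1) p(1)]] Suc.prems(2)
        src_comp[OF Suc.prems(1) p(1)] tgt_comp[OF Suc.prems(1) p(1)]
      by simp
  qed simp
qed simp

lemma oids_cell:
  "x \<in> cells X p \<Longrightarrow> p \<le> k \<Longrightarrow> oids (oid C) p k x \<in> cells X k \<and>
    bd (src X) p k (oids (oid C) p k x) = x \<and> bd (tgt X) p k (oids (oid C) p k x) = x"
  by (induction k) (auto simp: le_Suc_eq id_cell src_id tgt_id)

lemma composable_assoc:
  "composable X p k z y \<Longrightarrow> composable X p k y x \<Longrightarrow>
    composable X p k (ocomp C p k z y) x \<and> composable X p k z (ocomp C p k y x)"
  using comp_cell[of p k] bd_ocomp[of p k] by (simp add: composable_def)

lemma composable_oid: "composable X p k y x \<Longrightarrow> composable X p (Suc k) (oid C k y) (oid C k x)"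
  by (auto simp: composable_def id_cell src_id tgt_id)

lemma composable_units:
  assumes "x \<in> cells X k" "p < k"
  shows "composable X p k (oids (oid C) p k (bd (tgt X) p k x)) x"
    "composable X p k x (oids (oid C) p k (bd (src X) p k x))"
  using assms bd_mem[OF glob assms(1), of p] oids_cell[of _ p k] by (auto simp: composable_def)

lemma composable_interchange:
  assumes pq: "p < q" and c: "composable X q k y' y" "composable X q k x' x"
    "composable X p k y x" "composable X p k y' x'"
  shows "composable X p k (ocomp C q k y' y) (ocomp C q k x' x)"
    "composable X q k (ocomp C p k y' x') (ocomp C p k y x)"
proof -
  have qk: "q < k" using c by (simp add: composable_def)
  show "composable X p k (ocomp C q k y' y) (ocomp C q k x' x)"
    using c comp_cell bd_ocomp_high[OF c(1) pq] bd_ocomp_high[OF c(2) pq]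
    by (auto simp: composable_def)
  show "composable X q k (ocomp C p k y' x') (ocomp C p k y x)"
    using c comp_cell bd_ocomp_low[OF c(3) pq] bd_ocomp_low[OF c(4) pq] qk
    by (auto simp: composable_def)
qed

end

lemma functor_oids:
  assumes "strict_omega_functor Z D Y C F" "strict_omega_cat Z D" "c \<in> cells Z p" "p \<le> k"
  shows "F k (oids (oid D) p k c) = oids (oid C) p k (F p c)"
  using assms(4)
proof (induction k)
  case (Suc k)
  show ?case
  proof (cases "p = Suc k")
    case False
    then have "oids (oid D) p k c \<in> cells Z k" using strict_omega_cat.oids_cell[OF assms(2,3), of k] Suc.prems by simp
    then show ?thesis using Suc False assms(1) by (auto simp: strict_omega_functor_def)
  qed simp
qed simp

text \<open>\<open>F\<close> preserves the operations while \<open>h\<close> preserves only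
  boundaries. Since \<open>F\<close> undoes \<open>h\<close>, every composite in \<open>Y\<close> is
  the \<open>F\<close>-image of a composite of lifts, so each axiom of \<open>Z\<close> can be
  pushed down. The intended case is \<open>Z = T Y\<close> with \<open>h\<close> the unit of the
  monad.\<close>

lemma omega_cat_retract:
  assumes D: "strict_omega_cat Z D" and Y: "globular_set Y" and F: "strict_omega_functor Z D Y C F"
    and h: "globular_map Y Z h" and Fh: "\<And>k x. x \<in> cells Y k \<Longrightarrow> F k (h k x) = x"
  shows "strict_omega_cat Y C"
proof -
  interpret D: strict_omega_cat Z D by fact
  have Fm: "globular_map Z Y F" using F by (rule functor_map)
  have hc: "composable Z p k (h k y) (h k x)" if "composable Y p k y x" for p k y x
    using composable_map[OF h Y that] .
  have hm: "h k x \<in> cells Z k" if "x \<in> cells Y k" for k x using h that by (rule globular_map_mem)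
  have Fsrc: "F k (src Z k c) = src Y k (F (Suc k) c)" "F k (tgt Z k c) = tgt Y k (F (Suc k) c)"
    if "c \<in> cells Z (Suc k)" for k c using Fm that by (auto simp: globular_map_def)
  have hsrc: "h k (src Y k c) = src Z k (h (Suc k) c)" "h k (tgt Y k c) = tgt Z k (h (Suc k) c)"
    if "c \<in> cells Y (Suc k)" for k c using h that by (auto simp: globular_map_def)
  have Ysrc: "src Y k x \<in> cells Y k" "tgt Y k x \<in> cells Y k" if "x \<in> cells Y (Suc k)" for k x
    using Y that by (auto simp: globular_set_def)
  have Fc: "F k (ocomp D p k c d) = ocomp C p k (F k c) (F k d)" if "composable Z p k c d" for p k c d
    using F that by (auto simp: strict_omega_functor_def)
  have Fi: "F (Suc k) (oid D k c) = oid C k (F k c)" if "c \<in> cells Z k" for k c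
    using F that by (auto simp: strict_omega_functor_def)
  have cells: "x \<in> cells Y k" "y \<in> cells Y k" if "composable Y p k y x" for p k y x
    using that by (auto simp: composable_def)
  have Cc: "ocomp C p k y x = F k (ocomp D p k (h k y) (h k x))" if "composable Y p k y x" for p k y x
    using Fc[OF hc[OF that]] Fh cells[OF that] by simp
  have Ci: "oid C k x = F (Suc k) (oid D k (h k x))" if "x \<in> cells Y k" for k x
    using Fi[OF hm[OF that]] Fh that by simp
  have hbd: "h p (bd (src Y) p k x) = bd (src Z) p k (h k x)" "h p (bd (tgt Y) p k x) = bd (tgt Z) p k (h k x)"
    "bd (src Y) p k x \<in> cells Y p" "bd (tgt Y) p k x \<in> cells Y p"
    if "x \<in> cells Y k" "p \<le> k" for p k x using globular_map_bd[OF h Y that] bd_mem[OF Y that] by auto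
  show ?thesis
  proof
    show "globular_set Y" by fact
    show "ocomp C p k y x \<in> cells Y k" if "composable Y p k y x" for p k y x
      unfolding Cc[OF that] by (rule globular_map_mem[OF Fm D.comp_cell[OF hc[OF that]]])
    show "oid C k x \<in> cells Y (Suc k)" if "x \<in> cells Y k" for k x
      unfolding Ci[OF that] by (rule globular_map_mem[OF Fm D.id_cell[OF hm[OF that]]])
    show "src Y k (ocomp C k (Suc k) y x) = src Y k x" "tgt Y k (ocomp C k (Suc k) y x) = tgt Y k y"
      if "composable Y k (Suc k) y x" for k y x
      using D.src_comp_top[OF hc[OF that]] D.tgt_comp_top[OF hc[OF that]] cells[OF that] Cc[OF that]
        Fsrc[OF D.comp_cell[OF hc[OF that]], symmetric]
      by (simp_all flip: hsrc add: Fh Ysrc)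
    show "src Y k (ocomp C p (Suc k) y x) = ocomp C p k (src Y k y) (src Y k x)"
      "tgt Y k (ocomp C p (Suc k) y x) = ocomp C p k (tgt Y k y) (tgt Y k x)"
      if "composable Y p (Suc k) y x" "p < k" for p k y x
      using D.src_comp[OF hc[OF that(1)] that(2)] D.tgt_comp[OF hc[OF that(1)] that(2)] cells[OF that(1)] Cc[OF that(1)]
        Fsrc[OF D.comp_cell[OF hc[OF that(1)]], symmetric] composable_bdry[OF D.glob hc[OF that(1)] that(2)]
      by (simp_all add: Fc) (simp_all flip: hsrc add: Fh Ysrc)
    show "src Y k (oid C k x) = x" "tgt Y k (oid C k x) = x" if "x \<in> cells Y k" for k x
      using that Fsrc[OF D.id_cell[OF hm[OF that]], symmetric] hm[OF that] by (simp_all add: Ci D.src_id D.tgt_id Fh)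
    show "ocomp C p k (ocomp C p k z y) x = ocomp C p k z (ocomp C p k y x)"
      if c: "composable Y p k z y" "composable Y p k y x" for p k z y x
    proof -
      \<comment> \<open>\<open>h\<close> is only known to respect boundaries, so the nested
        composite is formed entirely in \<open>Z\<close> from lifted cells and mapped down as a
        whole.\<close>
      note D.composable_assoc[OF hc[OF c(1)] hc[OF c(2)]]
      then show ?thesis
        using Fc[of p k "ocomp D p k (h k z) (h k y)" "h k x"] Fc[of p k "h k z" "ocomp D p k (h k y) (h k x)"]
          D.assoc[OF hc[OF c(1)] hc[OF c(2)]] Cc[OF c(1)] Cc[OF c(2)] cells[OF c(1)] cells[OF c(2)] by (simp add: Fh)
    qed
    \<comment> \<open>The unit on the boundary of the lift \<open>h k x\<close> lies over the unit
      on the boundary of \<open>x\<close>, by \<open>functor_oids\<close> and because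
      \<open>h\<close> commutes with boundaries.\<close>
    show "ocomp C p k (oids (oid C) p k (bd (tgt Y) p k x)) x = x"
      if c: "x \<in> cells Y k" "p < k" for p k x
      using Fc[OF D.composable_units(1)[OF hm[OF c(1)] c(2)]] D.unit_left[OF hm[OF c(1)] c(2)]
        functor_oids[OF F D, of "bd (tgt Z) p k (h k x)" p k] hbd[OF c(1), of p] c hm[OF c(1)] bd_mem[OF D.glob hm[OF c(1)], of p]
      by (simp add: Fh) (metis Fh)
    show "ocomp C p k x (oids (oid C) p k (bd (src Y) p k x)) = x"
      if c: "x \<in> cells Y k" "p < k" for p k x
      using Fc[OF D.composable_units(2)[OF hm[OF c(1)] c(2)]] D.unit_right[OF hm[OF c(1)] c(2)]
        functor_oids[OF F D, of "bd (src Z) p k (h k x)" p k] hbd[OF c(1), of p] c hm[OF c(1)] bd_mem[OF D.glob hm[OF c(1)], of p]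
      by (simp add: Fh) (metis Fh)
    show "ocomp C p k (ocomp C q k y' y) (ocomp C q k x' x) = ocomp C q k (ocomp C p k y' x') (ocomp C p k y x)"
      if pq: "p < q" and c: "composable Y q k y' y" "composable Y q k x' x"
        "composable Y p k y x" "composable Y p k y' x'" for p q k y' y x' x
      using Fc[OF D.composable_interchange(1)[OF pq c[THEN hc]]] Fc[OF D.composable_interchange(2)[OF pq c[THEN hc]]]
        D.interchange[OF pq c[THEN hc]] c[THEN Cc] by simp
    show "ocomp C p (Suc k) (oid C k y) (oid C k x) = oid C k (ocomp C p k y x)"
      if c: "composable Y p k y x" for p k y x
      using Fc[OF D.composable_oid[OF hc[OF c]]] D.id_interchange[OF hc[OF c]] Fi[OF D.comp_cell[OF hc[OF c]]]
        Cc[OF c] Ci cells[OF c] by simp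
  qed
qed

definition T_algebra :: "('a, 'x) gset_scheme \<Rightarrow> (nat \<Rightarrow> 'a otm set \<Rightarrow> 'a) \<Rightarrow> bool" where
  "T_algebra Y \<theta> \<longleftrightarrow> globular_map (T Y) Y \<theta> \<and>
    (\<forall>k. \<forall>x\<in>cells Y k. \<theta> k (T_eta Y k x) = x) \<and>
    (\<forall>k. \<forall>W\<in>cells (T (T Y)) k. \<theta> k (T_map Y \<theta> k W) = \<theta> k (T_mu Y k W))"

text \<open>The operations evaluate formal composites of depth one. They are normalised outside
  their domain as \<open>omega_str_on\<close> demands.\<close>

definition T_algebra_str :: "('a, 'x) gset_scheme \<Rightarrow> (nat \<Rightarrow> 'a otm set \<Rightarrow> 'a) \<Rightarrow> 'a omega_str" where
  "T_algebra_str Y \<theta> = \<lparr>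
     ocomp = (\<lambda>p k y x. if composable Y p k y x
       then \<theta> k (ocomp (T_omega Y) p k (T_eta Y k y) (T_eta Y k x)) else undefined),
     oid = (\<lambda>k x. if x \<in> cells Y k then \<theta> (Suc k) (oid (T_omega Y) k (T_eta Y k x)) else undefined)\<rparr>"

text \<open>The associativity law of \<open>\<theta>\<close>, applied to the formal composite in
  \<open>T (T Y)\<close> of the generators on \<open>c\<close> and \<open>d\<close>: one side
  flattens to the composite of \<open>c\<close> and \<open>d\<close>, the other composes their
  values. Identities are treated in the same way.\<close>

lemma T_algebra_functor:
  assumes Y: "globular_set Y" and \<theta>: "T_algebra Y \<theta>"
  shows "strict_omega_functor (T Y) (T_omega Y) Y (T_algebra_str Y \<theta>) \<theta>"
proof -
  note TY = globular_T[OF Y]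
  have \<theta>m: "globular_map (T Y) Y \<theta>" and
    assoc: "\<And>k W. W \<in> cells (T (T Y)) k \<Longrightarrow> \<theta> k (T_map Y \<theta> k W) = \<theta> k (T_mu Y k W)"
    using \<theta> by (auto simp: T_algebra_def)
  interpret TT: strict_omega_cat "T (T Y)" "T_omega (T Y)" by (rule T_omega_cat[OF TY])
  have m: "T_map Y \<theta> k (T_eta (T Y) k c) = T_eta Y k (\<theta> k c)" "T_mu Y k (T_eta (T Y) k c) = c"
    "T_eta (T Y) k c \<in> cells (T (T Y)) k" "\<theta> k c \<in> cells Y k" if "c \<in> cells (T Y) k" for k c
    using that by (simp_all add: T_map_eta[OF \<theta>m TY] T_mu_eta[OF Y] T_eta_mem globular_map_mem[OF \<theta>m])
  note Tf = T_map_functor[OF \<theta>m TY Y, unfolded strict_omega_functor_def]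
    and mf = T_mu_functor[OF Y, unfolded strict_omega_functor_def]
  show ?thesis
    unfolding strict_omega_functor_def
  proof (intro conjI allI impI ballI)
    show "globular_map (T Y) Y \<theta>" by fact
  next
    fix p k c d assume cd: "composable (T Y) p k c d"
    then have mem: "c \<in> cells (T Y) k" "d \<in> cells (T Y) k" by (auto simp: composable_def)
    have cd2: "composable (T (T Y)) p k (T_eta (T Y) k c) (T_eta (T Y) k d)"
      by (rule composable_map[OF T_eta_glob[OF TY] TY cd])
    have "composable Y p k (\<theta> k c) (\<theta> k d)"
      by (rule composable_map[OF \<theta>m TY cd])
    then show "\<theta> k (ocomp (T_omega Y) p k c d) = ocomp (T_algebra_str Y \<theta>) p k (\<theta> k c) (\<theta> k d)"
      using assoc[OF TT.comp_cell[OF cd2]] cd2 Tf mf by (simp add: T_algebra_str_def m mem)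
  next
    fix k c assume c: "c \<in> cells (T Y) k"
    show "\<theta> (Suc k) (oid (T_omega Y) k c) = oid (T_algebra_str Y \<theta>) k (\<theta> k c)"
      using assoc[OF TT.id_cell[OF m(3)[OF c]]] Tf mf m[OF c] by (simp add: T_algebra_str_def)
  qed
qed

text \<open>The unit law exhibits \<open>Y\<close> as a retract of \<open>T Y\<close>, so
  \<open>omega_cat_retract\<close> applies. Evaluation and \<open>\<theta>\<close> are then two
  functors that agree on generators.\<close>

lemma T_algebra_omega_cat:
  assumes Y: "globular_set Y" and \<theta>: "T_algebra Y \<theta>"
  shows "strict_omega_cat Y (T_algebra_str Y \<theta>)"
    and "c \<in> cells (T Y) k \<Longrightarrow> T_eval (T_algebra_str Y \<theta>) k c = \<theta> k c"
proof -
  note F = T_algebra_functor[OF assms]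
  have e: "\<theta> k (T_eta Y k x) = x" if "x \<in> cells Y k" for k x using \<theta> that by (simp add: T_algebra_def)
  show D: "strict_omega_cat Y (T_algebra_str Y \<theta>)"
    by (rule omega_cat_retract[OF T_omega_cat[OF Y] Y F T_eta_glob[OF Y]]) (rule e)
  show "T_eval (T_algebra_str Y \<theta>) k c = \<theta> k c" if "c \<in> cells (T Y) k"
    by (rule functor_eqI[OF Y strict_omega_cat.T_eval_functor[OF D] F _ that])
      (simp add: e strict_omega_cat.T_eval_eta[OF D])
qed

text \<open>It is enough to test the homomorphism condition on formal composites and identities of
  depth one.\<close>

lemma T_algebra_hom_functor:
  assumes C: "strict_omega_cat X C" and D: "strict_omega_cat Y D" and f: "globular_map X Y f"
    and hom: "\<And>k c. c \<in> cells (T X) k \<Longrightarrow> f k (T_eval C k c) = T_eval D k (T_map Y f k c)"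
  shows "strict_omega_functor X C Y D f"
  unfolding strict_omega_functor_def
proof (intro conjI allI impI ballI)
  interpret C: strict_omega_cat X C by fact
  interpret D: strict_omega_cat Y D by fact
  interpret TX: strict_omega_cat "T X" "T_omega X" by (rule T_omega_cat[OF C.glob])
  note F = T_map_functor[OF f C.glob D.glob, unfolded strict_omega_functor_def]
    and ev = C.T_eval_functor[unfolded strict_omega_functor_def] D.T_eval_functor[unfolded strict_omega_functor_def]
  show "globular_map X Y f" by fact
  note e = T_map_eta[OF f C.glob] T_eta_mem C.T_eval_eta D.T_eval_eta globular_map_mem[OF f]
  {
    fix p k y x assume yx: "composable X p k y x"
    have yx1: "composable (T X) p k (T_eta X k y) (T_eta X k x)"
      by (rule composable_map[OF T_eta_glob[OF C.glob] C.glob yx])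
    have yx2: "composable (T Y) p k (T_eta Y k (f k y)) (T_eta Y k (f k x))"
      by (rule composable_map[OF T_eta_glob[OF D.glob] D.glob composable_map[OF f C.glob yx]])
    have mem: "y \<in> cells X k" "x \<in> cells X k" using yx by (auto simp: composable_def)
    show "f k (ocomp C p k y x) = ocomp D p k (f k y) (f k x)"
      using hom[OF TX.comp_cell[OF yx1]] yx1 yx2 F ev mem by (simp add: e)
  }
  fix k x assume x: "x \<in> cells X k"
  show "f (Suc k) (oid C k x) = oid D k (f k x)"
    using hom[OF TX.id_cell[OF T_eta_mem[OF x]]] F ev x by (simp add: e)
qed

section \<open>Algebras as families of maps \<open>\<T>(A\<^sup>n) \<rightarrow> A\<^sup>m\<close>\<close>

text \<open>Here \<open>take n\<close> and \<open>drop n\<close> are the two projections of \<open>A\<^sup>n\<^sup>+\<^sup>r\<close>.\<close>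

definition monadic_algebra ::
  "'p pro \<Rightarrow> 'a gset \<Rightarrow> (nat \<Rightarrow> nat \<Rightarrow> 'p \<Rightarrow> nat \<Rightarrow> 'a list otm set \<Rightarrow> 'a list) set" where
  "monadic_algebra P A = {\<omega>.
    (\<forall>n m. \<forall>f\<in>phom P n m. \<omega> n m f \<in> ghom (T (gpow A n)) (gpow A m)) \<and>
    (\<forall>n m f. f \<notin> phom P n m \<longrightarrow> \<omega> n m f = undefined) \<and>
    (\<forall>n m r. \<forall>f\<in>phom P n m. \<forall>g\<in>phom P m r. \<forall>k. \<forall>W\<in>cells (T (T (gpow A n))) k.
       \<omega> m r g k (T_map (gpow A m) (\<omega> n m f) k W) = \<omega> n r (pcomp P n m r g f) k (T_mu (gpow A n) k W)) \<and>
    (\<forall>n m r s. \<forall>f\<in>phom P n m. \<forall>g\<in>phom P r s. \<forall>k. \<forall>c\<in>cells (T (gpow A (n + r))) k.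
       \<omega> (n + r) (m + s) (psum P n m r s f g) k c =
       \<omega> n m f k (T_map (gpow A n) (\<lambda>_. take n) k c) @ \<omega> r s g k (T_map (gpow A r) (\<lambda>_. drop n) k c)) \<and>
    (\<forall>n k. \<forall>xs\<in>cells (gpow A n) k. \<omega> n n (pid P n) k (T_eta (gpow A n) k xs) = xs)}"

definition monadic_action ::
  "'p pro \<Rightarrow> 'a gset \<Rightarrow>
   'a omega_str \<times> (nat \<Rightarrow> nat \<Rightarrow> 'p \<Rightarrow> nat \<Rightarrow> 'a list \<Rightarrow> 'a list) \<Rightarrow>
   (nat \<Rightarrow> nat \<Rightarrow> 'p \<Rightarrow> nat \<Rightarrow> 'a list otm set \<Rightarrow> 'a list)" where
  "monadic_action P A = (\<lambda>(C, \<rho>) n m f.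
     if f \<in> phom P n m
     then (\<lambda>k c. if c \<in> cells (T (gpow A n)) k then \<rho> n m f k (T_eval (omega_pow C) k c) else undefined)
     else undefined)"

lemma monadic_action_mem:
  assumes P: "PRO P" and A: "globular_set A" and C\<rho>: "(C, \<rho>) \<in> omega_pro_algebra P A"
  shows "monadic_action P A (C, \<rho>) \<in> monadic_algebra P A"
proof -
  interpret PRO P by fact
  interpret strict_omega_cat A C using C\<rho> by (simp add: omega_pro_algebra_def omega_str_on_def)
  let ?ev = "T_eval (omega_pow C)"
  have G: "globular_set (gpow A n)" "globular_set (T (gpow A n))" "globular_set (T (T (gpow A n)))" for n
    by (simp_all add: globular_gpow A globular_T)
  have pw: "strict_omega_cat (gpow A n) (omega_pow C)" for n
    by (rule omega_pow_cat) unfold_locales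
  note evF = strict_omega_cat.T_eval_functor[OF pw] and ev_eta = strict_omega_cat.T_eval_eta[OF pw]
  have evm: "?ev k c \<in> cells (gpow A n) k" if "c \<in> cells (T (gpow A n)) k" for n k c
    by (rule globular_map_mem[OF functor_map[OF evF] that])
  have \<rho>F: "strict_omega_functor (gpow A n) (omega_pow C) (gpow A m) (omega_pow C) (\<rho> n m f)"
    if "f \<in> phom P n m" for n m f using C\<rho> that by (simp add: omega_pro_algebra_def)
  have \<rho>alg: "\<rho> \<in> pro_algebra P A" using C\<rho> by (simp add: omega_pro_algebra_def)
  define \<omega> where "\<omega> = monadic_action P A (C, \<rho>)"
  have \<omega>: "\<omega> n m f k c = \<rho> n m f k (?ev k c)" if "f \<in> phom P n m" "c \<in> cells (T (gpow A n)) k" for n m f k c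
    using that by (simp add: \<omega>_def monadic_action_def)
  have \<rho>ev: "strict_omega_functor (T (gpow A n)) (T_omega (gpow A n)) (gpow A m) (omega_pow C) (\<lambda>k c. \<rho> n m f k (?ev k c))"
    if "f \<in> phom P n m" for n m f
    by (rule functor_comp[OF G(2) evF \<rho>F[OF that]])
  have \<omega>m: "globular_map (T (gpow A n)) (gpow A m) (\<omega> n m f)" if "f \<in> phom P n m" for n m f
    by (rule globular_map_cong[OF functor_map[OF \<rho>ev[OF that]] G(2)]) (simp add: \<omega> that)
  show ?thesis
    unfolding monadic_algebra_def \<omega>_def[symmetric] mem_Collect_eq
  proof (intro conjI allI ballI impI)
    show "\<omega> n m f \<in> ghom (T (gpow A n)) (gpow A m)" if "f \<in> phom P n m" for n m f
      using \<omega>m[OF that] that by (auto simp: ghom_def \<omega>_def monadic_action_def)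
    show "\<omega> n m f = undefined" if "f \<notin> phom P n m" for n m f
      using that by (simp add: \<omega>_def monadic_action_def)
    show "\<omega> m r g k (T_map (gpow A m) (\<omega> n m f) k W) = \<omega> n r (pcomp P n m r g f) k (T_mu (gpow A n) k W)"
      if f: "f \<in> phom P n m" and g: "g \<in> phom P m r" and W: "W \<in> cells (T (T (gpow A n))) k" for n m r f g k W
    proof -
      \<comment> \<open>The right-hand side is a functor because \<open>\<rho> n m f\<close> is one;
        this is where the functoriality of the operations enters. On the generator on
        \<open>c\<close> both sides give \<open>\<omega> n m f k c\<close>.\<close>
      have "?ev k (T_map (gpow A m) (\<omega> n m f) k W) = \<rho> n m f k (?ev k (T_mu (gpow A n) k W))"
      proof (rule functor_eqI[OF G(2) _ _ _ W])
        show "strict_omega_functor (T (T (gpow A n))) (T_omega (T (gpow A n))) (gpow A m) (omega_pow C)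
           (\<lambda>k W. ?ev k (T_map (gpow A m) (\<omega> n m f) k W))"
          by (rule functor_comp[OF G(3) T_map_functor[OF \<omega>m[OF f] G(2) G(1)] evF])
        show "strict_omega_functor (T (T (gpow A n))) (T_omega (T (gpow A n))) (gpow A m) (omega_pow C)
           (\<lambda>k W. \<rho> n m f k (?ev k (T_mu (gpow A n) k W)))"
          by (rule functor_comp[OF G(3) T_mu_functor[OF G(1)] \<rho>ev[OF f]])
        show "?ev k (T_map (gpow A m) (\<omega> n m f) k (T_eta (T (gpow A n)) k c)) =
            \<rho> n m f k (?ev k (T_mu (gpow A n) k (T_eta (T (gpow A n)) k c)))" if "c \<in> cells (T (gpow A n)) k" for k c
          using that globular_map_mem[OF \<omega>m[OF f] that]
          by (simp add: T_map_eta[OF \<omega>m[OF f] G(2)] ev_eta T_mu_eta G \<omega>[OF f])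
      qed
      moreover have "T_map (gpow A m) (\<omega> n m f) k W \<in> cells (T (gpow A m)) k"
        by (rule T_map_mem[OF \<omega>m[OF f] G(2) G(1) W])
      moreover have "T_mu (gpow A n) k W \<in> cells (T (gpow A n)) k" by (rule T_mu_mem[OF G(1) W])
      ultimately show ?thesis
        using \<rho>alg f g pcomp_hom[OF f g] evm by (simp add: \<omega> pro_algebra_def)
    qed
    show "\<omega> (n + r) (m + s) (psum P n m r s f g) k c =
         \<omega> n m f k (T_map (gpow A n) (\<lambda>_. take n) k c) @ \<omega> r s g k (T_map (gpow A r) (\<lambda>_. drop n) k c)"
      if f: "f \<in> phom P n m" and g: "g \<in> phom P r s" and c: "c \<in> cells (T (gpow A (n + r))) k" for n m r s f g k c
    proof -
      note tk = T_map_functor[OF globular_map_take G(1) G(1), of n r]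
        and dr = T_map_functor[OF globular_map_drop G(1) G(1), of n r]
      \<comment> \<open>Evaluation in a product is componentwise: the paired evaluations form a
        functor that returns each generator's list, cut at position \<open>n\<close> and
        rejoined.\<close>
      have "?ev k c = ?ev k (T_map (gpow A n) (\<lambda>_. take n) k c) @ ?ev k (T_map (gpow A r) (\<lambda>_. drop n) k c)"
      proof (rule functor_eqI[OF G(1) evF _ _ c])
        show "strict_omega_functor (T (gpow A (n + r))) (T_omega (gpow A (n + r))) (gpow A (n + r)) (omega_pow C)
           (\<lambda>k c. ?ev k (T_map (gpow A n) (\<lambda>_. take n) k c) @ ?ev k (T_map (gpow A r) (\<lambda>_. drop n) k c))"
          by (rule functor_append[OF functor_comp[OF G(2) tk evF] functor_comp[OF G(2) dr evF]])
        show "?ev k (T_eta (gpow A (n + r)) k x) =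
           ?ev k (T_map (gpow A n) (\<lambda>_. take n) k (T_eta (gpow A (n + r)) k x)) @
           ?ev k (T_map (gpow A r) (\<lambda>_. drop n) k (T_eta (gpow A (n + r)) k x))"
          if "x \<in> cells (gpow A (n + r)) k" for k x
          using that globular_map_mem[OF globular_map_take that] globular_map_mem[OF globular_map_drop that]
          by (simp add: T_map_eta[OF globular_map_take] T_map_eta[OF globular_map_drop] G ev_eta)
      qed
      moreover have "T_map (gpow A n) (\<lambda>_. take n) k c \<in> cells (T (gpow A n)) k"
        "T_map (gpow A r) (\<lambda>_. drop n) k c \<in> cells (T (gpow A r)) k"
        using globular_map_mem[OF functor_map[OF tk] c] globular_map_mem[OF functor_map[OF dr] c] by auto
      ultimately show ?thesis
        using \<rho>alg f g c psum_hom[OF f g] evm by (simp add: \<omega> pro_algebra_def)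
    qed
    show "\<omega> n n (pid P n) k (T_eta (gpow A n) k xs) = xs" if "xs \<in> cells (gpow A n) k" for n k xs
      using that \<rho>alg by (simp add: \<omega> pid_hom T_eta_mem ev_eta pro_algebra_def)
  qed
qed

text \<open>Generators evaluate to themselves, which returns \<open>\<rho>\<close>. The identity of
  \<open>1\<close> acts by evaluation in \<open>A^1\<close>, so its values on depth-one composites
  of one-element lists return the operations of \<open>C\<close>, with \<open>hd\<close> undoing the
  passage from \<open>A\<close> to \<open>A^1\<close>.\<close>

lemma monadic_action_recover:
  assumes P: "PRO P" and A: "globular_set A" and C\<rho>: "(C, \<rho>) \<in> omega_pro_algebra P A"
  defines "\<omega> \<equiv> monadic_action P A (C, \<rho>)"
  shows "f \<in> phom P n m \<Longrightarrow> xs \<in> cells (gpow A n) k \<Longrightarrow> \<rho> n m f k xs = \<omega> n m f k (T_eta (gpow A n) k xs)"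
    and "composable A p k y x \<Longrightarrow> ocomp C p k y x =
      hd (\<omega> 1 1 (pid P 1) k (ocomp (T_omega (gpow A 1)) p k (T_eta (gpow A 1) k [y]) (T_eta (gpow A 1) k [x])))"
    and "x \<in> cells A k \<Longrightarrow> oid C k x =
      hd (\<omega> 1 1 (pid P 1) (Suc k) (oid (T_omega (gpow A 1)) k (T_eta (gpow A 1) k [x])))"
proof -
  interpret PRO P by fact
  interpret strict_omega_cat A C using C\<rho> by (simp add: omega_pro_algebra_def omega_str_on_def)
  let ?ev = "T_eval (omega_pow C)"
  have G: "globular_set (gpow A n)" for n by (simp add: globular_gpow A)
  have pw: "strict_omega_cat (gpow A n) (omega_pow C)" for n
    by (rule omega_pow_cat) unfold_locales
  note evF = strict_omega_cat.T_eval_functor[OF pw] and ev_eta = strict_omega_cat.T_eval_eta[OF pw]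
  have evm: "?ev k c \<in> cells (gpow A n) k" if "c \<in> cells (T (gpow A n)) k" for n k c
    by (rule globular_map_mem[OF functor_map[OF evF] that])
  have \<rho>alg: "\<rho> \<in> pro_algebra P A" using C\<rho> by (simp add: omega_pro_algebra_def)
  show "\<rho> n m f k xs = \<omega> n m f k (T_eta (gpow A n) k xs)" if "f \<in> phom P n m" "xs \<in> cells (gpow A n) k"
    using that by (simp add: \<omega>_def monadic_action_def T_eta_mem ev_eta)
  have id: "\<omega> 1 1 (pid P 1) k c = ?ev k c" if "c \<in> cells (T (gpow A 1)) k" for k c
    using that \<rho>alg pid_hom[of 1] evm[OF that] by (simp add: \<omega>_def monadic_action_def pro_algebra_def)
  interpret T1: strict_omega_cat "T (gpow A 1)" "T_omega (gpow A 1)" by (rule T_omega_cat[OF G])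
  have sg: "globular_map A (gpow A 1) (\<lambda>_ x. [x])" unfolding One_nat_def by (rule functor_map[OF functor_singleton])
  have sm: "[x] \<in> cells (gpow A 1) k" if "x \<in> cells A k" for x k using that by (simp add: cells_gpow)
  show "ocomp C p k y x =
      hd (\<omega> 1 1 (pid P 1) k (ocomp (T_omega (gpow A 1)) p k (T_eta (gpow A 1) k [y]) (T_eta (gpow A 1) k [x])))"
    if yx: "composable A p k y x"
  proof -
    have c: "composable (T (gpow A 1)) p k (T_eta (gpow A 1) k [y]) (T_eta (gpow A 1) k [x])"
      by (rule composable_map[OF T_eta_glob[OF G] G composable_map[OF sg A yx]])
    have "y \<in> cells A k" "x \<in> cells A k" using yx by (auto simp: composable_def)
    then show ?thesis using id[OF T1.comp_cell[OF c]] c evF[of 1] ev_eta[OF sm]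
      by (simp add: strict_omega_functor_def ocomp_omega_pow)
  qed
  show "oid C k x = hd (\<omega> 1 1 (pid P 1) (Suc k) (oid (T_omega (gpow A 1)) k (T_eta (gpow A 1) k [x])))"
    if x: "x \<in> cells A k"
    using id[OF T1.id_cell[OF T_eta_mem[OF sm[OF x]]]] evF[of 1] ev_eta[OF sm[OF x]] T_eta_mem[OF sm[OF x]]
    by (simp add: strict_omega_functor_def oid_omega_pow)
qed

lemma monadic_action_inj:
  assumes P: "PRO P" and A: "globular_set A"
  shows "inj_on (monadic_action P A) (omega_pro_algebra P A)"
proof (rule inj_onI, clarify)
  fix C \<rho> C' \<rho>' assume 1: "(C, \<rho>) \<in> omega_pro_algebra P A" and 2: "(C', \<rho>') \<in> omega_pro_algebra P A"
    and eq: "monadic_action P A (C, \<rho>) = monadic_action P A (C', \<rho>')"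
  have "ocomp C p k y x = ocomp C' p k y x" for p k y x
  proof (cases "composable A p k y x")
    case True
    then show ?thesis using monadic_action_recover(2)[OF P A 1] monadic_action_recover(2)[OF P A 2] eq by simp
  next
    case False
    then show ?thesis using 1 2 by (simp add: omega_pro_algebra_def omega_str_on_def)
  qed
  moreover have "oid C k x = oid C' k x" for k x
  proof (cases "x \<in> cells A k")
    case True
    then show ?thesis using monadic_action_recover(3)[OF P A 1] monadic_action_recover(3)[OF P A 2] eq by simp
  next
    case False
    then show ?thesis using 1 2 by (simp add: omega_pro_algebra_def omega_str_on_def)
  qed
  moreover have "\<rho> n m f = \<rho>' n m f" for n m f
  proof (cases "f \<in> phom P n m")
    case f: True
    have "\<rho> n m f k xs = \<rho>' n m f k xs" for k xs
    proof (cases "xs \<in> cells (gpow A n) k")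
      case True
      then show ?thesis
        using monadic_action_recover(1)[OF P A 1 f] monadic_action_recover(1)[OF P A 2 f] eq by simp
    next
      case False
      then show ?thesis using 1 2 f by (simp add: omega_pro_algebra_def pro_algebra_def ghom_def)
    qed
    then show ?thesis by blast
  next
    case False
    then show ?thesis using 1 2 by (simp add: omega_pro_algebra_def pro_algebra_def)
  qed
  ultimately show "C = C' \<and> \<rho> = \<rho>'" by (intro conjI omega_str.equality ext) simp_all
qed

lemma monadic_action_surj:
  fixes A :: "'b gset"
  assumes P: "PRO P" and A: "globular_set A" and \<omega>: "\<omega> \<in> monadic_algebra P A"
  shows "\<exists>C \<rho>. (C, \<rho>) \<in> omega_pro_algebra P A \<and> monadic_action P A (C, \<rho>) = \<omega>"
proof -
  \<comment> \<open>Keeps \<open>gpow A 1\<close> in the form in which the facts below are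
    stated.\<close>
  note One_nat_def [simp del]
  interpret PRO P by fact
  have G: "globular_set (gpow A n)" "globular_set (T (gpow A n))" "globular_set (T (T (gpow A n)))" for n
    by (simp_all add: globular_gpow A globular_T)
  have \<omega>m: "globular_map (T (gpow A n)) (gpow A m) (\<omega> n m f)" if "f \<in> phom P n m" for n m f
    using \<omega> that by (simp add: monadic_algebra_def ghom_def)
  have \<omega>comp: "\<omega> m r g k (T_map (gpow A m) (\<omega> n m f) k W) = \<omega> n r (pcomp P n m r g f) k (T_mu (gpow A n) k W)"
    if "f \<in> phom P n m" "g \<in> phom P m r" "W \<in> cells (T (T (gpow A n))) k" for n m r f g k W
    using \<omega> that by (simp add: monadic_algebra_def)
  have \<omega>sum: "\<omega> (n + r) (m + s) (psum P n m r s f g) k c =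
       \<omega> n m f k (T_map (gpow A n) (\<lambda>_. take n) k c) @ \<omega> r s g k (T_map (gpow A r) (\<lambda>_. drop n) k c)"
    if "f \<in> phom P n m" "g \<in> phom P r s" "c \<in> cells (T (gpow A (n + r))) k" for n m r s f g k c
    using \<omega> that by (simp add: monadic_algebra_def)
  have \<omega>id: "\<omega> n n (pid P n) k (T_eta (gpow A n) k xs) = xs" if "xs \<in> cells (gpow A n) k" for n k xs
    using \<omega> that by (simp add: monadic_algebra_def)
  define \<theta> where "\<theta> n = \<omega> n n (pid P n)" for n
  have \<theta>m: "globular_map (T (gpow A n)) (gpow A n) (\<theta> n)" for n
    unfolding \<theta>_def by (rule \<omega>m[OF pid_hom])
  have \<theta>eta: "\<theta> n k (T_eta (gpow A n) k xs) = xs" if "xs \<in> cells (gpow A n) k" for n k xs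
    unfolding \<theta>_def by (rule \<omega>id[OF that])
  have \<theta>mu: "\<theta> n k (T_map (gpow A n) (\<theta> n) k W) = \<theta> n k (T_mu (gpow A n) k W)"
    if "W \<in> cells (T (T (gpow A n))) k" for n k W
    using \<omega>comp[OF pid_hom pid_hom that] by (simp add: \<theta>_def pid_left[OF pid_hom])
  have s: "globular_map A (gpow A 1) (\<lambda>_ x. [x])" unfolding One_nat_def by (rule functor_map[OF functor_singleton])
  have hdm: "globular_map (gpow A (Suc n)) A (\<lambda>_. hd)" for n
  proof -
    have "hd (map f xs) = f (hd xs)" "hd xs \<in> cells A k" if "xs \<in> cells (gpow A (Suc n)) k" for f :: "'b \<Rightarrow> 'b" and xs k
      using that by (cases xs; auto simp: cells_gpow)+
    then show ?thesis by (simp add: globular_map_def src_gpow tgt_gpow)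
  qed
  have hd1: "[hd xs] = xs" if "xs \<in> cells (gpow A 1) k" for xs k
    using that by (cases xs) (auto simp: cells_gpow)
  note Ts = T_map_functor[OF s A G(1)]
  \<comment> \<open>The algebra structure \<open>\<theta> 1\<close> transported along the
    isomorphism of \<open>A\<close> with lists of length one.\<close>
  define \<tau> where "\<tau> k c = hd (\<theta> 1 k (T_map (gpow A 1) (\<lambda>_ x. [x]) k c))" for k c
  have \<tau>1: "[\<tau> k c] = \<theta> 1 k (T_map (gpow A 1) (\<lambda>_ x. [x]) k c)" if "c \<in> cells (T A) k" for k c
    unfolding \<tau>_def by (rule hd1[OF globular_map_mem[OF \<theta>m T_map_mem[OF s A G(1) that]]])
  have \<tau>m: "globular_map (T A) A \<tau>"
    using globular_map_comp[OF globular_map_comp[OF functor_map[OF Ts] \<theta>m] hdm[of 0, folded One_nat_def]]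
    by (simp add: \<tau>_def[abs_def])
  have \<tau>: "T_algebra A \<tau>"
    unfolding T_algebra_def
  proof (intro conjI allI ballI)
    show "globular_map (T A) A \<tau>" by fact
    show "\<tau> k (T_eta A k x) = x" if "x \<in> cells A k" for k x
      unfolding \<tau>_def T_map_eta[OF s A that] \<theta>eta[OF globular_map_mem[OF s that]] by simp
    fix k W assume W: "W \<in> cells (T (T A)) k"
    have "T_map (gpow A 1) (\<lambda>_ x. [x]) k (T_map A \<tau> k W) = T_map (gpow A 1) (\<lambda>k c. [\<tau> k c]) k W"
      by (rule T_map_comp[OF \<tau>m s globular_T[OF A] A G(1) W])
    also have "\<dots> = T_map (gpow A 1) (\<lambda>k c. \<theta> 1 k (T_map (gpow A 1) (\<lambda>_ x. [x]) k c)) k W"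
      by (rule T_map_cong[OF globular_map_comp[OF \<tau>m s] globular_T[OF A] G(1) W]) (rule \<tau>1)
    also have "\<dots> = T_map (gpow A 1) (\<theta> 1) k (T_map (T (gpow A 1)) (T_map (gpow A 1) (\<lambda>_ x. [x])) k W)"
      by (rule T_map_comp[OF functor_map[OF Ts] \<theta>m globular_T[OF A] G(2) G(1) W, symmetric])
    finally have "\<theta> 1 k (T_map (gpow A 1) (\<lambda>_ x. [x]) k (T_map A \<tau> k W)) =
       \<theta> 1 k (T_mu (gpow A 1) k (T_map (T (gpow A 1)) (T_map (gpow A 1) (\<lambda>_ x. [x])) k W))"
      using \<theta>mu[OF T_map_mem[OF functor_map[OF Ts] globular_T[OF A] G(2) W]] by simp
    also have "\<dots> = \<theta> 1 k (T_map (gpow A 1) (\<lambda>_ x. [x]) k (T_mu A k W))"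
      by (simp add: T_map_mu[OF s A G(1) W])
    finally show "\<tau> k (T_map A \<tau> k W) = \<tau> k (T_mu A k W)" by (simp add: \<tau>_def)
  qed
  define C where "C = T_algebra_str A \<tau>"
  interpret C: strict_omega_cat A C
    unfolding C_def by (rule T_algebra_omega_cat(1)[OF A \<tau>])
  have ev\<tau>: "T_eval C k c = \<tau> k c" if "c \<in> cells (T A) k" for k c
    unfolding C_def by (rule T_algebra_omega_cat(2)[OF A \<tau> that])
  let ?ev = "T_eval (omega_pow C)"
  have pw: "strict_omega_cat (gpow A n) (omega_pow C)" for n
    by (rule omega_pow_cat) unfold_locales
  note evF = strict_omega_cat.T_eval_functor[OF pw] and ev_eta = strict_omega_cat.T_eval_eta[OF pw]
  \<comment> \<open>The structure on \<open>A^n\<close> must be the product structure. The sum law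
    for the identities of \<open>1\<close> and \<open>n\<close> splits off the first coordinate;
    \<open>A^0\<close> has only the empty list as a cell in each dimension.\<close>
  have \<theta>ev: "c \<in> cells (T (gpow A n)) k \<Longrightarrow> \<theta> n k c = ?ev k c" for n k c
  proof (induction n arbitrary: k c)
    case 0
    then show ?case using globular_map_mem[OF \<theta>m 0] globular_map_mem[OF functor_map[OF evF] 0]
      by (simp add: cells_gpow)
  next
    case (Suc n)
    note dr = globular_map_drop[of A 1 n, unfolded plus_1_eq_Suc]
    note hdn = hdm[of n] and c = Suc.prems
    have "?ev k c = [T_eval C k (T_map A (\<lambda>_. hd) k c)] @ ?ev k (T_map (gpow A n) (\<lambda>_. drop 1) k c)"
    proof (rule functor_eqI[OF G(1) evF _ _ c])
      have "strict_omega_functor (T (gpow A (Suc n))) (T_omega (gpow A (Suc n))) (gpow A (Suc 0)) (omega_pow C)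
         (\<lambda>k c. [T_eval C k (T_map A (\<lambda>_. hd) k c)])"
        by (rule functor_comp[OF G(2) functor_comp[OF G(2) T_map_functor[OF hdn G(1) A] C.T_eval_functor] functor_singleton])
      from functor_append[OF this functor_comp[OF G(2) T_map_functor[OF dr G(1) G(1)] evF]]
      show "strict_omega_functor (T (gpow A (Suc n))) (T_omega (gpow A (Suc n))) (gpow A (Suc n)) (omega_pow C)
         (\<lambda>k c. [T_eval C k (T_map A (\<lambda>_. hd) k c)] @ ?ev k (T_map (gpow A n) (\<lambda>_. drop 1) k c))"
        by simp
      show "?ev k (T_eta (gpow A (Suc n)) k x) =
         [T_eval C k (T_map A (\<lambda>_. hd) k (T_eta (gpow A (Suc n)) k x))] @
         ?ev k (T_map (gpow A n) (\<lambda>_. drop 1) k (T_eta (gpow A (Suc n)) k x))"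
        if "x \<in> cells (gpow A (Suc n)) k" for k x
        using that globular_map_mem[OF hdn that] globular_map_mem[OF dr that]
        by (cases x) (simp_all add: T_map_eta[OF hdn] T_map_eta[OF dr] G ev_eta C.T_eval_eta cells_gpow drop_Cons')
    qed
    moreover have "[T_eval C k (T_map A (\<lambda>_. hd) k c)] = \<theta> 1 k (T_map (gpow A 1) (\<lambda>_. take 1) k c)"
    proof -
      note hc = T_map_mem[OF hdn G(1) A c]
      have "[T_eval C k (T_map A (\<lambda>_. hd) k c)] = \<theta> 1 k (T_map (gpow A 1) (\<lambda>_ x. [x]) k (T_map A (\<lambda>_. hd) k c))"
        using ev\<tau>[OF hc] \<tau>1[OF hc] by simp
      also have "T_map (gpow A 1) (\<lambda>_ x. [x]) k (T_map A (\<lambda>_. hd) k c) = T_map (gpow A 1) (\<lambda>_ x. [hd x]) k c"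
        by (rule T_map_comp[OF hdn s G(1) A G(1) c])
      also have "\<dots> = T_map (gpow A 1) (\<lambda>_. take 1) k c"
      proof (rule T_map_cong[OF globular_map_comp[OF hdn s] G(1) G(1) c])
        show "[hd x] = take 1 x" if "x \<in> cells (gpow A (Suc n)) k" for k x
          using that by (cases x) (auto simp: cells_gpow take_Cons')
      qed
      finally show ?thesis .
    qed
    moreover have "\<theta> n k (T_map (gpow A n) (\<lambda>_. drop 1) k c) = ?ev k (T_map (gpow A n) (\<lambda>_. drop 1) k c)"
      using Suc.IH[OF T_map_mem[OF dr G(1) G(1) c]] by simp
    moreover have "\<theta> (Suc n) k c = \<theta> 1 k (T_map (gpow A 1) (\<lambda>_. take 1) k c) @ \<theta> n k (T_map (gpow A n) (\<lambda>_. drop 1) k c)"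
      using \<omega>sum[OF pid_hom[of 1] pid_hom[of n], of c k] c psum_pid[of 1 n] by (simp add: \<theta>_def plus_1_eq_Suc)
    ultimately show ?case by simp
  qed
  define \<rho> where "\<rho> n m f = (if f \<in> phom P n m then (\<lambda>k xs. if xs \<in> cells (gpow A n) k
      then \<omega> n m f k (T_eta (gpow A n) k xs) else undefined) else undefined)" for n m f
  have \<rho>: "\<rho> n m f k xs = \<omega> n m f k (T_eta (gpow A n) k xs)" if "f \<in> phom P n m" "xs \<in> cells (gpow A n) k" for n m f k xs
    using that by (simp add: \<rho>_def)
  have \<omega>etam: "globular_map (gpow A n) (gpow A m) (\<lambda>k xs. \<omega> n m f k (T_eta (gpow A n) k xs))" if "f \<in> phom P n m" for n m f
    by (rule globular_map_comp[OF T_eta_glob[OF G(1)] \<omega>m[OF that]])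
  have \<rho>m: "globular_map (gpow A n) (gpow A m) (\<rho> n m f)" if "f \<in> phom P n m" for n m f
    by (rule globular_map_cong[OF \<omega>etam[OF that] G(1)]) (simp add: \<rho> that)
  \<comment> \<open>Associativity for \<open>f\<close> after the identity of \<open>n\<close>, at
    the generator on \<open>c\<close>: flattening it returns \<open>c\<close>, while mapping
    \<open>\<theta> n\<close> over it gives the generator on the value of \<open>c\<close>.\<close>
  have \<omega>\<rho>: "\<omega> n m f k c = \<rho> n m f k (?ev k c)" if f: "f \<in> phom P n m" and c: "c \<in> cells (T (gpow A n)) k" for n m f k c
  proof -
    have "\<omega> n m f k c = \<omega> n m f k (T_map (gpow A n) (\<theta> n) k (T_eta (T (gpow A n)) k c))"
      using \<omega>comp[OF pid_hom f T_eta_mem[OF c]] by (simp add: pid_right[OF f] T_mu_eta G c \<theta>_def)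
    also have "\<dots> = \<rho> n m f k (\<theta> n k c)"
      using c globular_map_mem[OF \<theta>m c] by (simp add: T_map_eta[OF \<theta>m G(2)] \<rho> f)
    finally show ?thesis by (simp add: \<theta>ev[OF c])
  qed
  \<comment> \<open>Associativity for the identity of \<open>m\<close> after \<open>f\<close>, at
    the diagram obtained from \<open>c\<close> by replacing each cell with the generator on it;
    flattening undoes this replacement.\<close>
  have \<rho>hom: "\<rho> n m f k (?ev k c) = ?ev k (T_map (gpow A m) (\<rho> n m f) k c)"
    if f: "f \<in> phom P n m" and c: "c \<in> cells (T (gpow A n)) k" for n m f k c
  proof -
    let ?W = "T_map (T (gpow A n)) (T_eta (gpow A n)) k c"
    have W: "?W \<in> cells (T (T (gpow A n))) k" by (rule T_map_mem[OF T_eta_glob[OF G(1)] G(1) G(2) c])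
    have "T_map (gpow A m) (\<omega> n m f) k ?W = T_map (gpow A m) (\<lambda>k xs. \<omega> n m f k (T_eta (gpow A n) k xs)) k c"
      by (rule T_map_comp[OF T_eta_glob[OF G(1)] \<omega>m[OF f] G(1) G(2) G(1) c])
    also have "\<dots> = T_map (gpow A m) (\<rho> n m f) k c"
      by (rule T_map_cong[OF \<omega>etam[OF f] G(1) G(1) c]) (simp add: \<rho> f)
    finally have "\<theta> m k (T_map (gpow A m) (\<rho> n m f) k c) = \<omega> n m f k c"
      using \<omega>comp[OF f pid_hom W] by (simp add: pid_left[OF f] T_mu_map_eta[OF G(1) c] \<theta>_def)
    then show ?thesis using \<omega>\<rho>[OF f c] \<theta>ev[OF T_map_mem[OF \<rho>m[OF f] G(1) G(1) c]] by simp
  qed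
  have \<rho>F: "strict_omega_functor (gpow A n) (omega_pow C) (gpow A m) (omega_pow C) (\<rho> n m f)" if "f \<in> phom P n m" for n m f
    by (rule T_algebra_hom_functor[OF pw pw \<rho>m[OF that] \<rho>hom[OF that]])
  have "\<rho> \<in> pro_algebra P A"
    unfolding pro_algebra_def mem_Collect_eq
  proof (intro conjI allI ballI impI)
    show "\<rho> n m f \<in> ghom (gpow A n) (gpow A m)" if "f \<in> phom P n m" for n m f
      using \<rho>m[OF that] that by (simp add: ghom_def \<rho>_def)
    show "\<rho> n m f = undefined" if "f \<notin> phom P n m" for n m f using that by (simp add: \<rho>_def)
    show "\<rho> n n (pid P n) k xs = xs" if "xs \<in> cells (gpow A n) k" for n k xs
      using that by (simp add: \<rho> pid_hom \<omega>id)
    \<comment> \<open>Associativity at the doubly nested generator on \<open>xs\<close>.\<close>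
    show "\<rho> n p (pcomp P n m p g f) k xs = \<rho> m p g k (\<rho> n m f k xs)"
      if f: "f \<in> phom P n m" and g: "g \<in> phom P m p" and xs: "xs \<in> cells (gpow A n) k" for n m p f g k xs
      using \<omega>comp[OF f g T_eta_mem[OF T_eta_mem[OF xs]]] xs T_eta_mem[OF xs] globular_map_mem[OF \<omega>m[OF f] T_eta_mem[OF xs]]
      by (simp add: \<rho> f g pcomp_hom[OF f g] T_map_eta[OF \<omega>m[OF f] G(2)] T_mu_eta G)
    show "\<rho> (n + r) (m + s) (psum P n m r s f g) k (xs @ ys) = \<rho> n m f k xs @ \<rho> r s g k ys"
      if f: "f \<in> phom P n m" and g: "g \<in> phom P r s" and xs: "xs \<in> cells (gpow A n) k" and ys: "ys \<in> cells (gpow A r) k"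
      for n m r s f g k xs ys
    proof -
      have xy: "xs @ ys \<in> cells (gpow A (n + r)) k" and l: "length xs = n" using xs ys by (auto simp: cells_gpow)
      show ?thesis using \<omega>sum[OF f g T_eta_mem[OF xy]] xy l
        by (simp add: \<rho> f g xs ys psum_hom[OF f g] T_map_eta[OF globular_map_take G(1)] T_map_eta[OF globular_map_drop G(1)])
    qed
  qed
  moreover have "C \<in> omega_str_on A"
    using C.strict_omega_cat_axioms by (simp add: omega_str_on_def C_def T_algebra_str_def)
  ultimately have "(C, \<rho>) \<in> omega_pro_algebra P A"
    using \<rho>F by (simp add: omega_pro_algebra_def)
  moreover have "monadic_action P A (C, \<rho>) = \<omega>"
  proof (intro ext)
    fix n m f k c
    show "monadic_action P A (C, \<rho>) n m f k c = \<omega> n m f k c"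
      using \<omega> \<omega>\<rho>[of f n m c k] by (simp add: monadic_action_def monadic_algebra_def ghom_def)
  qed
  ultimately show ?thesis by blast
qed

theorem monadic_action_bij:
  assumes "PRO P" "globular_set A"
  shows "bij_betw (monadic_action P A) (omega_pro_algebra P A) (monadic_algebra P A)"
  unfolding bij_betw_def
proof
  show "inj_on (monadic_action P A) (omega_pro_algebra P A)" by (rule monadic_action_inj[OF assms])
  show "monadic_action P A ` omega_pro_algebra P A = monadic_algebra P A"
  proof
    show "monadic_action P A ` omega_pro_algebra P A \<subseteq> monadic_algebra P A"
      using monadic_action_mem[OF assms] by auto
    show "monadic_algebra P A \<subseteq> monadic_action P A ` omega_pro_algebra P A"
      using monadic_action_surj[OF assms] by (metis image_eqI subsetI)
  qed
qed

section \<open>Connectedness, shapes and copowers\<close>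

text \<open>A labelling of the cells of \<open>Y\<close> that is constant along boundaries is a map to \<open>gdisc S\<close>. It extends
  to all of \<open>\<T>(Y)\<close> because \<open>gdisc S\<close> carries an omega-category structure, in which only equal cells
  are composable.\<close>

definition gdisc :: "'s set \<Rightarrow> 's gset" where
  "gdisc S = \<lparr>cells = (\<lambda>k. S), src = (\<lambda>k x. x), tgt = (\<lambda>k x. x)\<rparr>"

definition disc_str :: "'s omega_str" where
  "disc_str = \<lparr>ocomp = (\<lambda>p k y x. x), oid = (\<lambda>k x. x)\<rparr>"

lemma bd_trivial: "bd (\<lambda>k x. x) p k x = x"
  by (induction k) auto

lemma oids_trivial: "oids (\<lambda>k x. x) p k x = x"
  by (induction k) auto

lemma composable_gdisc: "composable (gdisc S) p k y x \<longleftrightarrow> p < k \<and> x \<in> S \<and> y = x"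
  by (auto simp: composable_def gdisc_def bd_trivial)

lemma gdisc_omega_cat: "strict_omega_cat (gdisc S) disc_str"
  by unfold_locales
    (auto simp: composable_gdisc, auto simp: disc_str_def gdisc_def globular_set_def oids_trivial bd_trivial)

definition T_label :: "'s set \<Rightarrow> (nat \<Rightarrow> 'a \<Rightarrow> 's) \<Rightarrow> nat \<Rightarrow> 'a otm set \<Rightarrow> 's" where
  "T_label S lab k c = T_eval disc_str k (T_map (gdisc S) lab k c)"

lemma T_label_functor:
  assumes "globular_set Y" "globular_map Y (gdisc S) lab"
  shows "strict_omega_functor (T Y) (T_omega Y) (gdisc S) disc_str (T_label S lab)"
proof -
  interpret D: strict_omega_cat "gdisc S" disc_str by (rule gdisc_omega_cat)
  show ?thesis
    unfolding T_label_def[abs_def]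
    by (rule functor_comp[OF globular_T[OF assms(1)] T_map_functor[OF assms(2,1) D.glob] D.T_eval_functor])
qed

lemma T_label_eta:
  assumes "globular_set Y" "globular_map Y (gdisc S) lab" "x \<in> cells Y k"
  shows "T_label S lab k (T_eta Y k x) = lab k x"
  using strict_omega_cat.T_eval_eta[OF gdisc_omega_cat globular_map_mem[OF assms(2,3)]]
  by (simp add: T_label_def T_map_eta[OF assms(2,1,3)])

lemma T_label_mem:
  assumes "globular_set Y" "globular_map Y (gdisc S) lab" "c \<in> cells (T Y) k"
  shows "T_label S lab k c \<in> S"
  using globular_map_mem[OF functor_map[OF T_label_functor[OF assms(1,2)]] assms(3)] by (simp add: gdisc_def)

text \<open>Composable cells carry equal labels, so all generators in a cell of \<open>T Y\<close>
  share its label. A map that fixes every generator with this label therefore fixes the whole cell,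
  even if it moves generators with other labels.\<close>

lemma T_connected:
  assumes Y: "globular_set Y" and lab: "globular_map Y (gdisc S) lab"
    and h: "\<And>l. l \<in> S \<Longrightarrow> globular_map Y Y (h l)"
    and hlab: "\<And>k x. x \<in> cells Y k \<Longrightarrow> h (lab k x) k x = x"
    and c: "c \<in> cells (T Y) k"
  shows "T_map Y (h (T_label S lab k c)) k c = c"
  using Y c
proof (induction rule: T_induct)
  note L = T_label_functor[OF Y lab, unfolded strict_omega_functor_def]
  note hF = T_map_functor[OF h Y Y, unfolded strict_omega_functor_def]
  {
    case (eta k x)
    have "lab k x \<in> S" using globular_map_mem[OF lab eta] by (simp add: gdisc_def)
    then show ?case using eta by (simp add: T_label_eta[OF Y lab] T_map_eta[OF h Y] hlab)
  next
    case (oid k c)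
    then show ?case using L hF[OF T_label_mem[OF Y lab oid(1)]] by (simp add: disc_str_def)
  next
    case (ocomp p k c d)
    have cd: "c \<in> cells (T Y) k" "d \<in> cells (T Y) k" using ocomp(1) by (auto simp: composable_def)
    have "composable (gdisc S) p k (T_label S lab k c) (T_label S lab k d)"
      by (rule composable_map[OF functor_map[OF T_label_functor[OF Y lab]] globular_T[OF Y] ocomp(1)])
    then have e: "T_label S lab k c = T_label S lab k d" by (simp add: composable_gdisc)
    have "T_label S lab k (ocomp (T_omega Y) p k c d) = T_label S lab k d"
      using L ocomp(1) by (simp add: disc_str_def)
    then show ?case using ocomp e hF[OF T_label_mem[OF Y lab cd(2)]] by simp
  }
qed

lemma functor_const:
  assumes "l \<in> S"
  shows "strict_omega_functor X C (gdisc S) disc_str (\<lambda>k x. l)"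
  using assms by (simp add: strict_omega_functor_def globular_map_def gdisc_def disc_str_def)

section \<open>Shapes of pasting diagrams and the identity arities\<close>

lemma globular_gone: "globular_set gone"
  by (simp add: globular_set_def gone_def)

lemma globular_map_bang: "globular_map X gone bang"
  by (simp add: globular_map_def gone_def)

abbreviation shape :: "nat \<Rightarrow> 'a otm set \<Rightarrow> arity" where
  "shape \<equiv> T_map gone bang"

lemma bang_comp: "(\<lambda>k x. bang k (f k x)) = bang"
  by (simp add: bang_def fun_eq_iff)

lemma shape_T_map:
  assumes "globular_map X Y f" "globular_set X" "globular_set Y" "w \<in> cells (T X) k"
  shows "shape k (T_map Y f k w) = shape k w"
  using T_map_comp[OF assms(1) globular_map_bang assms(2,3) globular_gone assms(4)] unfolding bang_comp[of f] .

lemma shape_mem: "globular_set X \<Longrightarrow> w \<in> cells (T X) k \<Longrightarrow> shape k w \<in> cells (T gone) k"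
  by (rule T_map_mem[OF globular_map_bang _ globular_gone])

lemma shape_glob: "globular_set X \<Longrightarrow> globular_map (T X) (T gone) shape"
  by (rule T_map_glob[OF globular_map_bang _ globular_gone])

lemma tm_wf_Idt_pow: "tm_wf gone k ((Idt ^^ k) (Gen ()))"
  by (induction k) (auto simp: gone_def)

lemma id_arity_mem: "id_arity k \<in> cells (T gone) k"
  unfolding id_arity_def by (rule tm_class_in_T[OF tm_wf_Idt_pow])

lemma oid_id_arity: "oid (T_omega gone) k (id_arity k) = id_arity (Suc k)"
  unfolding id_arity_def by (simp add: oid_T_class tm_wf_Idt_pow)

lemma bdry_id_arity:
  "src (T gone) k (id_arity (Suc k)) = id_arity k" "tgt (T gone) k (id_arity (Suc k)) = id_arity k"
  unfolding oid_id_arity[symmetric]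
  using strict_omega_cat.src_id[OF T_omega_cat[OF globular_gone] id_arity_mem]
    strict_omega_cat.tgt_id[OF T_omega_cat[OF globular_gone] id_arity_mem] by auto

text \<open>\<open>id_arity k\<close> is the iterated identity on its own
  \<open>p\<close>-dimensional boundary, so the left unit law applies to it.\<close>

lemma ocomp_id_arity:
  assumes "p < k"
  shows "ocomp (T_omega gone) p k (id_arity k) (id_arity k) = id_arity k"
proof -
  have 1: "p \<le> k \<Longrightarrow> bd (tgt (T gone)) p k (id_arity k) = id_arity p" for k
  proof (induction k)
    case (Suc k)
    then show ?case by (cases "p = Suc k") (simp_all add: bdry_id_arity)
  qed simp
  have 2: "p \<le> k \<Longrightarrow> oids (oid (T_omega gone)) p k (id_arity p) = id_arity k" for k
  proof (induction k)
    case (Suc k)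
    then show ?case by (cases "p = Suc k") (simp_all add: oid_id_arity)
  qed simp
  show ?thesis
    using strict_omega_cat.unit_left[OF T_omega_cat[OF globular_gone] id_arity_mem assms] 1[of k] 2[of k] assms by simp
qed

section \<open>The terminal collection and its copowers\<close>

lemma terminal_coll_sel [simp]:
  "cells terminal_coll = cells (T gone)" "src terminal_coll = src (T gone)" "tgt terminal_coll = tgt (T gone)"
  "ar terminal_coll k x = x"
  by (simp_all add: terminal_coll_def)

lemma globular_terminal: "globular_set terminal_coll"
  using globular_T[OF globular_gone] by (simp add: globular_set_def)

lemma globular_map_terminal: "globular_map X terminal_coll f \<longleftrightarrow> globular_map X (T gone) f"
  by (simp add: globular_map_def)

lemma copower_sel [simp]:
  "cells (copower S X) k = S \<times> cells X k" "src (copower S X) k z = (fst z, src X k (snd z))"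
  "tgt (copower S X) k z = (fst z, tgt X k (snd z))" "ar (copower S X) k z = ar X k (snd z)"
  by (simp_all add: copower_def map_prod_def split: prod.split)

lemma globular_copower: "globular_set X \<Longrightarrow> globular_set (copower S X)"
  by (auto simp: globular_set_def)

lemma globular_copower_in: "s \<in> S \<Longrightarrow> globular_map X (copower S X) (copower_in s)"
  by (auto simp: globular_map_def copower_in_def)

lemma globular_copower_snd: "globular_map (copower S X) X (\<lambda>_. snd)"
  by (auto simp: globular_map_def)

text \<open>Labelling cells by their summand recovers \<open>s\<close>, and the projection that
  forgets summands recovers \<open>w\<close>. This provides the uniqueness behind the definite
  description in \<open>globularization\<close>.\<close>

lemma T_copower_in_inj:
  assumes X: "globular_set X" and s: "s \<in> S" and s': "s' \<in> S"
    and w: "w \<in> cells (T X) k" and w': "w' \<in> cells (T X) k"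
    and eq: "T_map (copower S X) (copower_in s) k w = T_map (copower S X) (copower_in s') k w'"
  shows "s = s' \<and> w = w'"
proof
  have lab: "globular_map (copower S X) (gdisc S) (\<lambda>_. fst)"
    by (auto simp: globular_map_def gdisc_def)
  have 1: "T_label S (\<lambda>_. fst) k (T_map (copower S X) (copower_in s) k w) = s"
    if s: "s \<in> S" and w: "w \<in> cells (T X) k" for s w
  proof (rule functor_eqI[OF X _ functor_const[OF s] _ w])
    note in_s = globular_copower_in[OF s, of X]
    show "strict_omega_functor (T X) (T_omega X) (gdisc S) disc_str
       (\<lambda>k w. T_label S (\<lambda>_. fst) k (T_map (copower S X) (copower_in s) k w))"
      by (rule functor_comp[OF globular_T[OF X] T_map_functor[OF in_s X globular_copower[OF X]]
            T_label_functor[OF globular_copower[OF X] lab]])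
    show "T_label S (\<lambda>_. fst) k (T_map (copower S X) (copower_in s) k (T_eta X k x)) = s" if "x \<in> cells X k" for k x
      using globular_map_mem[OF in_s that]
      by (simp add: T_map_eta[OF in_s X that] T_label_eta[OF globular_copower[OF X] lab] copower_in_def)
  qed
  show "s = s'" using 1[OF s w] 1[OF s' w'] eq by simp
  have 2: "T_map X (\<lambda>_. snd) k (T_map (copower S X) (copower_in s) k w) = w" if s: "s \<in> S" and w: "w \<in> cells (T X) k" for s w
    unfolding T_map_comp[OF globular_copower_in[OF s] globular_copower_snd X globular_copower[OF X] X w]
    by (rule T_map_ident[OF X w]) (simp add: copower_in_def)
  show "w = w'" using 2[OF s w] 2[OF s' w'] eq by simp
qed

text \<open>The composition law on the summand of \<open>g\<close> and \<open>f\<close>. The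
  identity inside \<open>T_map\<close> is the arity map of the terminal collection, so the second
  component is the flattening of \<open>w\<close>.\<close>

lemma gcomp_globularization:
  assumes f: "f \<in> phom P n m" and g: "g \<in> phom P m r" and w: "w \<in> cells (T terminal_coll) k"
  shows "gcomp (globularization P) n m r k
      ((g, shape k w), T_map (copower (phom P n m) terminal_coll) (copower_in f) k w) =
    (pcomp P n m r g f, T_mu gone k (T_map (T gone) (\<lambda>_ x. x) k w))"
proof -
  let ?z = "((g, shape k w), T_map (copower (phom P n m) terminal_coll) (copower_in f) k w)"
  let ?y = "(pcomp P n m r g f, T_mu gone k (T_map (T gone) (\<lambda>_ x. x) k w))"
  have ar: "ar terminal_coll = (\<lambda>_ x. x)" by (simp add: fun_eq_iff)
  have "(THE y. \<exists>g\<in>phom P m r. \<exists>f\<in>phom P n m. \<exists>z'\<in>cells (terminal_coll \<box> terminal_coll) k.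
          ?z = ctensor_map (copower (phom P n m) terminal_coll) (copower_in g) (copower_in f) k z' \<and>
          y = copower_in (pcomp P n m r g f) k (ar (terminal_coll \<box> terminal_coll) k z')) = ?y"
  proof (rule the_equality)
    have "(shape k w, w) \<in> cells (terminal_coll \<box> terminal_coll) k"
      using w shape_mem[OF globular_terminal w] by (simp add: ctensor_def)
    moreover have "?z = ctensor_map (copower (phom P n m) terminal_coll) (copower_in g) (copower_in f) k (shape k w, w)"
      by (simp add: ctensor_map_def copower_in_def)
    moreover have "?y = copower_in (pcomp P n m r g f) k (ar (terminal_coll \<box> terminal_coll) k (shape k w, w))"
      by (simp add: ctensor_def ar copower_in_def)
    ultimately show "\<exists>g\<in>phom P m r. \<exists>f\<in>phom P n m. \<exists>z'\<in>cells (terminal_coll \<box> terminal_coll) k.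
          ?z = ctensor_map (copower (phom P n m) terminal_coll) (copower_in g) (copower_in f) k z' \<and>
          ?y = copower_in (pcomp P n m r g f) k (ar (terminal_coll \<box> terminal_coll) k z')"
      using f g by blast
  next
    fix y assume "\<exists>g\<in>phom P m r. \<exists>f\<in>phom P n m. \<exists>z'\<in>cells (terminal_coll \<box> terminal_coll) k.
          ?z = ctensor_map (copower (phom P n m) terminal_coll) (copower_in g) (copower_in f) k z' \<and>
          y = copower_in (pcomp P n m r g f) k (ar (terminal_coll \<box> terminal_coll) k z')"
    then obtain g' f' b w' where g': "g' \<in> phom P m r" and f': "f' \<in> phom P n m"
      and "(b, w') \<in> cells (terminal_coll \<box> terminal_coll) k"
      and z: "?z = ctensor_map (copower (phom P n m) terminal_coll) (copower_in g') (copower_in f') k (b, w')"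
      and y: "y = copower_in (pcomp P n m r g' f') k (ar (terminal_coll \<box> terminal_coll) k (b, w'))"
      by auto
    then have w': "w' \<in> cells (T terminal_coll) k" by (simp add: ctensor_def)
    have "g' = g" "b = shape k w"
      and "T_map (copower (phom P n m) terminal_coll) (copower_in f) k w =
        T_map (copower (phom P n m) terminal_coll) (copower_in f') k w'"
      using z by (simp_all add: ctensor_map_def copower_in_def)
    with T_copower_in_inj[OF globular_terminal f f' w w']
    show "y = ?y" by (simp add: y ctensor_def ar copower_in_def)
  qed
  then show ?thesis by (simp add: globularization_def)
qed

section \<open>Algebras for the globularization\<close>

text \<open>Covers both choices of \<open>A\<^sup>0\<close>. Since every cell of \<open>A\<^sup>m\<close>, \<open>m > 0\<close>, has arity \<open>id_arity k\<close>, an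
  operation \<open>0 \<rightarrow> m\<close> can act only if all cells of \<open>A\<^sup>0\<close> have this arity too: hence \<open>U_nullary\<close>.\<close>

locale power_arities = PRO P for P :: "'p pro" +
  fixes A :: "'a gset" and U :: "nat \<Rightarrow> arity set"
  assumes glob_A: "globular_set A"
    and id_arity_U: "id_arity k \<in> U k"
    and U_T: "U k \<subseteq> cells (T gone) k"
    and U_bdry: "a \<in> U (Suc k) \<Longrightarrow> src (T gone) k a \<in> U k \<and> tgt (T gone) k a \<in> U k"
    and U_oid: "a \<in> U k \<Longrightarrow> oid (T_omega gone) k a \<in> U (Suc k)"
    and U_ocomp: "composable (T gone) p k b a \<Longrightarrow> b \<in> U k \<Longrightarrow> a \<in> U k \<Longrightarrow> ocomp (T_omega gone) p k b a \<in> U k"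
    and U_nullary: "f \<in> phom P 0 m \<Longrightarrow> 0 < m \<Longrightarrow> U k = {id_arity k}"
begin

abbreviation pw :: "nat \<Rightarrow> (arity \<times> 'a list) coll" where
  "pw \<equiv> cpow U (degen A)"

abbreviation Pw :: "nat \<Rightarrow> 'a list gset" where
  "Pw \<equiv> gpow A"

abbreviation Obj :: "nat \<Rightarrow> nat \<Rightarrow> ('p \<times> arity) coll" where
  "Obj n m \<equiv> copower (phom P n m) terminal_coll"

section \<open>Powers of \<open>A\<close> as collections and the arities of diagrams in them\<close>

lemma glob_T1: "globular_set (T gone)" by (rule globular_T[OF globular_gone])

lemma cells_pw: "(a, xs) \<in> cells (pw n) k \<longleftrightarrow> a \<in> U k \<and> xs \<in> cells (Pw n) k \<and> (0 < n \<longrightarrow> a = id_arity k)"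
proof -
  have "(\<forall>x\<in>set xs. x \<in> cells A k \<and> id_arity k = a) \<longleftrightarrow> set xs \<subseteq> cells A k \<and> (0 < length xs \<longrightarrow> a = id_arity k)"
    by (cases xs) auto
  then show ?thesis by (auto simp: cpow_def degen_def cells_gpow)
qed

lemma pw_sel [simp]:
  "src (pw n) k z = (src (T gone) k (fst z), src (Pw n) k (snd z))"
  "tgt (pw n) k z = (tgt (T gone) k (fst z), tgt (Pw n) k (snd z))"
  "ar (pw n) k z = fst z"
  by (simp_all add: cpow_def degen_def gpow_def map_prod_def split: prod.split)

lemma pw_mem: "z \<in> cells (pw n) k \<longleftrightarrow> fst z \<in> U k \<and> snd z \<in> cells (Pw n) k \<and> (0 < n \<longrightarrow> fst z = id_arity k)"
  using cells_pw[of "fst z" "snd z"] by simp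

lemma glob_Pw: "globular_set (Pw n)" by (rule globular_gpow[OF glob_A])

lemma U_glob:
  assumes "a \<in> U (Suc (Suc k))"
  shows "src (T gone) k (src (T gone) (Suc k) a) = src (T gone) k (tgt (T gone) (Suc k) a)"
    "tgt (T gone) k (src (T gone) (Suc k) a) = tgt (T gone) k (tgt (T gone) (Suc k) a)"
  using glob_T1 subsetD[OF U_T assms] by (auto simp: globular_set_def)

lemma glob_pw: "globular_set (pw n)"
  using glob_Pw[of n] unfolding globular_set_def by (auto simp: pw_mem U_bdry bdry_id_arity U_glob)

lemma snd_map: "globular_map (pw n) (Pw n) (\<lambda>_. snd)"
  by (simp add: globular_map_def pw_mem)

lemma ar_map: "globular_map (pw n) (T gone) (ar (pw n))"
  by (auto simp: globular_map_def pw_mem id_arity_mem intro: subsetD[OF U_T])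

text \<open>A section of the projection to lists. For \<open>n > 0\<close> it is the inverse; for
  \<open>n = 0\<close> it selects the identity arity in each dimension.\<close>

definition emb :: "nat \<Rightarrow> 'a list \<Rightarrow> arity \<times> 'a list" where
  "emb k xs = (id_arity k, xs)"

lemma emb_map: "globular_map (Pw n) (pw n) emb"
  by (simp add: globular_map_def pw_mem emb_def bdry_id_arity id_arity_U)

text \<open>The arity map of any tensor product with right factor \<open>pw n\<close>; it depends on
  the diagram alone.\<close>

definition arT :: "nat \<Rightarrow> nat \<Rightarrow> (arity \<times> 'a list) otm set \<Rightarrow> arity" where
  "arT n k w = T_mu gone k (T_map (T gone) (ar (pw n)) k w)"

lemma arT_functor: "strict_omega_functor (T (pw n)) (T_omega (pw n)) (T gone) (T_omega gone) (arT n)"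
  unfolding arT_def[abs_def]
  by (rule functor_comp[OF globular_T[OF glob_pw] T_map_functor[OF ar_map glob_pw glob_T1] T_mu_functor[OF globular_gone]])

lemma arT_eta: "x \<in> cells (pw n) k \<Longrightarrow> arT n k (T_eta (pw n) k x) = fst x"
  unfolding arT_def using globular_map_mem[OF ar_map, of x n k]
  by (simp add: T_map_eta[OF ar_map glob_pw] T_mu_eta[OF globular_gone])

text \<open>\<open>U\<close> is closed under the operations of \<open>T gone\<close>, and composites
  and identities of identity arities are again identity arities.\<close>

lemma arT_pos:
  assumes "w \<in> cells (T (pw n)) k"
  shows "arT n k w \<in> U k \<and> (0 < n \<longrightarrow> arT n k w = id_arity k)"
  using glob_pw assms
proof (induction rule: T_induct)
  note F = arT_functor[of n, unfolded strict_omega_functor_def]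
  {
    case (eta k x)
    then show ?case using arT_eta[OF eta] by (simp add: pw_mem)
  next
    case (oid k c)
    then show ?case using F by (simp add: U_oid oid_id_arity)
  next
    case (ocomp p k c d)
    have c: "composable (T gone) p k (arT n k c) (arT n k d)"
      by (rule composable_map[OF functor_map[OF arT_functor] globular_T[OF glob_pw] ocomp(1)])
    then have "p < k" by (simp add: composable_def)
    then show ?case using F ocomp U_ocomp[OF c] by (simp add: ocomp_id_arity)
  }
qed

text \<open>What makes an operation into \<open>A^m\<close>, \<open>m > 0\<close>, possible at all.
  For \<open>n > 0\<close> the degeneracy of \<open>A\<close> yields it, for \<open>n = 0\<close> it
  is \<open>U_nullary\<close>.\<close>

lemma arT_forced:
  assumes "f \<in> phom P n m" "0 < m" "w \<in> cells (T (pw n)) k"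
  shows "arT n k w = id_arity k"
  using arT_pos[OF assms(3)] U_nullary[of f m k] assms(1,2) by (cases n) auto

lemma T_snd_mem: "w \<in> cells (T (pw n)) k \<Longrightarrow> T_map (Pw n) (\<lambda>_. snd) k w \<in> cells (T (Pw n)) k"
  by (rule T_map_mem[OF snd_map glob_pw glob_Pw])

lemma T_emb_mem: "c \<in> cells (T (Pw n)) k \<Longrightarrow> T_map (pw n) emb k c \<in> cells (T (pw n)) k"
  by (rule T_map_mem[OF emb_map glob_Pw glob_pw])

lemma T_snd_emb:
  assumes "c \<in> cells (T (Pw n)) k"
  shows "T_map (Pw n) (\<lambda>_. snd) k (T_map (pw n) emb k c) = c"
  unfolding T_map_comp[OF emb_map snd_map glob_Pw glob_pw glob_Pw assms]
  by (rule T_map_ident[OF glob_Pw assms]) (simp add: emb_def)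

lemma arT_emb:
  assumes "c \<in> cells (T (Pw n)) k"
  shows "arT n k (T_map (pw n) emb k c) = id_arity k"
  using glob_Pw assms
proof (induction rule: T_induct)
  note F = functor_comp[OF globular_T[OF glob_Pw] T_map_functor[OF emb_map glob_Pw glob_pw] arT_functor,
      of n]
  note F' = F[unfolded strict_omega_functor_def]
  {
    case (eta k x)
    then show ?case using globular_map_mem[OF emb_map eta]
      by (simp add: T_map_eta[OF emb_map glob_Pw] arT_eta) (simp add: emb_def)
  next
    case (oid k c)
    then show ?case using F' by (simp add: oid_id_arity)
  next
    case (ocomp p k c d)
    then have "p < k" by (simp add: composable_def)
    then show ?case using F' ocomp by (simp add: ocomp_id_arity)
  }
qed

lemma Obj_sel: "gobj (globularization P) n m = Obj n m" by (simp add: globularization_def)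

section \<open>Domains of structure maps and their decomposition by operations\<close>

abbreviation Tns :: "nat \<Rightarrow> nat \<Rightarrow> (('p \<times> arity) \<times> (arity \<times> 'a list) otm set) coll" where
  "Tns n m \<equiv> Obj n m \<box> pw n"

text \<open>The pullback condition determines the arity component, leaving an operation and a
  diagram to be chosen freely.\<close>

lemma cells_Tns: "z \<in> cells (Tns n m) k \<longleftrightarrow>
    (\<exists>f w. z = ((f, shape k w), w) \<and> f \<in> phom P n m \<and> w \<in> cells (T (pw n)) k)"
  using shape_mem[OF glob_pw, of _ n k] by (auto simp: ctensor_def)

lemma Tns_sel [simp]:
  "src (Tns n m) k ((f, a), w) = ((f, src (T gone) k a), src (T (pw n)) k w)"
  "tgt (Tns n m) k ((f, a), w) = ((f, tgt (T gone) k a), tgt (T (pw n)) k w)"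
  "ar (Tns n m) k ((f, a), w) = arT n k w"
  by (simp_all add: ctensor_def arT_def)

lemma shape_src:
  assumes "globular_set X" "w \<in> cells (T X) (Suc k)"
  shows "src (T gone) k (shape (Suc k) w) = shape k (src (T X) k w)"
    "tgt (T gone) k (shape (Suc k) w) = shape k (tgt (T X) k w)"
  using shape_glob[OF assms(1)] assms(2) by (auto simp: globular_map_def)

lemma T_bdry_mem:
  assumes "globular_set X" "w \<in> cells (T X) (Suc k)"
  shows "src (T X) k w \<in> cells (T X) k" "tgt (T X) k w \<in> cells (T X) k"
  using globular_T[OF assms(1)] assms(2) by (auto simp: globular_set_def)

lemma glob_Tns: "globular_set (Tns n m)"
  unfolding globular_set_def[of "Tns n m"]
proof (intro conjI allI ballI)
  fix k z assume "z \<in> cells (Tns n m) (Suc k)"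
  then show "src (Tns n m) k z \<in> cells (Tns n m) k" "tgt (Tns n m) k z \<in> cells (Tns n m) k"
    by (auto simp: cells_Tns shape_src[OF glob_pw] T_bdry_mem[OF glob_pw])
next
  fix k z assume "z \<in> cells (Tns n m) (Suc (Suc k))"
  then obtain f w where z: "z = ((f, shape (Suc (Suc k)) w), w)" and w: "w \<in> cells (T (pw n)) (Suc (Suc k))"
    by (auto simp: cells_Tns)
  note sh = shape_src[OF glob_pw w] shape_src[OF glob_pw T_bdry_mem(1)[OF glob_pw w]]
    shape_src[OF glob_pw T_bdry_mem(2)[OF glob_pw w]]
  show "src (Tns n m) k (src (Tns n m) (Suc k) z) = src (Tns n m) k (tgt (Tns n m) (Suc k) z)"
    "tgt (Tns n m) k (src (Tns n m) (Suc k) z) = tgt (Tns n m) k (tgt (Tns n m) (Suc k) z)"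
    using globular_T[OF glob_pw[of n]] w by (simp_all add: z sh globular_set_def)
qed

text \<open>The inclusion of the summand of \<open>f\<close>: the tensor product is a coproduct of
  copies of \<open>T (pw n)\<close> indexed by operations.\<close>

definition ins :: "'p \<Rightarrow> nat \<Rightarrow> (arity \<times> 'a list) otm set \<Rightarrow> ('p \<times> arity) \<times> (arity \<times> 'a list) otm set" where
  "ins f k w = ((f, shape k w), w)"

lemma ins_map: "f \<in> phom P n m \<Longrightarrow> globular_map (T (pw n)) (Tns n m) (ins f)"
  by (auto simp: globular_map_def ins_def cells_Tns shape_src[OF glob_pw])

lemma Tns_snd_map: "globular_map (Tns n m) (T (pw n)) (\<lambda>_. snd)"
  by (auto simp: globular_map_def cells_Tns)

text \<open>Operation labels are constant along boundaries, so a pasting diagram in \<open>\<P>(n,m) \<box> A\<^sup>n\<close> involves a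
  single operation.\<close>

lemma T_Tns_ins:
  assumes v: "v \<in> cells (T (Tns n m)) k"
  obtains f where "f \<in> phom P n m" "v = T_map (Tns n m) (ins f) k (T_map (T (pw n)) (\<lambda>_. snd) k v)"
proof -
  define lab where "lab = (\<lambda>(k::nat) (z :: ('p \<times> arity) \<times> (arity \<times> 'a list) otm set). fst (fst z))"
  have lab: "globular_map (Tns n m) (gdisc (phom P n m)) lab"
    by (auto simp: globular_map_def cells_Tns gdisc_def lab_def)
  \<comment> \<open>Overwrites the operation by \<open>f\<close> and keeps the diagram, hence fixes
    the cells labelled \<open>f\<close>, as \<open>T_connected\<close> requires.\<close>
  have h: "globular_map (Tns n m) (Tns n m) (\<lambda>k z. ins f k (snd z))" if "f \<in> phom P n m" for f
    by (rule globular_map_comp[OF Tns_snd_map ins_map[OF that]])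
  let ?f = "T_label (phom P n m) lab k v"
  have f: "?f \<in> phom P n m" by (rule T_label_mem[OF glob_Tns lab v])
  have "T_map (Tns n m) (\<lambda>k z. ins ?f k (snd z)) k v = v"
    by (rule T_connected[OF glob_Tns lab h _ v]) (auto simp: cells_Tns ins_def lab_def)
  moreover have "T_map (Tns n m) (ins ?f) k (T_map (T (pw n)) (\<lambda>_. snd) k v) = T_map (Tns n m) (\<lambda>k z. ins ?f k (snd z)) k v"
    by (rule T_map_comp[OF Tns_snd_map ins_map[OF f] glob_Tns globular_T[OF glob_pw] glob_Tns v])
  ultimately show ?thesis using that[OF f] by simp
qed

definition act ::
  "(nat \<Rightarrow> nat \<Rightarrow> nat \<Rightarrow> ('p \<times> arity) \<times> (arity \<times> 'a list) otm set \<Rightarrow> arity \<times> 'a list) \<Rightarrow>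
   nat \<Rightarrow> nat \<Rightarrow> 'p \<Rightarrow> nat \<Rightarrow> (arity \<times> 'a list) otm set \<Rightarrow> arity \<times> 'a list" where
  "act \<Omega> n m f k w = \<Omega> n m k (ins f k w)"

lemma act_map:
  assumes "\<Omega> n m \<in> chom (Tns n m) (pw m)" "f \<in> phom P n m"
  shows "globular_map (T (pw n)) (pw m) (act \<Omega> n m f)"
  unfolding act_def[abs_def]
  by (rule globular_map_comp[OF ins_map[OF assms(2)]]) (use assms in \<open>simp add: chom_def ghom_def\<close>)

text \<open>The shape components need no separate treatment: they are preserved by every \<open>\<T>(f)\<close>.\<close>

lemma assoc_law_iff:
  assumes \<Omega>: "\<And>n m. \<Omega> n m \<in> chom (Tns n m) (pw m)"
  shows "(\<forall>k. \<forall>z\<in>cells (Obj m r \<box> Obj n m \<box> pw n) k.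
       \<Omega> m r k (ctensor_map (pw m) (\<lambda>_. id) (\<Omega> n m) k z) =
       \<Omega> n r k (ctensor_map (pw n) (gcomp (globularization P) n m r) (\<lambda>_. id) k
                  (assoc_inv (Obj n m) (pw n) k z))) \<longleftrightarrow>
    (\<forall>f\<in>phom P n m. \<forall>g\<in>phom P m r. \<forall>k. \<forall>W\<in>cells (T (T (pw n))) k.
       act \<Omega> m r g k (T_map (pw m) (act \<Omega> n m f) k W) = act \<Omega> n r (pcomp P n m r g f) k (T_mu (pw n) k W))"
    (is "(\<forall>k. \<forall>z\<in>?Z k. ?L k z = ?R k z) \<longleftrightarrow> ?rhs")
proof -
  note TP = globular_T[OF glob_pw]
  have \<Omega>m: "globular_map (Tns n m) (pw m) (\<Omega> n m)" using \<Omega>[of n m] by (simp add: chom_def ghom_def)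
  have GO: "globular_set (Obj n m)" by (rule globular_copower[OF globular_terminal])
  have fst_map: "globular_map (Tns n m) (Obj n m) (\<lambda>_. fst)"
    by (auto simp: globular_map_def cells_Tns shape_mem[OF glob_pw])
  \<comment> \<open>Coordinates on the triple tensor product: two operations and a twofold diagram.
    \<open>all\<close> below shows that they reach every cell.\<close>
  define zz where "zz g f k W = ((g, shape k (T_map (Tns n m) (ins f) k W)), T_map (Tns n m) (ins f) k W)" for g f :: 'p and k W
  have mem: "zz g f k W \<in> ?Z k"
    if f: "f \<in> phom P n m" and g: "g \<in> phom P m r" and W: "W \<in> cells (T (T (pw n))) k" for f g k W
    using T_map_mem[OF ins_map[OF f] TP glob_Tns W] shape_mem[OF glob_Tns, of _ n m k] g
    by (simp add: zz_def ctensor_def[of "Obj m r"])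
  have L: "?L k (zz g f k W) = act \<Omega> m r g k (T_map (pw m) (act \<Omega> n m f) k W)"
    if f: "f \<in> phom P n m" and W: "W \<in> cells (T (T (pw n))) k" for f g k W
  proof -
    have 1: "T_map (pw m) (\<Omega> n m) k (T_map (Tns n m) (ins f) k W) = T_map (pw m) (act \<Omega> n m f) k W"
      unfolding act_def[abs_def] by (rule T_map_comp[OF ins_map[OF f] \<Omega>m TP glob_Tns glob_pw W])
    have "shape k (T_map (Tns n m) (ins f) k W) = shape k W"
      by (rule shape_T_map[OF ins_map[OF f] TP glob_Tns W])
    moreover have "shape k (T_map (pw m) (act \<Omega> n m f) k W) = shape k W"
      by (rule shape_T_map[OF act_map[of \<Omega> n m f, OF \<Omega> f] TP glob_pw W])
    ultimately show ?thesis
      by (simp add: zz_def ctensor_map_def 1) (simp add: act_def ins_def)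
  qed
  have R: "?R k (zz g f k W) = act \<Omega> n r (pcomp P n m r g f) k (T_mu (pw n) k W)"
    if f: "f \<in> phom P n m" and g: "g \<in> phom P m r" and W: "W \<in> cells (T (T (pw n))) k" for f g k W
  proof -
    note sh = shape_glob[OF glob_pw, of n]
    have sh': "globular_map (T (pw n)) terminal_coll shape" using sh by (simp add: globular_map_terminal)
    let ?w = "T_map terminal_coll shape k W"
    have w: "?w \<in> cells (T terminal_coll) k" by (rule T_map_mem[OF sh' TP globular_terminal W])
    have e1: "T_map (Obj n m) (\<lambda>_. fst) k (T_map (Tns n m) (ins f) k W) = T_map (Obj n m) (copower_in f) k ?w"
    proof -
      have "T_map (Obj n m) (\<lambda>_. fst) k (T_map (Tns n m) (ins f) k W) = T_map (Obj n m) (\<lambda>k w. fst (ins f k w)) k W"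
        by (rule T_map_comp[OF ins_map[OF f] fst_map TP glob_Tns GO W])
      also have "\<dots> = T_map (Obj n m) (\<lambda>k w. copower_in f k (shape k w)) k W"
        by (simp add: ins_def copower_in_def)
      also have "\<dots> = T_map (Obj n m) (copower_in f) k ?w"
        by (rule T_map_comp[OF sh' globular_copower_in[OF f] TP globular_terminal GO W, symmetric])
      finally show ?thesis .
    qed
    have e2: "T_map (T (pw n)) (\<lambda>_. snd) k (T_map (Tns n m) (ins f) k W) = W"
      unfolding T_map_comp[OF ins_map[OF f] Tns_snd_map TP glob_Tns TP W]
      by (rule T_map_ident[OF TP W]) (simp add: ins_def)
    have e3: "shape k (T_map (Tns n m) (ins f) k W) = shape k ?w"
      unfolding shape_T_map[OF ins_map[OF f] TP glob_Tns W] shape_T_map[OF sh' TP globular_terminal W] ..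
    have idm: "globular_map terminal_coll (T gone) (\<lambda>_ x. x)" by (simp add: globular_map_def)
    \<comment> \<open>Naturality of the multiplication along the map to \<open>gone\<close>: the
      arity assigned to the composite operation is the shape of the flattened diagram.\<close>
    have e4: "T_mu gone k (T_map (T gone) (\<lambda>_ x. x) k ?w) = shape k (T_mu (pw n) k W)"
      unfolding T_map_comp[OF sh' idm TP globular_terminal glob_T1 W]
      using T_map_mu[OF globular_map_bang glob_pw globular_gone W] by simp
    have "T_map (pw n) (\<lambda>_. id) k (T_mu (pw n) k W) = T_mu (pw n) k W"
      by (rule T_map_ident[OF glob_pw T_mu_mem[OF glob_pw W]]) simp
    then show ?thesis
      by (simp add: zz_def ctensor_map_def assoc_inv_def e1 e2 e3 gcomp_globularization[OF f g w] e4)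
        (simp add: act_def ins_def)
  qed
  \<comment> \<open>The inner diagram of operations is connected, so \<open>T_Tns_ins\<close>
    extracts a single \<open>f\<close> from it.\<close>
  have all: "\<exists>f\<in>phom P n m. \<exists>g\<in>phom P m r. \<exists>W\<in>cells (T (T (pw n))) k. z = zz g f k W" if zZ: "z \<in> ?Z k" for k z
  proof -
    obtain g v where z: "z = ((g, shape k v), v)" and g: "g \<in> phom P m r" and v: "v \<in> cells (T (Tns n m)) k"
      using zZ by (auto simp: ctensor_def[of "Obj m r"])
    obtain f where f: "f \<in> phom P n m" and "v = T_map (Tns n m) (ins f) k (T_map (T (pw n)) (\<lambda>_. snd) k v)"
      using T_Tns_ins[OF v] .
    then have "z = zz g f k (T_map (T (pw n)) (\<lambda>_. snd) k v)" by (simp add: zz_def z)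
    moreover have "T_map (T (pw n)) (\<lambda>_. snd) k v \<in> cells (T (T (pw n))) k"
      by (rule T_map_mem[OF Tns_snd_map glob_Tns TP v])
    ultimately show ?thesis using f g by blast
  qed
  show ?thesis
  proof
    assume *: "\<forall>k. \<forall>z\<in>?Z k. ?L k z = ?R k z"
    show ?rhs
    proof (intro ballI allI)
      fix f g k W assume h: "f \<in> phom P n m" "g \<in> phom P m r" "W \<in> cells (T (T (pw n))) k"
      have "?L k (zz g f k W) = ?R k (zz g f k W)" using * mem[OF h] by blast
      then show "act \<Omega> m r g k (T_map (pw m) (act \<Omega> n m f) k W) = act \<Omega> n r (pcomp P n m r g f) k (T_mu (pw n) k W)"
        unfolding L[OF h(1,3)] R[OF h] .
    qed
  next
    assume *: ?rhs
    show "\<forall>k. \<forall>z\<in>?Z k. ?L k z = ?R k z"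
    proof (intro ballI allI)
      fix k z assume "z \<in> ?Z k"
      from all[OF this] obtain f g W where h: "f \<in> phom P n m" "g \<in> phom P m r" "W \<in> cells (T (T (pw n))) k"
        and z: "z = zz g f k W" by blast
      show "?L k z = ?R k z" unfolding z L[OF h(1,3)] R[OF h] using * h by blast
    qed
  qed
qed

lemma cells_pair: "w \<in> cells (pw n \<times>\<^sub>c pw r) k \<longleftrightarrow>
    fst w \<in> cells (pw n) k \<and> snd w \<in> cells (pw r) k \<and> fst (fst w) = fst (snd w)"
  by (cases w) (simp add: cprod_def)

lemma pair_sel: "src (pw n \<times>\<^sub>c pw r) k w = (src (pw n) k (fst w), src (pw r) k (snd w))"
  "tgt (pw n \<times>\<^sub>c pw r) k w = (tgt (pw n) k (fst w), tgt (pw r) k (snd w))"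
  by (cases w; simp add: cprod_def)+

lemma glob_pair: "globular_set (pw n \<times>\<^sub>c pw r)"
  using glob_Pw[of n] glob_Pw[of r] unfolding globular_set_def
  by (auto simp: cells_pair pair_sel pw_mem U_bdry bdry_id_arity U_glob)

lemma pair_fst_map: "globular_map (pw n \<times>\<^sub>c pw r) (pw n) (\<lambda>_. fst)"
  and pair_snd_map: "globular_map (pw n \<times>\<^sub>c pw r) (pw r) (\<lambda>_. snd)"
  by (auto simp: globular_map_def cells_pair pair_sel)

lemma cpow_join_eq: "cpow_join k w = (fst (fst w), snd (fst w) @ snd (snd w))"
  by (simp add: cpow_join_def split: prod.split)

lemma join_map: "globular_map (pw n \<times>\<^sub>c pw r) (pw (n + r)) cpow_join"
  by (auto simp: globular_map_def cells_pair pair_sel cpow_join_eq pw_mem cells_gpow src_gpow tgt_gpow)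

text \<open>Both arity components of a cell on the left are the shape of the same diagram, so such a
  cell amounts to two operations and a diagram of pairs. Joining and projecting leave the shape
  unchanged.\<close>

lemma sum_law_iff:
  "(\<forall>k. \<forall>z\<in>cells ((Obj n m \<times>\<^sub>c Obj r s) \<box> (pw n \<times>\<^sub>c pw r)) k.
       \<Omega> (n + r) (m + s) k (ctensor_map (pw (n + r)) (gsum (globularization P) n m r s) cpow_join k z) =
       cpow_join k (cprod_map (\<Omega> n m) (\<Omega> r s) k (cinterchange (pw n) (pw r) k z))) \<longleftrightarrow>
    (\<forall>f\<in>phom P n m. \<forall>g\<in>phom P r s. \<forall>k. \<forall>w\<in>cells (T (pw n \<times>\<^sub>c pw r)) k.
       act \<Omega> (n + r) (m + s) (psum P n m r s f g) k (T_map (pw (n + r)) cpow_join k w) =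
       cpow_join k (act \<Omega> n m f k (T_map (pw n) (\<lambda>_. fst) k w), act \<Omega> r s g k (T_map (pw r) (\<lambda>_. snd) k w)))"
    (is "(\<forall>k. \<forall>z\<in>?Z k. ?L k z = ?R k z) \<longleftrightarrow> ?rhs")
proof -
  define zz where "zz f g k w = (((f, shape k w), (g, shape k w)), w)" for f g :: 'p and k
    and w :: "((arity \<times> 'a list) \<times> (arity \<times> 'a list)) otm set"
  have Z: "z \<in> ?Z k \<longleftrightarrow> (\<exists>f\<in>phom P n m. \<exists>g\<in>phom P r s. \<exists>w\<in>cells (T (pw n \<times>\<^sub>c pw r)) k. z = zz f g k w)" for z k
    using shape_mem[OF glob_pair, of _ n r k]
    by (cases z) (auto simp: zz_def ctensor_def cprod_def[of "Obj n m" "Obj r s"])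
  have L: "?L k (zz f g k w) = act \<Omega> (n + r) (m + s) (psum P n m r s f g) k (T_map (pw (n + r)) cpow_join k w)"
    if w: "w \<in> cells (T (pw n \<times>\<^sub>c pw r)) k" for f g k w
    using shape_T_map[OF join_map glob_pair glob_pw w]
    by (simp add: zz_def ctensor_map_def globularization_def copower_in_def cprod_def[of terminal_coll] act_def ins_def)
  have R: "?R k (zz f g k w) = cpow_join k (act \<Omega> n m f k (T_map (pw n) (\<lambda>_. fst) k w), act \<Omega> r s g k (T_map (pw r) (\<lambda>_. snd) k w))"
    if w: "w \<in> cells (T (pw n \<times>\<^sub>c pw r)) k" for f g k w
    using shape_T_map[OF pair_fst_map glob_pair glob_pw w] shape_T_map[OF pair_snd_map glob_pair glob_pw w]
    by (simp add: zz_def cprod_map_def cinterchange_def act_def ins_def)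
  show ?thesis
  proof
    assume *: "\<forall>k. \<forall>z\<in>?Z k. ?L k z = ?R k z"
    show ?rhs
    proof (intro ballI allI)
      fix f g k w assume h: "f \<in> phom P n m" "g \<in> phom P r s" "w \<in> cells (T (pw n \<times>\<^sub>c pw r)) k"
      have "?L k (zz f g k w) = ?R k (zz f g k w)" using * h Z by blast
      then show "act \<Omega> (n + r) (m + s) (psum P n m r s f g) k (T_map (pw (n + r)) cpow_join k w) =
        cpow_join k (act \<Omega> n m f k (T_map (pw n) (\<lambda>_. fst) k w), act \<Omega> r s g k (T_map (pw r) (\<lambda>_. snd) k w))"
        unfolding L[OF h(3)] R[OF h(3)] .
    qed
  next
    assume *: ?rhs
    show "\<forall>k. \<forall>z\<in>?Z k. ?L k z = ?R k z"
    proof (intro ballI allI)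
      fix k z assume "z \<in> ?Z k"
      then obtain f g w where h: "f \<in> phom P n m" "g \<in> phom P r s" "w \<in> cells (T (pw n \<times>\<^sub>c pw r)) k"
        and z: "z = zz f g k w" unfolding Z by blast
      show "?L k z = ?R k z" unfolding z L[OF h(3)] R[OF h(3)] using * h by blast
    qed
  qed
qed

text \<open>The shape of a generator is the generator of \<open>T gone\<close>, which is the arity
  that \<open>gunit\<close> supplies.\<close>

lemma unit_law_eq:
  assumes x: "x \<in> cells (pw n) k"
  shows "\<Omega> n n k (ctensor_map (pw n) (gunit (globularization P) n) (\<lambda>_. id) k (lunit_inv (pw n) k x)) =
     act \<Omega> n n (pid P n) k (T_eta (pw n) k x)"
proof -
  have "T_map (pw n) (\<lambda>_. id) k (T_eta (pw n) k x) = T_eta (pw n) k x"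
    by (rule T_map_ident[OF glob_pw T_eta_mem[OF x]]) simp
  moreover have "shape k (T_eta (pw n) k x) = T_eta gone k ()"
    unfolding T_map_eta[OF globular_map_bang glob_pw x] by (simp add: bang_def)
  ultimately show ?thesis
    by (simp add: ctensor_map_def lunit_inv_def globularization_def copower_in_def act_def ins_def)
qed

lemma gpro_algebra_iff:
  "\<Omega> \<in> gpro_algebra U (globularization P) A \<longleftrightarrow>
    (\<forall>n m. \<Omega> n m \<in> chom (Tns n m) (pw m)) \<and>
    (\<forall>n m r. \<forall>f\<in>phom P n m. \<forall>g\<in>phom P m r. \<forall>k. \<forall>W\<in>cells (T (T (pw n))) k.
       act \<Omega> m r g k (T_map (pw m) (act \<Omega> n m f) k W) = act \<Omega> n r (pcomp P n m r g f) k (T_mu (pw n) k W)) \<and>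
    (\<forall>n m r s. \<forall>f\<in>phom P n m. \<forall>g\<in>phom P r s. \<forall>k. \<forall>w\<in>cells (T (pw n \<times>\<^sub>c pw r)) k.
       act \<Omega> (n + r) (m + s) (psum P n m r s f g) k (T_map (pw (n + r)) cpow_join k w) =
       cpow_join k (act \<Omega> n m f k (T_map (pw n) (\<lambda>_. fst) k w), act \<Omega> r s g k (T_map (pw r) (\<lambda>_. snd) k w))) \<and>
    (\<forall>n k. \<forall>x\<in>cells (pw n) k. act \<Omega> n n (pid P n) k (T_eta (pw n) k x) = x)"
\<comment> \<open>The translation of the associativity law presupposes that the structure maps are
  collection homomorphisms; otherwise both sides fail.\<close>
proof (cases "\<forall>n m. \<Omega> n m \<in> chom (Tns n m) (pw m)")
  case True
  then show ?thesis
    by (simp add: gpro_algebra_def Let_def Obj_sel assoc_law_iff sum_law_iff unit_law_eq)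
next
  case False
  then show ?thesis unfolding gpro_algebra_def Let_def Obj_sel mem_Collect_eq by blast
qed

section \<open>Passage between families of maps on lists and structure maps with arities\<close>

definition glob_action ::
  "(nat \<Rightarrow> nat \<Rightarrow> 'p \<Rightarrow> nat \<Rightarrow> 'a list otm set \<Rightarrow> 'a list) \<Rightarrow>
   (nat \<Rightarrow> nat \<Rightarrow> nat \<Rightarrow> ('p \<times> arity) \<times> (arity \<times> 'a list) otm set \<Rightarrow> arity \<times> 'a list)" where
  "glob_action \<omega> n m k = (\<lambda>((f, a), w).
     if ((f, a), w) \<in> cells (Tns n m) k
     then (arT n k w, \<omega> n m f k (T_map (Pw n) (\<lambda>_. snd) k w))
     else undefined)"

lemma act_glob_action:
  "f \<in> phom P n m \<Longrightarrow> w \<in> cells (T (pw n)) k \<Longrightarrow>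
    act (glob_action \<omega>) n m f k w = (arT n k w, \<omega> n m f k (T_map (Pw n) (\<lambda>_. snd) k w))"
  by (simp add: act_def glob_action_def ins_def cells_Tns)

lemma induced_action_eq:
  assumes "(C, \<rho>) \<in> omega_pro_algebra P A"
  shows "induced_action U P A (C, \<rho>) = glob_action (monadic_action P A (C, \<rho>))"
proof (intro ext)
  fix n m k and z :: "('p \<times> arity) \<times> (arity \<times> 'a list) otm set"
  obtain f a w where z: "z = ((f, a), w)" by (metis surj_pair)
  show "induced_action U P A (C, \<rho>) n m k z = glob_action (monadic_action P A (C, \<rho>)) n m k z"
  proof (cases "z \<in> cells (Tns n m) k")
    case True
    then have "f \<in> phom P n m" "w \<in> cells (T (pw n)) k" by (auto simp: cells_Tns z)
    with True show ?thesis
      by (simp add: z induced_action_def glob_action_def monadic_action_def Obj_sel T_snd_mem)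
  next
    case False
    then show ?thesis by (simp add: z induced_action_def glob_action_def Obj_sel)
  qed
qed

text \<open>Each law splits into an arity component, which compares functors into
  \<open>T gone\<close> on generators, and a list component, which is the law for
  \<open>\<omega>\<close> carried along the projection to lists.\<close>

lemma glob_action_mem:
  assumes \<omega>: "\<omega> \<in> monadic_algebra P A"
  shows "glob_action \<omega> \<in> gpro_algebra U (globularization P) A"
proof -
  have \<omega>m: "globular_map (T (Pw n)) (Pw m) (\<omega> n m f)" if "f \<in> phom P n m" for n m f
    using \<omega> that by (simp add: monadic_algebra_def ghom_def)
  note TP = globular_T[OF glob_pw] and TTP = globular_T[OF globular_T[OF glob_pw]] and TPw = globular_T[OF glob_Pw]
  have \<omega>snd: "globular_map (T (pw n)) (Pw m) (\<lambda>k w. \<omega> n m f k (T_map (Pw n) (\<lambda>_. snd) k w))"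
    if "f \<in> phom P n m" for n m f
    by (rule globular_map_comp[OF T_map_glob[OF snd_map glob_pw glob_Pw] \<omega>m[OF that]])
  note arTm = functor_map[OF arT_functor]
  \<comment> \<open>The one place where nullary operations could fail: the result must have an arity
    that occurs in \<open>A^m\<close>.\<close>
  have pwm: "(arT n k w, \<omega> n m f k (T_map (Pw n) (\<lambda>_. snd) k w)) \<in> cells (pw m) k"
    if f: "f \<in> phom P n m" and w: "w \<in> cells (T (pw n)) k" for n m f k w
    using arT_pos[OF w] arT_forced[OF f _ w] globular_map_mem[OF \<omega>snd[OF f] w] by (simp add: cells_pw)
  have chom: "glob_action \<omega> n m \<in> chom (Tns n m) (pw m)" for n m
    unfolding chom_def ghom_def globular_map_def mem_Collect_eq
  proof (intro conjI allI ballI impI)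
    fix k z assume "z \<in> cells (Tns n m) k"
    then obtain f w where z: "z = ((f, shape k w), w)" and f: "f \<in> phom P n m" and w: "w \<in> cells (T (pw n)) k"
      by (auto simp: cells_Tns)
    have e: "glob_action \<omega> n m k z = (arT n k w, \<omega> n m f k (T_map (Pw n) (\<lambda>_. snd) k w))"
      using act_glob_action[OF f w, of \<omega>] by (simp add: act_def ins_def z)
    show "glob_action \<omega> n m k z \<in> cells (pw m) k" unfolding e by (rule pwm[OF f w])
    show "ar (pw m) k (glob_action \<omega> n m k z) = ar (Tns n m) k z" by (simp add: e) (simp add: z)
  next
    fix k z assume "z \<in> cells (Tns n m) (Suc k)"
    then obtain f w where z: "z = ((f, shape (Suc k) w), w)" and f: "f \<in> phom P n m" and w: "w \<in> cells (T (pw n)) (Suc k)"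
      by (auto simp: cells_Tns)
    have e: "glob_action \<omega> n m (Suc k) z = (arT n (Suc k) w, \<omega> n m f (Suc k) (T_map (Pw n) (\<lambda>_. snd) (Suc k) w))"
      using act_glob_action[OF f w, of \<omega>] by (simp add: act_def ins_def z)
    have e': "glob_action \<omega> n m k ((f, shape k w'), w') = (arT n k w', \<omega> n m f k (T_map (Pw n) (\<lambda>_. snd) k w'))"
      if "w' \<in> cells (T (pw n)) k" for w'
      using act_glob_action[OF f that, of \<omega>] by (simp add: act_def ins_def)
    show "glob_action \<omega> n m k (src (Tns n m) k z) = src (pw m) k (glob_action \<omega> n m (Suc k) z)"
      "glob_action \<omega> n m k (tgt (Tns n m) k z) = tgt (pw m) k (glob_action \<omega> n m (Suc k) z)"
      using arTm[of n] \<omega>snd[OF f] w unfolding e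
      by (simp_all add: z shape_src[OF glob_pw w] e' T_bdry_mem[OF glob_pw w] globular_map_def)
  next
    fix k z assume "z \<notin> cells (Tns n m) k"
    then show "glob_action \<omega> n m k z = undefined" by (cases z) (auto simp: glob_action_def)
  qed
  let ?act = "act (glob_action \<omega>)"
  have am: "globular_map (T (pw n)) (pw m) (?act n m f)" if "f \<in> phom P n m" for n m f
    by (rule act_map[of "glob_action \<omega>" n m f, OF chom that])
  show ?thesis
    unfolding gpro_algebra_iff
  proof (intro conjI allI ballI)
    show "glob_action \<omega> n m \<in> chom (Tns n m) (pw m)" for n m by (rule chom)
    show "?act n n (pid P n) k (T_eta (pw n) k x) = x" if x: "x \<in> cells (pw n) k" for n k x
      using \<omega> globular_map_mem[OF snd_map x]
      by (simp add: act_glob_action[OF pid_hom T_eta_mem[OF x]] arT_eta[OF x] T_map_eta[OF snd_map glob_pw x] monadic_algebra_def)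
  next
    fix n m r f g k W
    assume f: "f \<in> phom P n m" and g: "g \<in> phom P m r" and W: "W \<in> cells (T (T (pw n))) k"
    note W' = T_map_mem[OF am[OF f] TP glob_pw W] and \<mu>W = T_mu_mem[OF glob_pw W]
    \<comment> \<open>On the generator on \<open>w\<close> both sides give the arity of
      \<open>w\<close>, because the action preserves arities.\<close>
    have "arT m k (T_map (pw m) (?act n m f) k W) = arT n k (T_mu (pw n) k W)"
    proof (rule functor_eqI[OF TP _ _ _ W])
      show "strict_omega_functor (T (T (pw n))) (T_omega (T (pw n))) (T gone) (T_omega gone)
          (\<lambda>k W. arT m k (T_map (pw m) (?act n m f) k W))"
        by (rule functor_comp[OF TTP T_map_functor[OF am[OF f] TP glob_pw] arT_functor])
      show "strict_omega_functor (T (T (pw n))) (T_omega (T (pw n))) (T gone) (T_omega gone)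
          (\<lambda>k W. arT n k (T_mu (pw n) k W))"
        by (rule functor_comp[OF TTP T_mu_functor[OF glob_pw] arT_functor])
      show "arT m k (T_map (pw m) (?act n m f) k (T_eta (T (pw n)) k w)) = arT n k (T_mu (pw n) k (T_eta (T (pw n)) k w))"
        if w: "w \<in> cells (T (pw n)) k" for k w
        using globular_map_mem[OF am[OF f] w]
        by (simp add: T_map_eta[OF am[OF f] TP w] T_mu_eta[OF glob_pw w] arT_eta) (simp add: act_glob_action[OF f w])
    qed
    moreover have "T_map (Pw m) (\<lambda>_. snd) k (T_map (pw m) (?act n m f) k W) =
       T_map (Pw m) (\<omega> n m f) k (T_map (T (Pw n)) (T_map (Pw n) (\<lambda>_. snd)) k W)"
    proof -
      have "T_map (Pw m) (\<lambda>_. snd) k (T_map (pw m) (?act n m f) k W) = T_map (Pw m) (\<lambda>k w. snd (?act n m f k w)) k W"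
        by (rule T_map_comp[OF am[OF f] snd_map TP glob_pw glob_Pw W])
      also have "\<dots> = T_map (Pw m) (\<lambda>k w. \<omega> n m f k (T_map (Pw n) (\<lambda>_. snd) k w)) k W"
        by (rule T_map_cong[OF globular_map_comp[OF am[OF f] snd_map] TP glob_Pw W]) (simp add: act_glob_action f)
      also have "\<dots> = T_map (Pw m) (\<omega> n m f) k (T_map (T (Pw n)) (T_map (Pw n) (\<lambda>_. snd)) k W)"
        by (rule T_map_comp[OF T_map_glob[OF snd_map glob_pw glob_Pw] \<omega>m[OF f] TP TPw glob_Pw W, symmetric])
      finally show ?thesis .
    qed
    moreover have "\<omega> m r g k (T_map (Pw m) (\<omega> n m f) k (T_map (T (Pw n)) (T_map (Pw n) (\<lambda>_. snd)) k W)) =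
      \<omega> n r (pcomp P n m r g f) k (T_map (Pw n) (\<lambda>_. snd) k (T_mu (pw n) k W))"
      using \<omega> f g T_map_mem[OF T_map_glob[OF snd_map glob_pw glob_Pw] TP TPw W]
      by (simp add: monadic_algebra_def T_map_mu[OF snd_map glob_pw glob_Pw W])
    ultimately show "?act m r g k (T_map (pw m) (?act n m f) k W) = ?act n r (pcomp P n m r g f) k (T_mu (pw n) k W)"
      by (simp add: act_glob_action[OF g W'] act_glob_action[OF pcomp_hom[OF f g] \<mu>W])
  next
    fix n m r s f g k w
    assume f: "f \<in> phom P n m" and g: "g \<in> phom P r s" and w: "w \<in> cells (T (pw n \<times>\<^sub>c pw r)) k"
    note jw = T_map_mem[OF join_map glob_pair glob_pw w] and fw = T_map_mem[OF pair_fst_map glob_pair glob_pw w]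
      and sw = T_map_mem[OF pair_snd_map glob_pair glob_pw w]
    have "arT (n + r) k (T_map (pw (n + r)) cpow_join k w) = arT n k (T_map (pw n) (\<lambda>_. fst) k w)"
    proof (rule functor_eqI[OF glob_pair _ _ _ w])
      show "strict_omega_functor (T (pw n \<times>\<^sub>c pw r)) (T_omega (pw n \<times>\<^sub>c pw r)) (T gone) (T_omega gone)
          (\<lambda>k w. arT (n + r) k (T_map (pw (n + r)) cpow_join k w))"
        by (rule functor_comp[OF globular_T[OF glob_pair] T_map_functor[OF join_map glob_pair glob_pw] arT_functor])
      show "strict_omega_functor (T (pw n \<times>\<^sub>c pw r)) (T_omega (pw n \<times>\<^sub>c pw r)) (T gone) (T_omega gone)
          (\<lambda>k w. arT n k (T_map (pw n) (\<lambda>_. fst) k w))"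
        by (rule functor_comp[OF globular_T[OF glob_pair] T_map_functor[OF pair_fst_map glob_pair glob_pw] arT_functor])
      show "arT (n + r) k (T_map (pw (n + r)) cpow_join k (T_eta (pw n \<times>\<^sub>c pw r) k x)) =
          arT n k (T_map (pw n) (\<lambda>_. fst) k (T_eta (pw n \<times>\<^sub>c pw r) k x))" if x: "x \<in> cells (pw n \<times>\<^sub>c pw r) k" for k x
        using globular_map_mem[OF join_map x] globular_map_mem[OF pair_fst_map x]
        by (simp add: T_map_eta[OF join_map glob_pair x] T_map_eta[OF pair_fst_map glob_pair x] arT_eta cpow_join_eq)
    qed
    moreover have "\<omega> (n + r) (m + s) (psum P n m r s f g) k (T_map (Pw (n + r)) (\<lambda>_. snd) k (T_map (pw (n + r)) cpow_join k w)) =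
      \<omega> n m f k (T_map (Pw n) (\<lambda>_. snd) k (T_map (pw n) (\<lambda>_. fst) k w)) @
      \<omega> r s g k (T_map (Pw r) (\<lambda>_. snd) k (T_map (pw r) (\<lambda>_. snd) k w))"
    proof -
      let ?c = "T_map (Pw (n + r)) (\<lambda>_. snd) k (T_map (pw (n + r)) cpow_join k w)"
      note js = globular_map_comp[OF join_map snd_map, of n r]
      have c: "?c = T_map (Pw (n + r)) (\<lambda>k x. snd (cpow_join k x)) k w"
        by (rule T_map_comp[OF join_map snd_map glob_pair glob_pw glob_Pw w])
      have cT: "?c \<in> cells (T (Pw (n + r))) k" by (rule T_snd_mem[OF jw])
      have "T_map (Pw n) (\<lambda>_. take n) k ?c = T_map (Pw n) (\<lambda>k x. take n (snd (cpow_join k x))) k w"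
        unfolding c by (rule T_map_comp[OF js globular_map_take glob_pair glob_Pw glob_Pw w])
      also have "\<dots> = T_map (Pw n) (\<lambda>_ x. snd (fst x)) k w"
        by (rule T_map_cong[OF globular_map_comp[OF js globular_map_take] glob_pair glob_Pw w])
          (auto simp: cpow_join_eq cells_pair pw_mem cells_gpow)
      also have "\<dots> = T_map (Pw n) (\<lambda>_. snd) k (T_map (pw n) (\<lambda>_. fst) k w)"
        by (rule T_map_comp[OF pair_fst_map snd_map glob_pair glob_pw glob_Pw w, symmetric])
      finally have 1: "T_map (Pw n) (\<lambda>_. take n) k ?c = T_map (Pw n) (\<lambda>_. snd) k (T_map (pw n) (\<lambda>_. fst) k w)" .
      have "T_map (Pw r) (\<lambda>_. drop n) k ?c = T_map (Pw r) (\<lambda>k x. drop n (snd (cpow_join k x))) k w"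
        unfolding c by (rule T_map_comp[OF js globular_map_drop glob_pair glob_Pw glob_Pw w])
      also have "\<dots> = T_map (Pw r) (\<lambda>_ x. snd (snd x)) k w"
        by (rule T_map_cong[OF globular_map_comp[OF js globular_map_drop] glob_pair glob_Pw w])
          (auto simp: cpow_join_eq cells_pair pw_mem cells_gpow)
      also have "\<dots> = T_map (Pw r) (\<lambda>_. snd) k (T_map (pw r) (\<lambda>_. snd) k w)"
        by (rule T_map_comp[OF pair_snd_map snd_map glob_pair glob_pw glob_Pw w, symmetric])
      finally have 2: "T_map (Pw r) (\<lambda>_. drop n) k ?c = T_map (Pw r) (\<lambda>_. snd) k (T_map (pw r) (\<lambda>_. snd) k w)" .
      show ?thesis using \<omega> f g cT unfolding 1[symmetric] 2[symmetric] by (simp add: monadic_algebra_def)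
    qed
    ultimately show "?act (n + r) (m + s) (psum P n m r s f g) k (T_map (pw (n + r)) cpow_join k w) =
       cpow_join k (?act n m f k (T_map (pw n) (\<lambda>_. fst) k w), ?act r s g k (T_map (pw r) (\<lambda>_. snd) k w))"
      by (simp add: act_glob_action[OF psum_hom[OF f g] jw] act_glob_action[OF f fw] act_glob_action[OF g sw] cpow_join_eq)
  qed
qed

lemma glob_action_recover:
  assumes "f \<in> phom P n m" "c \<in> cells (T (Pw n)) k"
  shows "snd (act (glob_action \<omega>) n m f k (T_map (pw n) emb k c)) = \<omega> n m f k c"
  using assms by (simp add: act_glob_action T_emb_mem T_snd_emb)

lemma glob_action_inj: "inj_on glob_action (monadic_algebra P A)"
proof (rule inj_onI, intro ext)
  fix \<omega> \<omega>' n m f k c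
  assume 1: "\<omega> \<in> monadic_algebra P A" and 2: "\<omega>' \<in> monadic_algebra P A" and eq: "glob_action \<omega> = glob_action \<omega>'"
  show "\<omega> n m f k c = \<omega>' n m f k c"
  proof (cases "f \<in> phom P n m \<and> c \<in> cells (T (Pw n)) k")
    case True
    then show ?thesis using glob_action_recover[of f n m c k \<omega>] glob_action_recover[of f n m c k \<omega>'] eq by simp
  next
    case False
    then show ?thesis using 1 2 by (cases "f \<in> phom P n m") (simp_all add: monadic_algebra_def ghom_def)
  qed
qed

text \<open>\<open>\<omega>\<close> is the restriction of \<open>\<Omega>\<close> to diagrams whose
  cells all have identity arity, via \<open>emb\<close>. The remaining task is to see that
  \<open>\<Omega>\<close> is determined on all other diagrams as well.\<close>

lemma glob_action_surj:
  assumes \<Omega>: "\<Omega> \<in> gpro_algebra U (globularization P) A"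
  shows "\<exists>\<omega>\<in>monadic_algebra P A. glob_action \<omega> = \<Omega>"
proof -
  note TP = globular_T[OF glob_pw] and TPw = globular_T[OF glob_Pw]
  have chom: "\<Omega> n m \<in> chom (Tns n m) (pw m)" for n m using \<Omega> by (simp add: gpro_algebra_iff)
  have am: "globular_map (T (pw n)) (pw m) (act \<Omega> n m f)" if "f \<in> phom P n m" for n m f
    by (rule act_map[of \<Omega> n m f, OF chom that])
  have fst_act: "fst (act \<Omega> n m f k w) = arT n k w" if "f \<in> phom P n m" "w \<in> cells (T (pw n)) k" for n m f k w
  proof -
    have "ins f k w \<in> cells (Tns n m) k" by (rule globular_map_mem[OF ins_map[OF that(1)] that(2)])
    then have "ar (pw m) k (\<Omega> n m k (ins f k w)) = ar (Tns n m) k (ins f k w)" using chom[of n m] by (simp add: chom_def)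
    then show ?thesis by (simp add: act_def) (simp add: ins_def)
  qed
  note laws = \<Omega>[unfolded gpro_algebra_iff, THEN conjunct2]
  note law_comp = laws[THEN conjunct1, rule_format] and law_sum = laws[THEN conjunct2, THEN conjunct1, rule_format]
  define \<omega> where "\<omega> n m f = (if f \<in> phom P n m then (\<lambda>k c. if c \<in> cells (T (Pw n)) k
     then snd (act \<Omega> n m f k (T_map (pw n) emb k c)) else undefined) else undefined)" for n m f
  have \<omega>: "\<omega> n m f k c = snd (act \<Omega> n m f k (T_map (pw n) emb k c))"
    if "f \<in> phom P n m" "c \<in> cells (T (Pw n)) k" for n m f k c
    using that by (simp add: \<omega>_def)
  \<comment> \<open>Preservation of arities forces the first component, so the action maps embedded
    diagrams to embedded lists. This lets the laws for \<open>\<Omega>\<close> restrict to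
    \<open>\<omega>\<close>.\<close>
  have ae: "act \<Omega> n m f k (T_map (pw n) emb k c) = emb k (\<omega> n m f k c)"
    if "f \<in> phom P n m" "c \<in> cells (T (Pw n)) k" for n m f k c
    using fst_act[OF that(1) T_emb_mem[OF that(2)]] arT_emb[OF that(2)] by (simp add: \<omega>[OF that] emb_def prod_eq_iff)
  note embT = T_map_glob[OF emb_map glob_Pw glob_pw]
  have aem: "globular_map (T (Pw n)) (pw m) (\<lambda>k c. act \<Omega> n m f k (T_map (pw n) emb k c))" if "f \<in> phom P n m" for n m f
    by (rule globular_map_comp[OF embT am[OF that]])
  have \<omega>m: "globular_map (T (Pw n)) (Pw m) (\<omega> n m f)" if "f \<in> phom P n m" for n m f
    by (rule globular_map_cong[OF globular_map_comp[OF aem[OF that] snd_map] TPw]) (simp add: \<omega> that)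
  have "\<omega> \<in> monadic_algebra P A"
    unfolding monadic_algebra_def mem_Collect_eq
  proof (intro conjI allI ballI impI)
    show "\<omega> n m f \<in> ghom (T (Pw n)) (Pw m)" if "f \<in> phom P n m" for n m f
      using \<omega>m[OF that] that by (simp add: ghom_def \<omega>_def)
    show "\<omega> n m f = undefined" if "f \<notin> phom P n m" for n m f using that by (simp add: \<omega>_def)
    show "\<omega> n n (pid P n) k (T_eta (Pw n) k xs) = xs" if xs: "xs \<in> cells (Pw n) k" for n k xs
    proof -
      have "act \<Omega> n n (pid P n) k (T_eta (pw n) k (emb k xs)) = emb k xs"
        using \<Omega> globular_map_mem[OF emb_map xs] by (simp add: gpro_algebra_iff)
      then show ?thesis by (simp add: \<omega>[OF pid_hom T_eta_mem[OF xs]] T_map_eta[OF emb_map glob_Pw xs]) (simp add: emb_def)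
    qed
  next
    fix n m r f g k W
    assume f: "f \<in> phom P n m" and g: "g \<in> phom P m r" and W: "W \<in> cells (T (T (Pw n))) k"
    let ?W = "T_map (T (pw n)) (T_map (pw n) emb) k W"
    have W': "?W \<in> cells (T (T (pw n))) k" by (rule T_map_mem[OF embT TPw TP W])
    have "T_map (pw m) (act \<Omega> n m f) k ?W = T_map (pw m) (\<lambda>k c. act \<Omega> n m f k (T_map (pw n) emb k c)) k W"
      by (rule T_map_comp[OF embT am[OF f] TPw TP glob_pw W])
    also have "\<dots> = T_map (pw m) (\<lambda>k c. emb k (\<omega> n m f k c)) k W"
      by (rule T_map_cong[OF aem[OF f] TPw glob_pw W]) (rule ae[OF f])
    also have "\<dots> = T_map (pw m) emb k (T_map (Pw m) (\<omega> n m f) k W)"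
      by (rule T_map_comp[OF \<omega>m[OF f] emb_map TPw glob_Pw glob_pw W, symmetric])
    finally have "act \<Omega> m r g k (T_map (pw m) emb k (T_map (Pw m) (\<omega> n m f) k W)) =
       act \<Omega> n r (pcomp P n m r g f) k (T_mu (pw n) k ?W)"
      using law_comp[OF f g W'] by simp
    also have "T_mu (pw n) k ?W = T_map (pw n) emb k (T_mu (Pw n) k W)"
      by (rule T_map_mu[OF emb_map glob_Pw glob_pw W, symmetric])
    finally show "\<omega> m r g k (T_map (Pw m) (\<omega> n m f) k W) = \<omega> n r (pcomp P n m r g f) k (T_mu (Pw n) k W)"
      by (simp add: \<omega>[OF g T_map_mem[OF \<omega>m[OF f] TPw glob_Pw W]] \<omega>[OF pcomp_hom[OF f g] T_mu_mem[OF glob_Pw W]])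
  next
    fix n m r s f g k c
    assume f: "f \<in> phom P n m" and g: "g \<in> phom P r s" and c: "c \<in> cells (T (Pw (n + r))) k"
    \<comment> \<open>Both halves receive the identity arity, so the pair lies in the fibre product;
      joining it again gives \<open>emb\<close>.\<close>
    define spl where "spl = (\<lambda>k (xs :: 'a list). (emb k (take n xs), emb k (drop n xs)))"
    have splm: "globular_map (Pw (n + r)) (pw n \<times>\<^sub>c pw r) spl"
      using globular_map_comp[OF globular_map_take[of A n r] emb_map] globular_map_comp[OF globular_map_drop[of A n r] emb_map]
      unfolding globular_map_def by (auto simp: cells_pair pair_sel spl_def) (auto simp: emb_def)
    let ?w = "T_map (pw n \<times>\<^sub>c pw r) spl k c"
    have w: "?w \<in> cells (T (pw n \<times>\<^sub>c pw r)) k" by (rule T_map_mem[OF splm glob_Pw glob_pair c])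
    have "T_map (pw (n + r)) cpow_join k ?w = T_map (pw (n + r)) (\<lambda>k xs. cpow_join k (spl k xs)) k c"
      by (rule T_map_comp[OF splm join_map glob_Pw glob_pair glob_pw c])
    also have "\<dots> = T_map (pw (n + r)) emb k c"
      by (simp add: cpow_join_eq spl_def emb_def[abs_def])
    finally have 1: "T_map (pw (n + r)) cpow_join k ?w = T_map (pw (n + r)) emb k c" .
    have "T_map (pw n) (\<lambda>_. fst) k ?w = T_map (pw n) (\<lambda>k xs. fst (spl k xs)) k c"
      by (rule T_map_comp[OF splm pair_fst_map glob_Pw glob_pair glob_pw c])
    also have "\<dots> = T_map (pw n) (\<lambda>k xs. emb k (take n xs)) k c" by (simp add: spl_def)
    also have "\<dots> = T_map (pw n) emb k (T_map (Pw n) (\<lambda>_. take n) k c)"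
      by (rule T_map_comp[OF globular_map_take emb_map glob_Pw glob_Pw glob_pw c, symmetric])
    finally have 2: "T_map (pw n) (\<lambda>_. fst) k ?w = T_map (pw n) emb k (T_map (Pw n) (\<lambda>_. take n) k c)" .
    have "T_map (pw r) (\<lambda>_. snd) k ?w = T_map (pw r) (\<lambda>k xs. snd (spl k xs)) k c"
      by (rule T_map_comp[OF splm pair_snd_map glob_Pw glob_pair glob_pw c])
    also have "\<dots> = T_map (pw r) (\<lambda>k xs. emb k (drop n xs)) k c" by (simp add: spl_def)
    also have "\<dots> = T_map (pw r) emb k (T_map (Pw r) (\<lambda>_. drop n) k c)"
      by (rule T_map_comp[OF globular_map_drop emb_map glob_Pw glob_Pw glob_pw c, symmetric])
    finally have 3: "T_map (pw r) (\<lambda>_. snd) k ?w = T_map (pw r) emb k (T_map (Pw r) (\<lambda>_. drop n) k c)" .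
    have "act \<Omega> (n + r) (m + s) (psum P n m r s f g) k (T_map (pw (n + r)) cpow_join k ?w) =
       cpow_join k (act \<Omega> n m f k (T_map (pw n) (\<lambda>_. fst) k ?w), act \<Omega> r s g k (T_map (pw r) (\<lambda>_. snd) k ?w))"
      by (rule law_sum[OF f g w])
    note this[unfolded 1 2 3]
    then show "\<omega> (n + r) (m + s) (psum P n m r s f g) k c =
       \<omega> n m f k (T_map (Pw n) (\<lambda>_. take n) k c) @ \<omega> r s g k (T_map (Pw r) (\<lambda>_. drop n) k c)"
      using T_map_mem[OF globular_map_take glob_Pw glob_Pw c] T_map_mem[OF globular_map_drop glob_Pw glob_Pw c]
      by (simp add: \<omega> f g c psum_hom[OF f g] cpow_join_eq)
  qed
  moreover have "glob_action \<omega> = \<Omega>"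
  proof (intro ext)
    fix n m k z
    show "glob_action \<omega> n m k z = \<Omega> n m k z"
    proof (cases "z \<in> cells (Tns n m) k")
      case False
      then have "\<Omega> n m k z = undefined" using chom[of n m] unfolding chom_def ghom_def by blast
      with False show ?thesis by (cases z) (auto simp: glob_action_def)
    next
      case True
      then obtain f w where z: "z = ins f k w" and f: "f \<in> phom P n m" and w: "w \<in> cells (T (pw n)) k"
        by (auto simp: cells_Tns ins_def)
      have sw: "T_map (Pw n) (\<lambda>_. snd) k w \<in> cells (T (Pw n)) k" by (rule T_snd_mem[OF w])
      have "\<omega> n m f k (T_map (Pw n) (\<lambda>_. snd) k w) = snd (act \<Omega> n m f k w)"
      \<comment> \<open>For \<open>m = 0\<close> both lists are empty, whatever the diagram. For
        \<open>m > 0\<close> the projection to lists loses nothing, since all cells of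
        \<open>pw n\<close> have identity arity: by degeneracy if \<open>n > 0\<close>, by
        \<open>U_nullary\<close> if \<open>n = 0\<close>.\<close>
      proof (cases "m = 0")
        case True
        then show ?thesis using globular_map_mem[OF \<omega>m[OF f] sw] globular_map_mem[OF am[OF f] w]
          by (simp add: pw_mem cells_gpow)
      next
        case False
        have "emb k (snd x) = x" if "x \<in> cells (pw n) k" for k x
          using that False f U_nullary[of f m k] by (cases n) (auto simp: pw_mem emb_def prod_eq_iff)
        then have "T_map (pw n) emb k (T_map (Pw n) (\<lambda>_. snd) k w) = w"
          unfolding T_map_comp[OF snd_map emb_map glob_pw glob_Pw glob_pw w]
          by (intro T_map_ident[OF glob_pw w])
        then show ?thesis by (simp add: \<omega>[OF f sw])
      qed
      then have "act (glob_action \<omega>) n m f k w = act \<Omega> n m f k w"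
        using fst_act[OF f w] by (simp add: act_glob_action[OF f w] prod_eq_iff)
      then show ?thesis by (simp add: act_def z)
    qed
  qed
  ultimately show ?thesis by blast
qed

theorem induced_action_bij:
  "bij_betw (induced_action U P A) (omega_pro_algebra P A) (gpro_algebra U (globularization P) A)"
proof -
  have "bij_betw glob_action (monadic_algebra P A) (gpro_algebra U (globularization P) A)"
    unfolding bij_betw_def using glob_action_inj glob_action_mem glob_action_surj by blast
  then have "bij_betw (glob_action \<circ> monadic_action P A) (omega_pro_algebra P A) (gpro_algebra U (globularization P) A)"
    by (rule bij_betw_trans[OF monadic_action_bij[OF PRO_axioms glob_A]])
  then show ?thesis
    by (rule bij_betw_cong[THEN iffD1, rotated]) (auto simp: induced_action_eq)
qed

end

section \<open>The two choices of the nullary power\<close>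

lemma power_arities_id:
  assumes "PRO P" "globular_set A"
  shows "power_arities P A id_arities"
  using assms unfolding power_arities_def power_arities_axioms_def
  by (auto simp: id_arity_mem bdry_id_arity oid_id_arity composable_def ocomp_id_arity)

text \<open>The hypothesis makes \<open>U_nullary\<close> vacuous; the closure conditions say that
  \<open>T gone\<close> is a strict omega-category.\<close>

lemma power_arities_all:
  assumes "PRO P" "globular_set A" "\<forall>m>0. phom P 0 m = {}"
  shows "power_arities P A all_arities"
proof -
  interpret T1: strict_omega_cat "T gone" "T_omega gone" by (rule T_omega_cat[OF globular_gone])
  show ?thesis
    using assms T1.glob unfolding power_arities_def power_arities_axioms_def globular_set_def
    by (auto simp: id_arity_mem T1.comp_cell T1.id_cell)
qed

theorem theorem13p2:
  fixes P :: "'p pro" and A :: "'a gset"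
  assumes "PRO P" and "globular_set A"
  shows "bij_betw (induced_action id_arities P A)
           (omega_pro_algebra P A)
           (gpro_algebra id_arities (globularization P) A) \<and>
         ((\<forall>m>0. phom P 0 m = {}) \<longrightarrow>
          bij_betw (induced_action all_arities P A)
           (omega_pro_algebra P A)
           (gpro_algebra all_arities (globularization P) A))"
proof (intro conjI impI)
  interpret power_arities P A id_arities
    by (rule power_arities_id[OF assms])
  show "bij_betw (induced_action id_arities P A) (omega_pro_algebra P A)
      (gpro_algebra id_arities (globularization P) A)"
    by (rule induced_action_bij)
next
  assume "\<forall>m>0. phom P 0 m = {}"
  then interpret power_arities P A all_arities
    by (rule power_arities_all[OF assms])
  show "bij_betw (induced_action all_arities P A) (omega_pro_algebra P A)
      (gpro_algebra all_arities (globularization P) A)"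
    by (rule induced_action_bij)
qed

end
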